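(* For each $N\ge 2$, let $(X_1(t),\dots,X_N(t))_{t\ge 0}$ be the repeated averaging $N$-particle system with values in $\mathbb{R}_+=[0,\infty)$: to each unordered pair $\{i,j\}$, $i\neq j$, is attached an independent Poisson clock of intensity $1/N$, and when the clock of $\{i,j\}$ rings the wealths are updated by $$(X_i,X_j)\mapsto\left(\frac{X_i+X_j}{2},\frac{X_i+X_j}{2}\right),$$ all the other $X_k$ being unchanged. Let $$\rho_{\mathrm{emp}}(t)=\frac1N\sum_{i=1}^N\delta_{X_i(t)}$$ be its empirical distribution at time $t$. Let $\rho(t)=\rho(t,\cdot)$ be the solution of $$\partial_t\rho(t,x)=2\int_0^{2x}\rho(t,y)\,\rho(t,2x-y)\,\mathrm{d}y-\rho(t,x),\qquad t\ge 0,\ x\ge 0,$$ with initial data $\rho(0)$, a probability density on $\mathbb{R}_+$. If $$\mathbb{E}\big[W_1(\rho_{\mathrm{emp}}(0),\rho(0))\big]\to 0\quad\text{as }N\to\infty,$$ then for any fixed $T>0$ and all $0\le t\le T$, $$\mathbb{E}\big[W_1(\rho_{\mathrm{emp}}(t),\rho(t))\big]\to 0\quad\text{as }N\to\infty.$$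
   Context: $W_1$ is the Wasserstein distance of exponent $1$ on probability measures on $\mathbb{R}_+$: $W_1(\mu,\nu)=\sup_{\|\nabla\varphi\|_\infty\le 1}\langle\mu-\nu,\varphi\rangle$, where $\langle\nu,\varphi\rangle=\int\varphi\,\mathrm{d}\nu$ and the supremum is over test functions $\varphi$ with Lipschitz constant at most $1$. A probability density is identified with the probability measure it defines. A solution $\rho(t,x)$ is a classical solution, existing for all $0\le t<\infty$, of the time-integrated form of the equation, $\rho(t,x)=\rho(0,x)+\int_0^t\big(2\int_0^{2x}\rho(s,y)\rho(s,2x-y)\,\mathrm{d}y-\rho(s,x)\big)\,\mathrm{d}s$. *)

theory Defs
  imports "HOL-Probability.Probability"
begin

section \<open>Measures on the half-line and the Wasserstein distance\<close>

definition half_line :: "real measure" where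
  "half_line = restrict_space lborel {0..}"

lemma space_half_line [simp]: "space half_line = {0..}"
  by (simp add: half_line_def space_restrict_space)

definition probability_density :: "(real \<Rightarrow> real) \<Rightarrow> bool" where
  "probability_density f \<longleftrightarrow>
     f \<in> borel_measurable half_line \<and> (\<forall>x\<ge>0. 0 \<le> f x) \<and>
     (\<integral>\<^sup>+ x. ennreal (f x) \<partial>half_line) = 1"

definition density_measure :: "(real \<Rightarrow> real) \<Rightarrow> real measure" where
  "density_measure f = density half_line (\<lambda>x. ennreal (f x))"

lemma sets_density_measure [simp]: "sets (density_measure f) = sets half_line"
  by (simp add: density_measure_def)

lemma prob_space_density_measure:
  assumes "probability_density f"
  shows "prob_space (density_measure f)"
proof
  have f: "(\<lambda>x. ennreal (f x)) \<in> borel_measurable half_line"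
    using assms unfolding probability_density_def by (auto intro: measurable_compose[OF _ measurable_ennreal])
  have "emeasure (density_measure f) (space half_line) = (\<integral>\<^sup>+ x. ennreal (f x) \<partial>half_line)"
    unfolding density_measure_def emeasure_density[OF f sets.top]
    by (intro nn_integral_cong) (simp del: space_half_line)
  then show "emeasure (density_measure f) (space (density_measure f)) = 1"
    using assms by (simp add: probability_density_def density_measure_def)
qed

text \<open>The mean of the Dirac masses at \<open>x 0, \<dots>, x (N - 1)\<close>, as the image of the uniform
  distribution on the indices.\<close>

definition empirical_measure :: "nat \<Rightarrow> (nat \<Rightarrow> real) \<Rightarrow> real measure" where
  "empirical_measure N x = distr (uniform_count_measure {..<N}) half_line x"

lemma sets_empirical_measure [simp]: "sets (empirical_measure N x) = sets half_line"
  by (simp add: empirical_measure_def)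

lemma measurable_indices:
  "x \<in> uniform_count_measure {..<N} \<rightarrow>\<^sub>M half_line" if "\<And>i. i < N \<Longrightarrow> 0 \<le> x i"
  using that by (auto simp: measurable_def sets_uniform_count_measure space_uniform_count_measure)

lemma emeasure_empirical_measure:
  assumes "\<And>i. i < N \<Longrightarrow> 0 \<le> x i" and "A \<in> sets half_line"
  shows "emeasure (empirical_measure N x) A = ennreal (card {i. i < N \<and> x i \<in> A} / real N)"
proof -
  have "x -` A \<inter> {..<N} = {i. i < N \<and> x i \<in> A}" by auto
  then show ?thesis
    using assms measurable_indices[of N x]
      emeasure_uniform_count_measure[of "{..<N}" "{i. i < N \<and> x i \<in> A}"]
    unfolding empirical_measure_def
    by (subst emeasure_distr) (auto simp: space_uniform_count_measure)
qed

text \<open>The distance takes values in \<open>[0, \<infinity>]\<close>. As the Bochner integral of a non-integrable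
  function is \<open>0\<close> by convention, the test functions are required to be integrable. Bounded test
  functions are always admitted and suffice to attain the supremum, so it is \<open>\<infinity>\<close> as soon as
  exactly one of the two measures has infinite mean. Truncating negative values to \<open>0\<close>, as
  \<open>ennreal\<close> does, does not change the supremum, since \<open>\<phi> = 0\<close> is a test function.\<close>

definition wasserstein1 :: "real measure \<Rightarrow> real measure \<Rightarrow> ennreal" where
  "wasserstein1 \<mu> \<nu> =
     (SUP \<phi> \<in> {\<phi>. 1-lipschitz_on {0..} \<phi> \<and> integrable \<mu> \<phi> \<and> integrable \<nu> \<phi>}.
        ennreal ((\<integral>x. \<phi> x \<partial>\<mu>) - (\<integral>x. \<phi> x \<partial>\<nu>)))"


section \<open>The limit equation\<close>

text \<open>Classical solutions of the time-integrated equation: the equation holds for all \<open>t\<close> and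
  \<open>x\<close>, and its integrals exist. Joint measurability of \<open>\<rho>\<close> is not assumed; it follows from
  measurability in \<open>x\<close> together with the equation, which makes \<open>\<rho>\<close> continuous in \<open>t\<close>.\<close>

definition averaging_rate :: "(real \<Rightarrow> real) \<Rightarrow> real \<Rightarrow> real" where
  "averaging_rate f x = 2 * (LBINT y:{0..2 * x}. f y * f (2 * x - y)) - f x"

definition averaging_solution :: "(real \<Rightarrow> real \<Rightarrow> real) \<Rightarrow> bool" where
  "averaging_solution \<rho> \<longleftrightarrow>
     (\<forall>t\<ge>0. probability_density (\<rho> t)) \<and>
     (\<forall>t\<ge>0. \<forall>x\<ge>0.
        set_integrable lborel {0..2 * x} (\<lambda>y. \<rho> t y * \<rho> t (2 * x - y)) \<and>
        set_integrable lborel {0..t} (\<lambda>s. averaging_rate (\<rho> s) x) \<and>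
        \<rho> t x = \<rho> 0 x + (LBINT s:{0..t}. averaging_rate (\<rho> s) x))"


section \<open>The particle system\<close>

text \<open>\<open>K t \<omega>\<close> is the number of rings up to time \<open>t\<close>. The subtraction of natural numbers is
  harmless, as the paths are almost surely nondecreasing.\<close>

locale poisson_process = prob_space M
  for M :: "'w measure" and rate :: real and K :: "real \<Rightarrow> 'w \<Rightarrow> nat" +
  assumes measurable_K: "\<And>t. 0 \<le> t \<Longrightarrow> K t \<in> M \<rightarrow>\<^sub>M count_space UNIV"
    and paths: "AE \<omega> in M. K 0 \<omega> = 0 \<and> mono_on {0..} (\<lambda>t. K t \<omega>) \<and>
      (\<forall>t\<ge>0. continuous (at_right t) (\<lambda>s. K s \<omega>))"
    and poisson_increments: "\<And>s t. 0 \<le> s \<Longrightarrow> s < t \<Longrightarrow>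
      distr M (count_space UNIV) (\<lambda>\<omega>. K t \<omega> - K s \<omega>) = measure_pmf (poisson_pmf (rate * (t - s)))"
    and independent_increments: "\<And>n (\<tau> :: nat \<Rightarrow> real). mono \<tau> \<Longrightarrow> 0 \<le> \<tau> 0 \<Longrightarrow>
      indep_vars (\<lambda>_. count_space UNIV) (\<lambda>i \<omega>. K (\<tau> (Suc i)) \<omega> - K (\<tau> i) \<omega>) {..<n}"

definition rings_at :: "(real \<Rightarrow> nat) \<Rightarrow> real \<Rightarrow> bool" where
  "rings_at k t \<longleftrightarrow> 0 < t \<and> (\<forall>s. 0 \<le> s \<and> s < t \<longrightarrow> k s < k t)"

definition pairs :: "nat \<Rightarrow> nat set set" where
  "pairs N = {{i, j} | i j. i < N \<and> j < N \<and> i \<noteq> j}"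

definition average_pair :: "nat \<Rightarrow> nat \<Rightarrow> (nat \<Rightarrow> real) \<Rightarrow> (nat \<Rightarrow> real)" where
  "average_pair i j x = x(i := (x i + x j) / 2, j := (x i + x j) / 2)"

text \<open>Particles are numbered \<open>0, \<dots>, N - 1\<close>; the values of \<open>X t \<omega>\<close> at other indices are
  irrelevant. The clocks are independent of each other and, jointly, of the initial wealths.
  Almost surely, the path is constant on every interval without rings, and when a clock rings the
  update is applied to the state immediately before. Almost surely there are no simultaneous
  rings, so the conditions of \<open>jumps\<close> for different pairs do not conflict.\<close>

locale repeated_averaging = prob_space M
  for M :: "'w measure" and N :: nat and X :: "real \<Rightarrow> 'w \<Rightarrow> nat \<Rightarrow> real"
    and K :: "nat set \<Rightarrow> real \<Rightarrow> 'w \<Rightarrow> nat" +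
  assumes measurable_X: "\<And>t i. 0 \<le> t \<Longrightarrow> i < N \<Longrightarrow> (\<lambda>\<omega>. X t \<omega> i) \<in> borel_measurable M"
    and nonneg_X: "\<And>t i \<omega>. 0 \<le> t \<Longrightarrow> i < N \<Longrightarrow> \<omega> \<in> space M \<Longrightarrow> 0 \<le> X t \<omega> i"
    and clocks: "\<And>p. p \<in> pairs N \<Longrightarrow> poisson_process M (1 / real N) (K p)"
    and independent_clocks:
      "indep_vars (\<lambda>_. Pi\<^sub>M {0..} (\<lambda>_. count_space UNIV)) (\<lambda>p \<omega>. \<lambda>t\<in>{0..}. K p t \<omega>) (pairs N)"
    and independent_initial:
      "indep_set
         (sets (vimage_algebra (space M) (\<lambda>\<omega>. \<lambda>i\<in>{..<N}. X 0 \<omega> i) (Pi\<^sub>M {..<N} (\<lambda>_. borel))))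
         (sets (vimage_algebra (space M) (\<lambda>\<omega>. \<lambda>p\<in>pairs N. \<lambda>t\<in>{0..}. K p t \<omega>)
           (Pi\<^sub>M (pairs N) (\<lambda>_. Pi\<^sub>M {0..} (\<lambda>_. count_space UNIV)))))"
    and constant_between_rings: "AE \<omega> in M. \<forall>s t. 0 \<le> s \<and> s \<le> t \<and>
        (\<forall>p\<in>pairs N. \<forall>u\<in>{s<..t}. \<not> rings_at (\<lambda>v. K p v \<omega>) u) \<longrightarrow>
        (\<forall>k<N. X t \<omega> k = X s \<omega> k)"
    and jumps: "AE \<omega> in M. \<forall>t i j. i < N \<and> j < N \<and> i \<noteq> j \<and> rings_at (\<lambda>v. K {i, j} v \<omega>) t \<longrightarrow>
        (\<forall>\<^sub>F s in at_left t. \<forall>k<N. X t \<omega> k = average_pair i j (X s \<omega>) k)"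

end

theory Submission
  imports Defs
begin

text \<open>Laplace transforms turn the equation into a closed hierarchy. If \<open>Y\<close> and \<open>Y'\<close> are independent
with density \<open>\<rho>\<close>, the gain term of the equation is the density of \<open>(Y + Y') / 2\<close>; hence the
transform \<open>L(t, l) = \<integral> exp (- l x) \<rho>(t, x) dx\<close> satisfies
\<open>\<partial>L(t, l)/\<partial>t = L(t, l/2)\<^sup>2 - L(t, l)\<close> (\<open>laplace_integral_equation\<close>). The empirical transform
\<open>u(l) = (1/N) \<Sum>i exp (- l X\<^sub>i)\<close> follows the same law on average, without any error in \<open>N\<close>: summed
over all pairs, its increments give \<open>N (u(l/2)\<^sup>2 - u(l))\<close>, since the diagonal of the double sum
\<open>u(l/2)\<^sup>2\<close> accounts exactly for the missing pairs \<open>i = j\<close> (\<open>sum_pairs_laplace_emp\<close>). A single ring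
changes \<open>u(l)\<close> by at most \<open>2/N\<close>, so the growth rate of the expected squared error
\<open>(u(l) - L(l))\<^sup>2\<close> is at most twice the same quantity at \<open>l/2\<close>, plus a fluctuation of order \<open>1/N\<close>.
The interval \<open>[0, l]\<close> is stable under halving, and there \<open>\<bar>u - L\<bar> \<le> l W\<^sub>1\<close> at time \<open>0\<close>; a Gronwall
argument shows that the error stays small (\<open>funpow_chain_step_laplace_error\<close>).

The particle system is given by paths and clocks. For fixed \<open>N\<close> it is compared with a chain on a
grid of \<open>n\<close> cells of length \<open>h = t/n\<close>. Outside an event of probability \<open>O(1/n)\<close> every cell contains
at most one ring, and then the state at time \<open>t\<close> arises from the initial one by averaging the pairs
selected by the cells (\<open>grid_representation\<close>). These pairs are independent of each other and of the
initial state, so an expectation at time \<open>t\<close> is, up to \<open>O(1/n)\<close>, the expectation at time \<open>0\<close> of the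
\<open>n\<close>-fold image of the test function under an explicit one-step operator (\<open>chain_expectation\<close>).
The Gronwall bound holds for this operator at each deterministic initial state, and \<open>n \<rightarrow> \<infinity>\<close>
removes the discretization error (\<open>expectation_laplace_error_le\<close>).

To return to \<open>W\<^sub>1\<close>, a Lipschitz function that is constant beyond \<open>R\<close> is a Lipschitz function of
\<open>exp (- x)\<close>, and Bernstein polynomials approximate it at a rate that depends only on the Lipschitz
constant; so finitely many transforms \<open>L(0), \<dots>, L(n)\<close> control all test functions at once. The tails
are controlled by the first moments (\<open>wasserstein1_le\<close>). Averaging preserves the empirical mean
(\<open>mean_conserved\<close>), and \<open>\<rho>(t)\<close> has the same mean as \<open>\<rho>(0)\<close>: it is not smaller because
\<open>L(t, l)\<close> decreases in time (\<open>laplace_decreasing_in_time\<close>), and not larger because the inequality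
\<open>1 - u(l) \<le> l (mean)\<close> of the particle system passes to the limit (\<open>laplace_slope_later_le\<close>).
\<close>

section \<open>Laplace transforms of densities on the half-line\<close>

text \<open>Densities are only prescribed on the half-line; extension by zero removes the range conditions
from convolutions and changes of variable.\<close>
definition density_ext :: "(real \<Rightarrow> real) \<Rightarrow> real \<Rightarrow> real" where
  "density_ext f x = (if 0 \<le> x then f x else 0)"

definition laplace :: "real measure \<Rightarrow> real \<Rightarrow> real" where
  "laplace \<nu> l = (\<integral>x. exp (- l * x) \<partial>\<nu>)"

lemma density_ext_nonneg: "probability_density f \<Longrightarrow> 0 \<le> density_ext f x"
  by (simp add: density_ext_def probability_density_def)

lemma measurable_density_ext:
  assumes "probability_density f"
  shows "density_ext f \<in> borel_measurable borel"
proof -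
  have "f \<in> borel_measurable (restrict_space lborel {0..})"
    using assms by (simp add: probability_density_def half_line_def)
  then have "(\<lambda>x. if x \<in> {0..} then f x else 0) \<in> borel_measurable lborel"
    by (subst (asm) measurable_restrict_space_iff) auto
  then show ?thesis by (simp add: density_ext_def[abs_def])
qed

lemma measurable_half_lineI [measurable (raw)]:
  "f \<in> borel_measurable borel \<Longrightarrow> f \<in> borel_measurable half_line"
  unfolding half_line_def by (rule measurable_restrict_space1) simp

lemma measurable_id_half_line: "(\<lambda>y. y) \<in> borel_measurable half_line"
  by measurable

lemma nn_integral_density_measure:
  assumes f: "probability_density f" and [measurable]: "g \<in> borel_measurable borel"
  shows "(\<integral>\<^sup>+x. g x \<partial>density_measure f) = (\<integral>\<^sup>+x. ennreal (density_ext f x) * g x \<partial>lborel)"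
proof -
  have [measurable]: "f \<in> borel_measurable half_line"
    using f by (simp add: probability_density_def)
  have "(\<integral>\<^sup>+x. g x \<partial>density_measure f) = (\<integral>\<^sup>+x. ennreal (f x) * g x \<partial>half_line)"
    unfolding density_measure_def by (rule nn_integral_density) simp_all
  also have "\<dots> = (\<integral>\<^sup>+x. ennreal (f x) * g x * indicator {0..} x \<partial>lborel)"
    unfolding half_line_def by (rule nn_integral_restrict_space) simp
  also have "\<dots> = (\<integral>\<^sup>+x. ennreal (density_ext f x) * g x \<partial>lborel)"
    by (intro nn_integral_cong) (simp add: density_ext_def indicator_def)
  finally show ?thesis .
qed

lemma integrable_exp_on_half_line:
  assumes "prob_space \<nu>" "sets \<nu> = sets half_line" "0 \<le> l"
  shows "integrable \<nu> (\<lambda>x. exp (- l * x))"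
proof -
  interpret prob_space \<nu> by fact
  have sp: "space \<nu> = {0..}" using sets_eq_imp_space_eq[OF assms(2)] by simp
  show ?thesis
  proof (rule integrable_const_bound[where B = 1])
    show "AE x in \<nu>. norm (exp (- l * x)) \<le> 1"
      using assms(3) by (intro AE_I2) (simp add: sp)
    show "(\<lambda>x. exp (- l * x)) \<in> borel_measurable \<nu>"
      unfolding measurable_cong_sets[OF assms(2) refl] by measurable
  qed
qed

lemma laplace_bounds:
  assumes "prob_space \<nu>" "sets \<nu> = sets half_line" "0 \<le> l"
  shows "0 \<le> laplace \<nu> l" and "laplace \<nu> l \<le> 1"
proof -
  interpret prob_space \<nu> by fact
  have sp: "space \<nu> = {0..}" using sets_eq_imp_space_eq[OF assms(2)] by simp
  show "0 \<le> laplace \<nu> l" unfolding laplace_def by (rule integral_nonneg_AE) simp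
  have "laplace \<nu> l \<le> (\<integral>x. 1 \<partial>\<nu>)"
    unfolding laplace_def using assms(3)
    by (intro integral_mono integrable_exp_on_half_line assms) (auto simp: sp)
  then show "laplace \<nu> l \<le> 1" by (simp add: prob_space)
qed

lemma ennreal_laplace:
  assumes f: "probability_density f" and l: "0 \<le> l"
  shows "ennreal (laplace (density_measure f) l)
    = (\<integral>\<^sup>+x. ennreal (density_ext f x) * ennreal (exp (- l * x)) \<partial>lborel)"
proof -
  note p = prob_space_density_measure[OF f]
  have "ennreal (laplace (density_measure f) l) = (\<integral>\<^sup>+x. ennreal (exp (- l * x)) \<partial>density_measure f)"
    unfolding laplace_def
    by (rule nn_integral_eq_integral[OF integrable_exp_on_half_line[OF p _ l], symmetric]) simp_all
  then show ?thesis using nn_integral_density_measure[OF f, of "\<lambda>x. ennreal (exp (- l * x))"] by simp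
qed

text \<open>The substitution \<open>x = (y + z) / 2\<close> splits the exponential: \<open>exp (- l x) = exp (- l y / 2) exp (- l z / 2)\<close>.
Its Jacobian cancels the factor \<open>2\<close> of the gain term.\<close>
lemma nn_integral_gain:
  fixes r :: "real \<Rightarrow> real"
  assumes [measurable]: "r \<in> borel_measurable borel" and nn: "\<And>x. 0 \<le> r x"
  shows "(\<integral>\<^sup>+x. ennreal (exp (- l * x)) * (2 * (\<integral>\<^sup>+y. ennreal (r y) * ennreal (r (2 * x - y)) \<partial>lborel)) \<partial>lborel)
    = (\<integral>\<^sup>+x. ennreal (r x) * ennreal (exp (- (l/2) * x)) \<partial>lborel)\<^sup>2" (is "?L = ?R\<^sup>2")
proof -
  let ?inner = "\<lambda>y. \<integral>\<^sup>+x. ennreal (exp (- l * x)) * 2 * (ennreal (r y) * ennreal (r (2 * x - y))) \<partial>lborel"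
  let ?split = "\<lambda>y. \<integral>\<^sup>+z. ennreal (r y) * ennreal (exp (- (l/2) * y)) * (ennreal (r z) * ennreal (exp (- (l/2) * z))) \<partial>lborel"
  have "?L = (\<integral>\<^sup>+x. \<integral>\<^sup>+y. ennreal (exp (- l * x)) * 2 * (ennreal (r y) * ennreal (r (2 * x - y))) \<partial>lborel \<partial>lborel)"
    by (simp add: nn_integral_cmult mult.assoc)
  also have "\<dots> = (\<integral>\<^sup>+y. ?inner y \<partial>lborel)"
    by (rule lborel_pair.Fubini'[symmetric]) measurable
  also have "\<dots> = (\<integral>\<^sup>+y. ?split y \<partial>lborel)"
  proof (rule nn_integral_cong)
    fix y :: real
    have "?inner y = ennreal \<bar>1/2\<bar> * (\<integral>\<^sup>+z. ennreal (exp (- l * (y/2 + 1/2 * z))) * 2 * (ennreal (r y) * ennreal (r (2 * (y/2 + 1/2*z) - y))) \<partial>lborel)"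
      by (rule nn_integral_real_affine) (simp_all, measurable)
    also have "\<dots> = (\<integral>\<^sup>+z. ennreal \<bar>1/2\<bar> * (ennreal (exp (- l * (y/2 + 1/2 * z))) * 2 * (ennreal (r y) * ennreal (r (2 * (y/2 + 1/2*z) - y)))) \<partial>lborel)"
      by (rule nn_integral_cmult[symmetric]) measurable
    also have "\<dots> = ?split y"
    proof (rule nn_integral_cong)
      fix z :: real
      have e: "exp (- l * (y/2 + 1/2 * z)) = exp (- (l/2) * y) * exp (- (l/2) * z)"
        by (simp add: exp_add[symmetric] algebra_simps)
      have s: "2 * (y/2 + 1/2*z) - y = z" by simp
      have two: "(2::ennreal) = ennreal 2" by simp
      show "ennreal \<bar>1/2\<bar> * (ennreal (exp (- l * (y/2 + 1/2 * z))) * 2 * (ennreal (r y) * ennreal (r (2 * (y/2 + 1/2*z) - y))))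
        = ennreal (r y) * ennreal (exp (- (l/2) * y)) * (ennreal (r z) * ennreal (exp (- (l/2) * z)))"
        unfolding e s two using nn[of y] nn[of z]
        by (simp only: ennreal_mult[symmetric] mult_nonneg_nonneg exp_ge_zero abs_ge_zero zero_le_numeral)
           (simp add: algebra_simps)
    qed
    finally show "?inner y = ?split y" .
  qed
  also have "\<dots> = (\<integral>\<^sup>+y. ennreal (r y) * ennreal (exp (- (l/2) * y)) * ?R \<partial>lborel)"
    by (intro nn_integral_cong nn_integral_cmult) measurable
  also have "\<dots> = ?R\<^sup>2"
    unfolding power2_eq_square by (rule nn_integral_multc) measurable
  finally show ?thesis .
qed

section \<open>The limit equation in Laplace variables\<close>

lemma solution_density:
  "averaging_solution \<rho> \<Longrightarrow> 0 \<le> s \<Longrightarrow> probability_density (\<rho> s)"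
  unfolding averaging_solution_def by blast

text \<open>The integrated equation writes \<open>\<rho>\<close> as an indefinite integral in time.\<close>
lemma solution_path_continuous:
  assumes sol: "averaging_solution \<rho>" and x: "0 \<le> x" and T: "0 \<le> T"
  shows "continuous_on {0..T} (\<lambda>s. \<rho> s x)"
proof -
  let ?g = "\<lambda>s. averaging_rate (\<rho> s) x"
  have int: "set_integrable lborel {0..s} ?g" if "0 \<le> s" for s
    using sol x that unfolding averaging_solution_def by blast
  have "continuous_on {0..T} (\<lambda>s. \<rho> 0 x + integral {0..s} ?g)"
    using set_borel_integral_eq_integral(1)[OF int[OF T]]
    by (intro continuous_intros indefinite_integral_continuous_1)
  moreover have "\<rho> 0 x + integral {0..s} ?g = \<rho> s x" if "s \<in> {0..T}" for s
  proof -
    have s: "0 \<le> s" using that by simp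
    have "\<rho> s x = \<rho> 0 x + (LBINT u:{0..s}. ?g u)"
      using sol s x unfolding averaging_solution_def by blast
    then show ?thesis using set_borel_integral_eq_integral(2)[OF int[OF s]] by (simp only:)
  qed
  ultimately show ?thesis
    by (rule continuous_on_eq)
qed

text \<open>Fubini's theorem on the integrated equation needs joint measurability. Continuity in time reduces it
to rational times: \<open>\<rho>(s, x)\<close> is the limit of \<open>\<rho>(\<lfloor>n s\<rfloor> / n, x)\<close>, which takes countably many
measurable functions of \<open>x\<close>.\<close>
lemma solution_jointly_measurable:
  assumes sol: "averaging_solution \<rho>"
  shows "(\<lambda>(s, x). density_ext (\<rho> (max 0 s)) x) \<in> borel_measurable (borel \<Otimes>\<^sub>M borel)"
proof -
  \<comment> \<open>\<open>max 0 s\<close> keeps the approximating times in the domain of the solution.\<close>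
  define a where "a n s = real (nat \<lfloor>real (Suc n) * max 0 s\<rfloor>) / real (Suc n)" for n :: nat and s :: real
  have a0: "0 \<le> a n s" for n s by (simp add: a_def)
  have a1: "a n s \<le> max 0 s" for n s
  proof -
    have "real (nat \<lfloor>real (Suc n) * max 0 s\<rfloor>) \<le> real (Suc n) * max 0 s"
      by (rule of_nat_floor) simp
    then show ?thesis by (simp add: a_def field_simps)
  qed
  have a2: "max 0 s - 1 / real (Suc n) \<le> a n s" for n s
  proof -
    have "real (Suc n) * max 0 s - 1 \<le> real (nat \<lfloor>real (Suc n) * max 0 s\<rfloor>)" by linarith
    then have "(real (Suc n) * max 0 s - 1) / real (Suc n) \<le> a n s"
      unfolding a_def by (rule divide_right_mono) simp
    then show ?thesis by (simp add: diff_divide_distrib)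
  qed
  have alim: "(\<lambda>n. a n s) \<longlonglongrightarrow> max 0 s" for s
  proof (rule tendsto_sandwich)
    show "(\<lambda>n. max 0 s - 1 / real (Suc n)) \<longlonglongrightarrow> max 0 s"
      using tendsto_diff[OF tendsto_const[of "max 0 s"] LIMSEQ_inverse_real_of_nat] by (simp add: inverse_eq_divide)
  qed (use a1 a2 in auto)
  have meas: "(\<lambda>z. density_ext (\<rho> (a n (fst z))) (snd z)) \<in> borel_measurable (borel \<Otimes>\<^sub>M borel)" for n
    unfolding a_def
  proof (rule measurable_compose_countable[where f = "\<lambda>k z. density_ext (\<rho> (real k / real (Suc n))) (snd z)"])
    fix k :: nat
    have "probability_density (\<rho> (real k / real (Suc n)))"
      by (rule solution_density[OF sol]) simp
    from measurable_density_ext[OF this]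
    show "(\<lambda>z. density_ext (\<rho> (real k / real (Suc n))) (snd z)) \<in> borel_measurable (borel \<Otimes>\<^sub>M borel)"
      by measurable
  qed measurable
  have lim: "(\<lambda>n. density_ext (\<rho> (a n (fst z))) (snd z)) \<longlonglongrightarrow> density_ext (\<rho> (max 0 (fst z))) (snd z)"
    for z :: "real \<times> real"
  proof (cases "0 \<le> snd z")
    case True
    define m where "m = max 0 (fst z)"
    have "continuous_on {0..m} (\<lambda>s. \<rho> s (snd z))"
      by (rule solution_path_continuous[OF sol True]) (simp add: m_def)
    then have "(\<lambda>n. \<rho> (a n (fst z)) (snd z)) \<longlonglongrightarrow> \<rho> m (snd z)"
      by (rule continuous_on_tendsto_compose) (use alim[of "fst z"] a0 a1 in \<open>auto simp: m_def\<close>)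
    with True show ?thesis by (simp add: density_ext_def m_def)
  qed (simp add: density_ext_def)
  show ?thesis
    unfolding split_beta' by (rule borel_measurable_LIMSEQ_metric[OF meas lim])
qed

lemma solution_measurable:
  assumes sol: "averaging_solution \<rho>" and f: "f \<in> borel_measurable M" and g: "g \<in> borel_measurable M"
  shows "(\<lambda>z. density_ext (\<rho> (max 0 (f z))) (g z)) \<in> borel_measurable M"
  using measurable_compose[OF measurable_Pair[OF f g] solution_jointly_measurable[OF sol]] by simp

abbreviation laplace_sol :: "(real \<Rightarrow> real \<Rightarrow> real) \<Rightarrow> real \<Rightarrow> real \<Rightarrow> real" where
  "laplace_sol \<rho> s \<equiv> laplace (density_measure (\<rho> s))"

text \<open>Gain and loss are separated so that both sides are integrals of nonnegative functions; Tonelli's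
theorem then applies without any integrability estimate.\<close>
lemma solution_balance:
  assumes sol: "averaging_solution \<rho>" and t: "0 \<le> t" and x: "0 \<le> x"
  shows "ennreal (\<rho> t x) + (\<integral>\<^sup>+s. ennreal (density_ext (\<rho> (max 0 s)) x) * indicator {0..t} s \<partial>lborel)
    = ennreal (\<rho> 0 x) + (\<integral>\<^sup>+s. 2 * (\<integral>\<^sup>+y. ennreal (density_ext (\<rho> (max 0 s)) y)
        * ennreal (density_ext (\<rho> (max 0 s)) (2 * x - y)) \<partial>lborel) * indicator {0..t} s \<partial>lborel)"
proof -
  let ?gain = "\<lambda>s. 2 * (\<integral>\<^sup>+y. ennreal (density_ext (\<rho> s) y) * ennreal (density_ext (\<rho> s) (2 * x - y)) \<partial>lborel)"
  define c where "c s = (LBINT y:{0..2 * x}. \<rho> s y * \<rho> s (2 * x - y))" for s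
  have dens: "probability_density (\<rho> s)" if "0 \<le> s" for s
    by (rule solution_density[OF sol that])
  have rate: "set_integrable lborel {0..t} (\<lambda>s. averaging_rate (\<rho> s) x)"
    and eq: "\<rho> t x = \<rho> 0 x + (LBINT s:{0..t}. averaging_rate (\<rho> s) x)"
    using sol t x unfolding averaging_solution_def by blast+
  have conv: "set_integrable lborel {0..2 * x} (\<lambda>y. \<rho> s y * \<rho> s (2 * x - y))" if "0 \<le> s" for s
    using sol x that unfolding averaging_solution_def by blast
  have loss: "set_integrable lborel {0..t} (\<lambda>s. \<rho> s x)"
    using solution_path_continuous[OF sol x t] by (intro borel_integrable_atLeastAtMost') auto
  have gain: "set_integrable lborel {0..t} (\<lambda>s. 2 * c s)"
    using set_integral_add(1)[OF rate loss] by (simp add: averaging_rate_def c_def)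
  have eq': "\<rho> t x + (LBINT s:{0..t}. \<rho> s x) = \<rho> 0 x + (LBINT s:{0..t}. 2 * c s)"
    using set_integral_add(2)[OF rate loss] eq by (simp add: averaging_rate_def c_def)
  have nn: "0 \<le> \<rho> s y" if "0 \<le> s" "0 \<le> y" for s y
    using dens[OF that(1)] that(2) by (simp add: probability_density_def)
  have cnn: "0 \<le> c s" if "0 \<le> s" for s
    unfolding c_def set_lebesgue_integral_def
    by (rule integral_nonneg_AE) (use nn that in \<open>auto simp: indicator_def\<close>)
  have lossE: "(\<integral>\<^sup>+s. ennreal (density_ext (\<rho> (max 0 s)) x) * indicator {0..t} s \<partial>lborel)
      = ennreal (LBINT s:{0..t}. \<rho> s x)"
  proof -
    have "(\<integral>\<^sup>+s. ennreal (density_ext (\<rho> (max 0 s)) x) * indicator {0..t} s \<partial>lborel)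
        = (\<integral>\<^sup>+s. ennreal (indicator {0..t} s *\<^sub>R \<rho> s x) \<partial>lborel)"
      by (intro nn_integral_cong) (use x in \<open>auto simp: indicator_def density_ext_def max_absorb2\<close>)
    also have "\<dots> = ennreal (LBINT s:{0..t}. \<rho> s x)"
      unfolding set_lebesgue_integral_def
      by (rule nn_integral_eq_integral)
         (use loss nn x in \<open>auto simp: set_integrable_def indicator_def\<close>)
    finally show ?thesis .
  qed
  have convE: "(\<integral>\<^sup>+y. ennreal (density_ext (\<rho> s) y) * ennreal (density_ext (\<rho> s) (2 * x - y)) \<partial>lborel)
      = ennreal (c s)" if s: "0 \<le> s" for s
  proof -
    have "(\<integral>\<^sup>+y. ennreal (density_ext (\<rho> s) y) * ennreal (density_ext (\<rho> s) (2 * x - y)) \<partial>lborel)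
       = (\<integral>\<^sup>+y. ennreal (indicator {0..2*x} y *\<^sub>R (\<rho> s y * \<rho> s (2 * x - y))) \<partial>lborel)"
      by (intro nn_integral_cong) (use s nn in \<open>auto simp: indicator_def density_ext_def ennreal_mult\<close>)
    also have "\<dots> = ennreal (c s)"
      unfolding c_def set_lebesgue_integral_def
      by (rule nn_integral_eq_integral)
         (use conv[OF s] nn[OF s] in \<open>auto simp: set_integrable_def indicator_def\<close>)
    finally show ?thesis .
  qed
  have gainE: "(\<integral>\<^sup>+s. ?gain (max 0 s) * indicator {0..t} s \<partial>lborel)
      = ennreal (LBINT s:{0..t}. 2 * c s)"
  proof -
    have "(\<integral>\<^sup>+s. ?gain (max 0 s) * indicator {0..t} s \<partial>lborel)
       = (\<integral>\<^sup>+s. ennreal (indicator {0..t} s *\<^sub>R (2 * c s)) \<partial>lborel)"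
    proof (intro nn_integral_cong)
      fix s
      show "?gain (max 0 s) * indicator {0..t} s
        = ennreal (indicator {0..t} s *\<^sub>R (2 * c s))"
      proof (cases "s \<in> {0..t}")
        case True
        then have s: "0 \<le> s" by simp
        then have "max 0 s = s" by simp
        moreover have "2 * ennreal (c s) = ennreal (2 * c s)"
          using ennreal_mult[of 2 "c s"] cnn[OF s] by (simp only: ennreal_numeral zero_le_numeral)
        ultimately show ?thesis using True convE[OF s] by (simp only: indicator_simps mult_1_right scaleR_one)
      qed simp
    qed
    also have "\<dots> = ennreal (LBINT s:{0..t}. 2 * c s)"
      unfolding set_lebesgue_integral_def
      by (rule nn_integral_eq_integral)
         (use gain cnn in \<open>auto simp: set_integrable_def indicator_def\<close>)
    finally show ?thesis .
  qed
  have i1: "0 \<le> (LBINT s:{0..t}. \<rho> s x)"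
    unfolding set_lebesgue_integral_def
    by (rule integral_nonneg_AE) (use nn x in \<open>auto simp: indicator_def\<close>)
  have i2: "0 \<le> (LBINT s:{0..t}. 2 * c s)"
    unfolding set_lebesgue_integral_def
    by (rule integral_nonneg_AE) (use cnn in \<open>auto simp: indicator_def\<close>)
  show ?thesis
    unfolding lossE gainE using eq' i1 i2 nn[OF t x] nn[OF order_refl x]
    by (metis ennreal_plus)
qed

lemma ennreal_laplace_balance:
  assumes sol: "averaging_solution \<rho>" and t: "0 \<le> t" and l: "0 \<le> l"
  shows "ennreal (laplace_sol \<rho> t l)
      + (\<integral>\<^sup>+s. ennreal (laplace_sol \<rho> (max 0 s) l) * indicator {0..t} s \<partial>lborel)
    = ennreal (laplace_sol \<rho> 0 l)
      + (\<integral>\<^sup>+s. ennreal ((laplace_sol \<rho> (max 0 s) (l / 2))\<^sup>2) * indicator {0..t} s \<partial>lborel)"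
proof -
  define r where "r s x = density_ext (\<rho> (max 0 s)) x" for s x
  have dens: "probability_density (\<rho> s)" if "0 \<le> s" for s
    by (rule solution_density[OF sol that])
  let ?B2 = "borel \<Otimes>\<^sub>M borel :: (real \<times> real) measure"
  note [measurable (raw)] = solution_measurable[OF sol, folded r_def]
  have rnn: "0 \<le> r s x" for s x
    unfolding r_def by (rule density_ext_nonneg[OF dens]) simp
  let ?e = "\<lambda>x. ennreal (exp (- l * x))"
  let ?g = "\<lambda>s x. 2 * (\<integral>\<^sup>+y. ennreal (r s y) * ennreal (r s (2 * x - y)) \<partial>lborel)"
  have bal: "ennreal (r t x) + (\<integral>\<^sup>+s. ennreal (r s x) * indicator {0..t} s \<partial>lborel)
     = ennreal (r 0 x) + (\<integral>\<^sup>+s. ?g s x * indicator {0..t} s \<partial>lborel)" for x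
  proof (cases "0 \<le> x")
    case True
    then show ?thesis
      using solution_balance[OF sol t True] t by (simp add: r_def density_ext_def max_absorb2)
  next
    case False
    have "r s y * r s (2 * x - y) = 0" for s y
      using False by (simp add: r_def density_ext_def)
    then have z: "ennreal (r s y) * ennreal (r s (2 * x - y)) = 0" for s y
      by (simp only: ennreal_mult[symmetric] rnn ennreal_0)
    have "?g s x = 0" for s unfolding z by simp
    with False show ?thesis by (simp add: r_def density_ext_def)
  qed
  have tonelli: "(\<integral>\<^sup>+x. ?e x * (\<integral>\<^sup>+s. h s x * indicator {0..t} s \<partial>lborel) \<partial>lborel)
      = (\<integral>\<^sup>+s. (\<integral>\<^sup>+x. ?e x * h s x \<partial>lborel) * indicator {0..t} s \<partial>lborel)"
    if h: "(\<lambda>z. h (fst z) (snd z)) \<in> borel_measurable ?B2" for h :: "real \<Rightarrow> real \<Rightarrow> ennreal"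
  proof -
    have h1[measurable]: "(\<lambda>s. h s x) \<in> borel_measurable borel" for x
      using measurable_compose[OF _ h, of "\<lambda>s. (s, x)" borel] by simp
    have h2[measurable]: "h s \<in> borel_measurable borel" for s
      using measurable_compose[OF _ h, of "\<lambda>x. (s, x)" borel] by simp
    have h3[measurable]: "(\<lambda>z. h (snd z) (fst z)) \<in> borel_measurable ?B2"
      using measurable_compose[OF _ h, of "\<lambda>z. (snd z, fst z)" ?B2] by simp
    have "(\<integral>\<^sup>+x. ?e x * (\<integral>\<^sup>+s. h s x * indicator {0..t} s \<partial>lborel) \<partial>lborel)
        = (\<integral>\<^sup>+x. \<integral>\<^sup>+s. ?e x * h s x * indicator {0..t} s \<partial>lborel \<partial>lborel)"
      by (simp add: nn_integral_cmult[symmetric] mult.assoc)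
    also have "\<dots> = (\<integral>\<^sup>+s. \<integral>\<^sup>+x. ?e x * h s x * indicator {0..t} s \<partial>lborel \<partial>lborel)"
      by (rule lborel_pair.Fubini'[symmetric]) (use h h3 in measurable)
    also have "\<dots> = (\<integral>\<^sup>+s. (\<integral>\<^sup>+x. ?e x * h s x \<partial>lborel) * indicator {0..t} s \<partial>lborel)"
      by (simp add: nn_integral_multc)
    finally show ?thesis .
  qed
  have L: "ennreal (laplace_sol \<rho> (max 0 s) k) = (\<integral>\<^sup>+x. ennreal (r s x) * ennreal (exp (- k * x)) \<partial>lborel)"
    if "0 \<le> k" for s k
    using ennreal_laplace[OF dens that, of "max 0 s"] by (simp add: r_def)
  have L2: "ennreal ((laplace_sol \<rho> (max 0 s) (l / 2))\<^sup>2) = (\<integral>\<^sup>+x. ?e x * ?g s x \<partial>lborel)" for s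
  proof -
    have "0 \<le> laplace_sol \<rho> (max 0 s) (l / 2)"
      using laplace_bounds(1)[OF prob_space_density_measure[OF dens]] l by simp
    then have "ennreal ((laplace_sol \<rho> (max 0 s) (l / 2))\<^sup>2)
       = (ennreal (laplace_sol \<rho> (max 0 s) (l / 2)))\<^sup>2"
      by (simp add: ennreal_power)
    then show ?thesis using nn_integral_gain[of "r s" l, OF _ rnn] L[of "l/2" s] l by simp
  qed
  have "(\<integral>\<^sup>+x. ?e x * ennreal (r t x) \<partial>lborel) + (\<integral>\<^sup>+x. ?e x * (\<integral>\<^sup>+s. ennreal (r s x) * indicator {0..t} s \<partial>lborel) \<partial>lborel)
    = (\<integral>\<^sup>+x. ?e x * (ennreal (r t x) + (\<integral>\<^sup>+s. ennreal (r s x) * indicator {0..t} s \<partial>lborel)) \<partial>lborel)"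
    by (subst nn_integral_add[symmetric]) (simp_all add: distrib_left)
  also have "\<dots> = (\<integral>\<^sup>+x. ?e x * ennreal (r 0 x) \<partial>lborel) + (\<integral>\<^sup>+x. ?e x * (\<integral>\<^sup>+s. ?g s x * indicator {0..t} s \<partial>lborel) \<partial>lborel)"
    unfolding bal by (subst nn_integral_add[symmetric]) (simp_all add: distrib_left)
  finally show ?thesis
    using tonelli[of "\<lambda>s x. ennreal (r s x)"] tonelli[of ?g] L[OF l] L[OF l, of t] L[OF l, of 0] L2 t
    by (simp add: mult.commute max_absorb2)
qed

lemma laplace_measurable_in_time:
  assumes sol: "averaging_solution \<rho>" and l: "0 \<le> l"
  shows "(\<lambda>s. laplace_sol \<rho> (max 0 s) l) \<in> borel_measurable borel"
proof -
  have dens: "probability_density (\<rho> (max 0 s))" for s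
    by (rule solution_density[OF sol]) simp
  note [measurable (raw)] = solution_measurable[OF sol]
  have m: "(\<lambda>s. ennreal (laplace_sol \<rho> (max 0 s) l)) \<in> borel_measurable borel"
    unfolding ennreal_laplace[OF dens l] by measurable
  have "(\<lambda>s. enn2real (ennreal (laplace_sol \<rho> (max 0 s) l))) \<in> borel_measurable borel"
    using m by measurable
  then
  show ?thesis
    using laplace_bounds(1)[OF prob_space_density_measure[OF dens] _ l] by simp
qed

text \<open>The time derivative of the Laplace transform.\<close>
definition laplace_rate :: "(real \<Rightarrow> real \<Rightarrow> real) \<Rightarrow> real \<Rightarrow> real \<Rightarrow> real" where
  "laplace_rate \<rho> l s =
    (laplace_sol \<rho> s (l / 2))\<^sup>2 - laplace_sol \<rho> s l"

lemma laplace_rate_bound: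
  assumes sol: "averaging_solution \<rho>" and l: "0 \<le> l" and s: "0 \<le> s"
  shows "\<bar>laplace_rate \<rho> l s\<bar> \<le> 1"
proof -
  note p = prob_space_density_measure[OF solution_density[OF sol s]]
  have "(laplace_sol \<rho> s (l / 2))\<^sup>2 \<le> 1"
    using laplace_bounds[OF p, of "l/2"] l by (simp add: power_le_one)
  then show ?thesis
    using laplace_bounds[OF p, of l] l unfolding laplace_rate_def by (simp add: abs_le_iff) (smt (verit) zero_le_power2)
qed

lemma laplace_rate_integrable:
  assumes sol: "averaging_solution \<rho>" and l: "0 \<le> l" and a: "0 \<le> a"
  shows "set_integrable lborel {a..b} (laplace_rate \<rho> l)"
proof -
  have [measurable]: "(\<lambda>s. laplace_rate \<rho> l (max 0 s)) \<in> borel_measurable borel"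
    unfolding laplace_rate_def
    using laplace_measurable_in_time[OF sol, of "l/2"] laplace_measurable_in_time[OF sol, of l] l by simp
  have "set_integrable lborel {a..b} (\<lambda>s. laplace_rate \<rho> l (max 0 s))"
    unfolding set_integrable_def
  proof (rule integrableI_bounded_set[where A = "{a..b}" and B = 1])
    show "AE x in lborel. x \<in> {a..b} \<longrightarrow> norm (indicat_real {a..b} x *\<^sub>R laplace_rate \<rho> l (max 0 x)) \<le> 1"
      using laplace_rate_bound[OF sol l] by (auto simp: indicator_def)
  qed (auto simp: emeasure_lborel_Icc_eq)
  moreover have "indicator {a..b} s *\<^sub>R laplace_rate \<rho> l (max 0 s) = indicator {a..b} s *\<^sub>R laplace_rate \<rho> l s" for s
    using a by (auto simp: indicator_def max_absorb2)
  ultimately show ?thesis by (simp only: set_integrable_def)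
qed

lemma laplace_integral_equation:
  assumes sol: "averaging_solution \<rho>" and l: "0 \<le> l" and t: "0 \<le> t"
  shows "laplace_sol \<rho> t l = laplace_sol \<rho> 0 l
     + (LBINT s:{0..t}. laplace_rate \<rho> l s)"
proof -
  define L where "L k s = laplace_sol \<rho> (max 0 s) k" for k s
  have dens: "probability_density (\<rho> (max 0 s))" for s
    by (rule solution_density[OF sol]) simp
  have Lb: "0 \<le> L k s" "L k s \<le> 1" if "0 \<le> k" for k s
    unfolding L_def using laplace_bounds[OF prob_space_density_measure[OF dens] _ that] by simp_all
  have Lm[measurable]: "L k \<in> borel_measurable borel" if "0 \<le> k" for k
    using laplace_measurable_in_time[OF sol that] by (simp add: L_def[abs_def])
  have int: "set_integrable lborel {0..t} f" and nn: "0 \<le> (LBINT s:{0..t}. f s)"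
    and eq: "(\<integral>\<^sup>+s. ennreal (f s) * indicator {0..t} s \<partial>lborel) = ennreal (LBINT s:{0..t}. f s)"
    if f: "f \<in> borel_measurable borel" "\<And>s. 0 \<le> f s" "\<And>s. f s \<le> 1" for f :: "real \<Rightarrow> real"
  proof -
    show int: "set_integrable lborel {0..t} f"
      unfolding set_integrable_def
      by (rule integrableI_bounded_set[where A = "{0..t}" and B = 1])
         (use f in \<open>auto simp: emeasure_lborel_Icc_eq indicator_def\<close>)
    show "0 \<le> (LBINT s:{0..t}. f s)"
      unfolding set_lebesgue_integral_def by (rule integral_nonneg_AE) (use f in auto)
    have "(\<integral>\<^sup>+s. ennreal (f s) * indicator {0..t} s \<partial>lborel) = (\<integral>\<^sup>+s. ennreal (indicator {0..t} s *\<^sub>R f s) \<partial>lborel)"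
      by (rule nn_integral_cong) (simp add: indicator_def)
    also have "\<dots> = ennreal (LBINT s:{0..t}. f s)"
      unfolding set_lebesgue_integral_def
      by (rule nn_integral_eq_integral) (use int f in \<open>auto simp: set_integrable_def\<close>)
    finally show "(\<integral>\<^sup>+s. ennreal (f s) * indicator {0..t} s \<partial>lborel) = ennreal (LBINT s:{0..t}. f s)" .
  qed
  have l2: "0 \<le> l/2" using l by simp
  note f1 = Lm[OF l] Lb[OF l]
  have f2: "(\<lambda>s. (L (l/2) s)\<^sup>2) \<in> borel_measurable borel" "\<And>s. 0 \<le> (L (l/2) s)\<^sup>2" "\<And>s. (L (l/2) s)\<^sup>2 \<le> 1"
    using Lm[OF l2] Lb[OF l2] by (auto simp: power_le_one)
  have "ennreal (L l t) + ennreal (LBINT s:{0..t}. L l s)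
      = ennreal (L l 0) + ennreal (LBINT s:{0..t}. (L (l/2) s)\<^sup>2)"
    using ennreal_laplace_balance[OF sol t l] eq[OF f1] eq[OF f2] t by (simp add: L_def max_absorb2)
  then have "L l t + (LBINT s:{0..t}. L l s) = L l 0 + (LBINT s:{0..t}. (L (l/2) s)\<^sup>2)"
    using nn[OF f1] nn[OF f2] Lb[OF l] by (simp add: ennreal_plus[symmetric] del: ennreal_plus)
  moreover have "(LBINT s:{0..t}. laplace_rate \<rho> l s) = (LBINT s:{0..t}. (L (l/2) s)\<^sup>2 - L l s)"
    by (rule set_lebesgue_integral_cong) (auto simp: laplace_rate_def L_def max_absorb2)
  moreover have "(LBINT s:{0..t}. (L (l/2) s)\<^sup>2 - L l s) = (LBINT s:{0..t}. (L (l/2) s)\<^sup>2) - (LBINT s:{0..t}. L l s)"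
    by (rule set_integral_diff(2)[OF int[OF f2] int[OF f1]])
  ultimately show ?thesis using t by (simp add: L_def max_absorb2)
qed

lemma laplace_increment:
  assumes sol: "averaging_solution \<rho>" and l: "0 \<le> l" and s: "0 \<le> s" "s \<le> t"
  shows "laplace_sol \<rho> t l - laplace_sol \<rho> s l = (LBINT u:{s..t}. laplace_rate \<rho> l u)"
proof -
  let ?g = "laplace_rate \<rho> l"
  have e: "?g integrable_on {a..b}" "(LBINT u:{a..b}. ?g u) = integral {a..b} ?g" if "0 \<le> a" for a b
    using set_borel_integral_eq_integral[OF laplace_rate_integrable[OF sol l that, of b]] by auto
  have "(LBINT u:{0..t}. ?g u) = (LBINT u:{0..s}. ?g u) + (LBINT u:{s..t}. ?g u)"
    using e[of 0 t] e[of 0 s] e[of s t] s Henstock_Kurzweil_Integration.integral_combine[of 0 s t ?g] by simp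
  then show ?thesis
    using laplace_integral_equation[OF sol l, of t] laplace_integral_equation[OF sol l, of s] s by simp
qed

lemma set_integral_deviation:
  fixes g :: "real \<Rightarrow> real"
  assumes g: "set_integrable lborel {s..t} g" and st: "s \<le> t"
    and B: "\<And>u. s \<le> u \<Longrightarrow> u \<le> t \<Longrightarrow> \<bar>g u - c\<bar> \<le> B"
  shows "\<bar>(LBINT u:{s..t}. g u) - (t - s) * c\<bar> \<le> B * (t - s)"
proof -
  have "0 \<le> B" using B[of s] st by linarith
  have "((\<lambda>u. g u - c) has_integral (LBINT u:{s..t}. g u) - (t - s) * c) {s..t}"
    using has_integral_diff[OF integrable_integral[OF set_borel_integral_eq_integral(1)[OF g]] has_integral_const_real[of c s t]]
      set_borel_integral_eq_integral(2)[OF g] st by simp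
  from has_integral_bound[OF \<open>0 \<le> B\<close> this[folded box_real(2)]] show ?thesis
    using B st by (simp add: mult.commute)
qed

lemma laplace_lipschitz:
  assumes sol: "averaging_solution \<rho>" and l: "0 \<le> l" and s: "0 \<le> s" "s \<le> t"
  shows "\<bar>laplace_sol \<rho> t l - laplace_sol \<rho> s l\<bar> \<le> t - s"
proof -
  have "\<bar>(LBINT u:{s..t}. laplace_rate \<rho> l u) - (t - s) * 0\<bar> \<le> 1 * (t - s)"
    by (rule set_integral_deviation[OF laplace_rate_integrable[OF sol l s(1)] s(2)])
       (use laplace_rate_bound[OF sol l] s in auto)
  then show ?thesis using laplace_increment[OF sol l s] by simp
qed

text \<open>The rate is \<open>3\<close>-Lipschitz in time: \<open>L(l)\<close> contributes \<open>1\<close> and the square of \<open>L(l/2) \<in> [0, 1]\<close>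
contributes \<open>2\<close>.\<close>
lemma laplace_one_step:
  assumes sol: "averaging_solution \<rho>" and l: "0 \<le> l" and s: "0 \<le> s" "0 \<le> h"
  shows "\<bar>laplace_sol \<rho> (s + h) l - laplace_sol \<rho> s l
      - h * laplace_rate \<rho> l s\<bar> \<le> 3 * h\<^sup>2"
proof -
  have "\<bar>laplace_rate \<rho> l u - laplace_rate \<rho> l s\<bar> \<le> 3 * h" if u: "s \<le> u" "u \<le> s + h" for u
  proof -
    let ?L = "\<lambda>k v. laplace_sol \<rho> v k"
    have l2: "0 \<le> l/2" using l by simp
    have u0: "0 \<le> u" using s u by simp
    have b: "0 \<le> ?L (l/2) v" "?L (l/2) v \<le> 1" if "0 \<le> v" for v
      using laplace_bounds[OF prob_space_density_measure[OF solution_density[OF sol that]] _ l2] by simp_all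
    have "(?L (l/2) u)\<^sup>2 - (?L (l/2) s)\<^sup>2 = (?L (l/2) u - ?L (l/2) s) * (?L (l/2) u + ?L (l/2) s)"
      by (simp add: power2_eq_square algebra_simps)
    then have "\<bar>(?L (l/2) u)\<^sup>2 - (?L (l/2) s)\<^sup>2\<bar> = \<bar>?L (l/2) u - ?L (l/2) s\<bar> * \<bar>?L (l/2) u + ?L (l/2) s\<bar>"
      by (simp add: abs_mult)
    also have "\<dots> \<le> h * 2"
      using laplace_lipschitz[OF sol l2 s(1) u(1)] b[OF u0] b[OF s(1)] u(2) s(2)
      by (intro mult_mono) auto
    finally show ?thesis
      using laplace_lipschitz[OF sol l s(1) u(1)] u(2) unfolding laplace_rate_def by linarith
  qed
  then have "\<bar>(LBINT u:{s..s + h}. laplace_rate \<rho> l u) - (s + h - s) * laplace_rate \<rho> l s\<bar> \<le> 3 * h * (s + h - s)"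
    by (intro set_integral_deviation laplace_rate_integrable[OF sol l s(1)]) (use s in auto)
  then show ?thesis
    using laplace_increment[OF sol l s(1), of "s + h"] s by (simp add: power2_eq_square)
qed

text \<open>By Jensen's inequality \<open>L(l/2)\<^sup>2 \<le> L(l)\<close>, so the rate is nonpositive.\<close>
lemma laplace_decreasing_in_time:
  assumes sol: "averaging_solution \<rho>" and l: "0 \<le> l" and t: "0 \<le> t"
  shows "laplace_sol \<rho> t l \<le> laplace_sol \<rho> 0 l"
proof -
  have neg: "laplace_rate \<rho> l s \<le> 0" if s: "0 \<le> s" for s
  proof -
    note dens = solution_density[OF sol s]
    interpret prob_space "density_measure (\<rho> s)" by (rule prob_space_density_measure[OF dens])
    have sq: "(exp (- (l/2) * x))\<^sup>2 = exp (- l * x)" for x :: real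
      by (simp add: power2_eq_square exp_add[symmetric])
    have i1: "integrable (density_measure (\<rho> s)) (\<lambda>x. exp (- (l/2) * x))"
      using l by (intro integrable_exp_on_half_line prob_space_axioms) auto
    have i2: "integrable (density_measure (\<rho> s)) (\<lambda>x. (exp (- (l/2) * x))\<^sup>2)"
      unfolding sq using l by (intro integrable_exp_on_half_line prob_space_axioms) auto
    show ?thesis
      using variance_positive[of "\<lambda>x. exp (- (l/2) * x)"]
      unfolding variance_eq[OF i1 i2] sq laplace_rate_def laplace_def by simp
  qed
  have "(LBINT s:{0..t}. laplace_rate \<rho> l s) \<le> 0"
    unfolding set_lebesgue_integral_def
    using integral_nonneg_AE[of "\<lambda>s. - (indicator {0..t} s *\<^sub>R laplace_rate \<rho> l s)" lborel] neg
    by (auto simp: indicator_def)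
  then show ?thesis using laplace_integral_equation[OF sol l t] by simp
qed

section \<open>Averaging of pairs and the empirical Laplace transform\<close>

text \<open>Averaging without reference to an order of the two indices, since the clocks are attached to
unordered pairs. It is the identity for the empty set, which stands for a cell without a ring.\<close>
definition average_on :: "nat set \<Rightarrow> (nat \<Rightarrow> real) \<Rightarrow> (nat \<Rightarrow> real)" where
  "average_on p x = (\<lambda>k. if k \<in> p then (\<Sum>i\<in>p. x i) / 2 else x k)"

lemma average_pair_eq: "i \<noteq> j \<Longrightarrow> average_pair i j x = average_on {i, j} x"
  by (auto simp: average_pair_def average_on_def fun_eq_iff)

lemma average_on_empty [simp]: "average_on {} x = x"
  by (simp add: average_on_def)

definition sample_mean :: "nat \<Rightarrow> (real \<Rightarrow> real) \<Rightarrow> (nat \<Rightarrow> real) \<Rightarrow> real" where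
  "sample_mean N f x = (\<Sum>i<N. f (x i)) / real N"

lemma finite_pairs [simp]: "finite (pairs N)"
proof -
  have "pairs N \<subseteq> Pow {..<N}" by (auto simp: pairs_def)
  then show ?thesis by (rule finite_subset) simp
qed

lemma pairsE:
  assumes "p \<in> pairs N"
  obtains i j where "p = {i, j}" "i < N" "j < N" "i \<noteq> j"
  using assms by (auto simp: pairs_def)

lemma pairs_nonempty: "2 \<le> N \<Longrightarrow> pairs N \<noteq> {}"
proof -
  assume "2 \<le> N"
  then have "{0, 1} \<in> pairs N"
    unfolding pairs_def by (intro CollectI exI[of _ 0] exI[of _ 1]) auto
  then show ?thesis by blast
qed

lemma sum_average_on:
  fixes f :: "real \<Rightarrow> real"
  assumes "i < N" "j < N" "i \<noteq> j"
  shows "(\<Sum>k<N. f (average_on {i, j} x k)) = (\<Sum>k<N. f (x k)) + (2 * f ((x i + x j) / 2) - f (x i) - f (x j))"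
proof -
  have s: "(\<Sum>k<N. g k) = g i + g j + (\<Sum>k\<in>{..<N} - {i, j}. g k)" for g :: "nat \<Rightarrow> real"
    using assms by (subst sum.subset_diff[of "{i, j}"]) auto
  have "(\<Sum>k\<in>{..<N} - {i, j}. f (average_on {i, j} x k)) = (\<Sum>k\<in>{..<N} - {i, j}. f (x k))"
    by (rule sum.cong) (auto simp: average_on_def)
  then show ?thesis
    unfolding s[of "\<lambda>k. f (average_on {i, j} x k)"] s[of "\<lambda>k. f (x k)"] using assms
    by (simp add: average_on_def)
qed

text \<open>Each unordered pair occurs twice off the diagonal of the square of indices.\<close>
lemma sum_pairs:
  fixes g :: "nat \<Rightarrow> nat \<Rightarrow> real"
  assumes sym: "\<And>i j. g i j = g j i"
    and G: "\<And>i j. i < N \<Longrightarrow> j < N \<Longrightarrow> i \<noteq> j \<Longrightarrow> G {i, j} = g i j"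
  shows "2 * (\<Sum>p\<in>pairs N. G p) = (\<Sum>i<N. \<Sum>j<N. g i j) - (\<Sum>i<N. g i i)"
proof -
  let ?U = "{(i, j). i < j \<and> j < N}" and ?D = "{(i, j). j < i \<and> i < N}"
  have finU: "finite ?U" and finD: "finite ?D"
    by (rule finite_subset[of _ "{..<N} \<times> {..<N}"]; auto)+
  have "pairs N = (\<lambda>(i, j). {i, j}) ` ?U"
  proof -
    have "{i, j} \<in> (\<lambda>(i, j). {i, j}) ` ?U" if "i < N" "j < N" "i \<noteq> j" for i j
    proof (cases "i < j")
      case True with that show ?thesis by force
    next
      case False
      then have "(j, i) \<in> ?U" using that by simp
      then have "(\<lambda>(i, j). {i, j}) (j, i) \<in> (\<lambda>(i, j). {i, j}) ` ?U" by (rule imageI)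
      then show ?thesis by (simp add: insert_commute)
    qed
    moreover have "{i, j} \<in> pairs N" if "i < j" "j < N" for i j
    proof -
      have "i < N" "i \<noteq> j" using that by simp_all
      with that show ?thesis unfolding pairs_def by blast
    qed
    ultimately show ?thesis by (auto simp: elim!: pairsE)
  qed
  moreover have "inj_on (\<lambda>(i, j). {i, j}) ?U"
    by (auto simp: inj_on_def doubleton_eq_iff)
  ultimately have "(\<Sum>p\<in>pairs N. G p) = (\<Sum>z\<in>?U. G (case z of (i, j) \<Rightarrow> {i, j}))"
    by (simp add: sum.reindex)
  also have "\<dots> = (\<Sum>(i, j)\<in>?U. g i j)"
    by (intro sum.cong) (auto simp: G)
  finally have U: "(\<Sum>p\<in>pairs N. G p) = (\<Sum>(i, j)\<in>?U. g i j)" .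
  have D: "(\<Sum>(i, j)\<in>?D. g i j) = (\<Sum>(i, j)\<in>?U. g i j)"
    by (rule sum.reindex_bij_witness[of _ prod.swap prod.swap]) (auto simp: sym)
  have "(\<Sum>i<N. \<Sum>j<N. g i j) = (\<Sum>(i, j)\<in>{..<N} \<times> {..<N}. g i j)"
    by (simp add: sum.cartesian_product)
  also have "{..<N} \<times> {..<N} = (?U \<union> ?D) \<union> (\<lambda>i. (i, i)) ` {..<N}"
    by auto
  also have "(\<Sum>(i, j)\<in>(?U \<union> ?D) \<union> (\<lambda>i. (i, i)) ` {..<N}. g i j)
      = (\<Sum>(i, j)\<in>?U. g i j) + (\<Sum>(i, j)\<in>?D. g i j) + (\<Sum>(i, j)\<in>(\<lambda>i. (i, i)) ` {..<N}. g i j)"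
    using finU finD by (subst sum.union_disjoint; auto)+
  also have "(\<Sum>(i, j)\<in>(\<lambda>i. (i, i)) ` {..<N}. g i j) = (\<Sum>i<N. g i i)"
    by (subst sum.reindex) (auto simp: inj_on_def)
  finally show ?thesis using U D by simp
qed

lemma card_pairs: "2 * real (card (pairs N)) = real N * (real N - 1)"
  using sum_pairs[of "\<lambda>_ _. 1" N "\<lambda>_. 1"] by (simp add: algebra_simps)

lemma sample_mean_average_on:
  assumes "i < N" "j < N" "i \<noteq> j"
  shows "sample_mean N f (average_on {i, j} x)
    = sample_mean N f x + (2 * f ((x i + x j) / 2) - f (x i) - f (x j)) / real N"
  unfolding sample_mean_def sum_average_on[OF assms] by (simp add: add_divide_distrib)

lemma average_on_nonneg:
  assumes "p \<in> pairs N" "\<forall>i<N. 0 \<le> x i" "k < N"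
  shows "0 \<le> average_on p x k"
  using assms by (auto simp: average_on_def elim!: pairsE)

definition laplace_emp :: "nat \<Rightarrow> real \<Rightarrow> (nat \<Rightarrow> real) \<Rightarrow> real" where
  "laplace_emp N l = sample_mean N (\<lambda>y. exp (- l * y))"

lemma laplace_emp_bounds:
  assumes "0 \<le> l" "0 < N" "\<forall>i<N. 0 \<le> x i"
  shows "0 \<le> laplace_emp N l x" "laplace_emp N l x \<le> 1"
proof -
  show "0 \<le> laplace_emp N l x"
    by (simp add: laplace_emp_def sample_mean_def sum_nonneg)
  have "(\<Sum>i<N. exp (- l * x i)) \<le> (\<Sum>i<N. 1)"
    by (rule sum_mono) (use assms in auto)
  then show "laplace_emp N l x \<le> 1"
    using assms(2) by (simp add: laplace_emp_def sample_mean_def)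
qed

text \<open>The action of the generator (up to the intensity \<open>1/N\<close>) is exactly quadratic: on the diagonal
\<open>i = j\<close> the increment \<open>2 exp (- l (x\<^sub>i + x\<^sub>j) / 2) - exp (- l x\<^sub>i) - exp (- l x\<^sub>j)\<close> vanishes, so the sum
over pairs is half of a full double sum.\<close>
lemma sum_pairs_laplace_emp:
  assumes N: "0 < N"
  shows "(\<Sum>p\<in>pairs N. laplace_emp N l (average_on p x) - laplace_emp N l x)
    = real N * ((laplace_emp N (l / 2) x)\<^sup>2 - laplace_emp N l x)"
proof -
  let ?e = "\<lambda>i. exp (- (l/2) * x i)" and ?E = "\<lambda>i. exp (- l * x i)"
  let ?g = "\<lambda>i j. (2 * (?e i * ?e j) - ?E i - ?E j) / real N"
  have ee: "exp (- l * ((x i + x j) / 2)) = ?e i * ?e j" for i j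
    by (simp add: exp_add[symmetric] algebra_simps add_divide_distrib)
  have E: "?E i = ?e i * ?e i" for i by (simp add: exp_add[symmetric])
  have "2 * (\<Sum>p\<in>pairs N. laplace_emp N l (average_on p x) - laplace_emp N l x)
      = (\<Sum>i<N. \<Sum>j<N. ?g i j) - (\<Sum>i<N. ?g i i)"
  proof (rule sum_pairs)
    fix i j assume "i < N" "j < N" "i \<noteq> j"
    from sample_mean_average_on[OF this, of "\<lambda>y. exp (- l * y)" x]
    show "laplace_emp N l (average_on {i, j} x) - laplace_emp N l x = ?g i j"
      unfolding laplace_emp_def ee by simp
  qed (simp add: algebra_simps)
  also have "(\<Sum>i<N. ?g i i) = 0" by (simp only: E) simp
  also have "(\<Sum>i<N. \<Sum>j<N. ?g i j) = (2 * (\<Sum>i<N. ?e i)\<^sup>2 - 2 * real N * (\<Sum>i<N. ?E i)) / real N"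
  proof -
    have "(\<Sum>i<N. \<Sum>j<N. ?g i j) = (\<Sum>i<N. \<Sum>j<N. 2 * (?e i * ?e j) - ?E i - ?E j) / real N"
      by (simp only: sum_divide_distrib)
    also have "(\<Sum>i<N. \<Sum>j<N. 2 * (?e i * ?e j) - ?E i - ?E j) = 2 * (\<Sum>i<N. ?e i)\<^sup>2 - 2 * real N * (\<Sum>i<N. ?E i)"
      by (simp only: sum_subtractf sum_distrib_left[symmetric] power2_eq_square sum_product)
         (simp add: sum_distrib_left[symmetric])
    finally show ?thesis .
  qed
  finally have "2 * (\<Sum>p\<in>pairs N. laplace_emp N l (average_on p x) - laplace_emp N l x)
    = (2 * (real N * laplace_emp N (l / 2) x)\<^sup>2 - 2 * real N * (real N * laplace_emp N l x)) / real N"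
    using N by (simp add: laplace_emp_def sample_mean_def)
  also have "\<dots> = 2 * (real N * ((laplace_emp N (l / 2) x)\<^sup>2 - laplace_emp N l x))"
    using N by (simp add: power2_eq_square field_simps)
  finally show ?thesis by simp
qed

lemma average_on_laplace_emp_change:
  assumes p: "p \<in> pairs N" and l: "0 \<le> l" and x: "\<forall>i<N. 0 \<le> x i"
  shows "\<bar>laplace_emp N l (average_on p x) - laplace_emp N l x\<bar> \<le> 2 / real N"
proof -
  from p obtain i j where ij: "p = {i, j}" "i < N" "j < N" "i \<noteq> j" by (rule pairsE)
  let ?d = "2 * exp (- l * ((x i + x j) / 2)) - exp (- l * x i) - exp (- l * x j)"
  have "exp (- l * y) \<le> 1" if "0 \<le> y" for y using l that by simp
  moreover have xs: "0 \<le> x i" "0 \<le> x j" "0 \<le> (x i + x j) / 2"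
    using x ij by simp_all
  ultimately have "exp (- l * ((x i + x j) / 2)) \<le> 1" "exp (- l * x i) \<le> 1" "exp (- l * x j) \<le> 1"
    by blast+
  then have "\<bar>?d\<bar> \<le> 2"
    using exp_ge_zero[of "- l * ((x i + x j) / 2)"] exp_ge_zero[of "- l * x i"] exp_ge_zero[of "- l * x j"]
    by linarith
  then have "\<bar>?d / real N\<bar> \<le> 2 / real N"
    by (simp add: divide_right_mono)
  then show ?thesis
    unfolding laplace_emp_def ij(1) sample_mean_average_on[OF ij(2-4)] by simp
qed

text \<open>The one-step transition operator on test functions of the chain that averages each pair with
probability \<open>r\<close> and otherwise rests.\<close>
definition chain_step :: "nat \<Rightarrow> real \<Rightarrow> ((nat \<Rightarrow> real) \<Rightarrow> real) \<Rightarrow> (nat \<Rightarrow> real) \<Rightarrow> real" where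
  "chain_step N r F x = F x + r * (\<Sum>p\<in>pairs N. F (average_on p x) - F x)"

lemma chain_step_mono:
  fixes r :: real
  assumes r: "0 \<le> r" "r * card (pairs N) \<le> 1"
    and le: "\<And>x. \<forall>i<N. 0 \<le> x i \<Longrightarrow> F x \<le> G x"
    and x: "\<forall>i<N. 0 \<le> x i"
  shows "chain_step N r F x \<le> chain_step N r G x"
proof -
  have e: "chain_step N r H x = (1 - r * card (pairs N)) * H x + r * (\<Sum>p\<in>pairs N. H (average_on p x))"
    for H :: "(nat \<Rightarrow> real) \<Rightarrow> real" and x
    by (simp add: chain_step_def sum_subtractf algebra_simps)
  show ?thesis unfolding e
    by (intro add_mono mult_left_mono sum_mono le allI impI average_on_nonneg) (use r x in auto)
qed

lemma chain_step_linear: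
  "chain_step N r (\<lambda>x. a * F x + b * G x + c) x = a * chain_step N r F x + b * chain_step N r G x + c"
  by (simp add: chain_step_def sum_subtractf sum.distrib sum_distrib_left algebra_simps)

lemma funpow_chain_step_mono:
  fixes r :: real
  assumes r: "0 \<le> r" "r * card (pairs N) \<le> 1"
    and le: "\<And>x. \<forall>i<N. 0 \<le> x i \<Longrightarrow> F x \<le> G x"
    and x: "\<forall>i<N. 0 \<le> x i"
  shows "(chain_step N r ^^ k) F x \<le> (chain_step N r ^^ k) G x"
  using x
proof (induction k arbitrary: x)
  case (Suc k)
  show ?case unfolding funpow.simps o_def
    by (rule chain_step_mono[OF r Suc.IH Suc.prems])
qed (simp add: le)

lemma funpow_chain_step_linear:
  "(chain_step N r ^^ k) (\<lambda>x. a * F x + b * G x + c) x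
    = a * (chain_step N r ^^ k) F x + b * (chain_step N r ^^ k) G x + c"
proof (induction k arbitrary: x)
  case (Suc k)
  then have "(chain_step N r ^^ k) (\<lambda>x. a * F x + b * G x + c)
     = (\<lambda>x. a * (chain_step N r ^^ k) F x + b * (chain_step N r ^^ k) G x + c)" by blast
  then show ?case by (simp add: chain_step_linear)
qed simp

section \<open>Growth of the squared error along the discrete chain\<close>

definition laplace_error :: "nat \<Rightarrow> (real \<Rightarrow> real \<Rightarrow> real) \<Rightarrow> real \<Rightarrow> real \<Rightarrow> (nat \<Rightarrow> real) \<Rightarrow> real" where
  "laplace_error N \<rho> l s x = (laplace_emp N l x - laplace_sol \<rho> s l)\<^sup>2"

lemma solution_laplace_bounds:
  assumes "averaging_solution \<rho>" "0 \<le> l" "0 \<le> s"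
  shows "0 \<le> laplace_sol \<rho> s l" "laplace_sol \<rho> s l \<le> 1"
  using laplace_bounds[OF prob_space_density_measure[OF solution_density[OF assms(1,3)]] _ assms(2)] by simp_all

lemma laplace_error_bounds:
  assumes sol: "averaging_solution \<rho>" and l: "0 \<le> l" and N: "0 < N" and s: "0 \<le> s"
    and x: "\<forall>i<N. 0 \<le> x i"
  shows "0 \<le> laplace_error N \<rho> l s x" "laplace_error N \<rho> l s x \<le> 1"
proof -
  show "0 \<le> laplace_error N \<rho> l s x" by (simp add: laplace_error_def)
  have "\<bar>laplace_emp N l x - laplace_sol \<rho> s l\<bar> \<le> 1"
    using laplace_emp_bounds[OF l N x] solution_laplace_bounds[OF sol l s] by linarith
  then show "laplace_error N \<rho> l s x \<le> 1"
    unfolding laplace_error_def by (simp add: abs_square_le_1)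
qed

text \<open>The energy estimate behind the Gronwall argument, with \<open>u\<close>, \<open>a\<close> the empirical transforms at \<open>l\<close> and
\<open>l/2\<close>, with \<open>v\<close>, \<open>b\<close> those of the solution, and \<open>v'\<close> the transform at \<open>l\<close> one step later. The drift
of \<open>D = u - v\<close> is \<open>a\<^sup>2 - b\<^sup>2 - D\<close>, and
\<open>2 D (a\<^sup>2 - b\<^sup>2 - D) \<le> 4 \<bar>D\<bar> \<bar>a - b\<bar> - 2 D\<^sup>2 \<le> 2 (a - b)\<^sup>2\<close>: the dissipation absorbs the part of the
error at \<open>l\<close> itself.\<close>
lemma squared_error_step:
  fixes u v v' a b h r n m Q :: real
  assumes u: "0 \<le> u" "u \<le> 1" and v: "0 \<le> v" "v \<le> 1" and v': "0 \<le> v'" "v' \<le> 1"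
    and a: "0 \<le> a" "a \<le> 1" and b: "0 \<le> b" "b \<le> 1"
    and h: "0 \<le> h" and n: "0 < n"
    and step: "\<bar>v' - v - h * (b\<^sup>2 - v)\<bar> \<le> 3 * h\<^sup>2" and lip: "\<bar>v' - v\<bar> \<le> h"
    and r: "0 \<le> r" "r * n \<le> h" "h - r * n \<le> h\<^sup>2 * m" and m: "0 \<le> m"
    and Q: "r * Q \<le> 2 * h / n"
  shows "(u - v')\<^sup>2 + r * (2 * (u - v') * (n * (a\<^sup>2 - u)) + Q)
     \<le> (u - v)\<^sup>2 + 2 * h * (a - b)\<^sup>2 + 2 * h / n + (9 + 2 * m) * h\<^sup>2"
proof -
  define D where "D = u - v"
  define B where "B = a\<^sup>2 - u"
  define g where "g = b\<^sup>2 - v"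
  define e where "e = v' - v - h * g"
  have D: "\<bar>D\<bar> \<le> 1" using u v by (simp add: D_def)
  have a2: "0 \<le> a\<^sup>2" "a\<^sup>2 \<le> 1" using a by (auto simp: power_le_one)
  have B: "\<bar>B\<bar> \<le> 1" unfolding B_def using u a2 by linarith
  have e: "\<bar>e\<bar> \<le> 3 * h\<^sup>2" using step by (simp add: e_def g_def)
  have "\<bar>u - v'\<bar> \<le> 1" using u v' by linarith
  have t1: "(u - v')\<^sup>2 \<le> D\<^sup>2 - 2 * D * h * g + 7 * h\<^sup>2"
  proof -
    have "(u - v')\<^sup>2 = D\<^sup>2 - 2 * D * (v' - v) + (v' - v)\<^sup>2"
      by (simp add: D_def power2_eq_square algebra_simps)
    also have "v' - v = h * g + e" by (simp add: e_def)
    finally have "(u - v')\<^sup>2 = D\<^sup>2 - 2 * D * h * g - 2 * (D * e) + (v' - v)\<^sup>2"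
      by (simp add: e_def algebra_simps)
    moreover have "\<bar>D * e\<bar> \<le> 1 * (3 * h\<^sup>2)"
      unfolding abs_mult by (rule mult_mono) (use D e in auto)
    moreover have "(v' - v)\<^sup>2 \<le> h\<^sup>2"
      using lip h by (simp add: abs_le_square_iff[symmetric])
    ultimately show ?thesis by linarith
  qed
  have t2: "r * (2 * (u - v') * (n * B)) \<le> 2 * D * h * B + 2 * h\<^sup>2 + 2 * m * h\<^sup>2"
  proof -
    have rn: "0 \<le> r * n" using r n by simp
    have "r * (2 * (u - v') * (n * B)) = 2 * D * h * B - 2 * ((h - r * n) * (D * B)) - 2 * ((r * n) * ((v' - v) * B))"
      by (simp add: D_def algebra_simps)
    moreover have "\<bar>(h - r * n) * (D * B)\<bar> \<le> (h\<^sup>2 * m) * (1 * 1)"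
      unfolding abs_mult using r D B by (intro mult_mono) auto
    moreover have "\<bar>(r * n) * ((v' - v) * B)\<bar> \<le> h * (h * 1)"
      unfolding abs_mult using r rn lip B h by (intro mult_mono) auto
    ultimately show ?thesis by (simp add: power2_eq_square algebra_simps)
  qed
  have t3: "2 * D * h * (B - g) \<le> 2 * h * (a - b)\<^sup>2"
  proof -
    have Bg: "B - g = (a - b) * (a + b) - D"
      by (simp add: B_def g_def D_def power2_eq_square algebra_simps)
    have "D * ((a - b) * (a + b)) \<le> \<bar>D\<bar> * (\<bar>a - b\<bar> * 2)"
    proof -
      have "D * ((a - b) * (a + b)) \<le> \<bar>D\<bar> * (\<bar>a - b\<bar> * \<bar>a + b\<bar>)"
        by (simp add: abs_mult[symmetric])
      also have "\<dots> \<le> \<bar>D\<bar> * (\<bar>a - b\<bar> * 2)"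
        by (intro mult_left_mono) (use a b in auto)
      finally show ?thesis .
    qed
    also have "\<dots> \<le> D\<^sup>2 + (a - b)\<^sup>2"
      using sum_squares_bound[of "\<bar>D\<bar>" "\<bar>a - b\<bar>"] by simp
    finally have "D * (B - g) \<le> (a - b)\<^sup>2"
      unfolding Bg by (simp add: right_diff_distrib power2_eq_square)
    from mult_left_mono[OF this, of "2 * h"] h show ?thesis by (simp add: algebra_simps)
  qed
  have "r * (2 * (u - v') * (n * (a\<^sup>2 - u)) + Q) = r * (2 * (u - v') * (n * B)) + r * Q"
    by (simp add: B_def algebra_simps)
  moreover have "2 * D * h * (B - g) = 2 * D * h * B - 2 * D * h * g" by (simp add: algebra_simps)
  moreover have "(9 + 2 * m) * h\<^sup>2 = 7 * h\<^sup>2 + 2 * h\<^sup>2 + 2 * m * h\<^sup>2" by (simp add: algebra_simps)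
  ultimately show ?thesis using t1 t2 t3 Q unfolding D_def[symmetric] by linarith
qed

lemma chain_step_laplace_error:
  assumes sol: "averaging_solution \<rho>" and l: "0 \<le> l" and N: "0 < N" and s: "0 \<le> s" and h: "0 \<le> h"
    and r: "0 \<le> r" "r * real N \<le> h" "h - r * real N \<le> h\<^sup>2 * m" and m: "0 \<le> m"
    and x: "\<forall>i<N. 0 \<le> x i"
  shows "chain_step N r (laplace_error N \<rho> l (s + h)) x
    \<le> laplace_error N \<rho> l s x + 2 * h * laplace_error N \<rho> (l / 2) s x + 2 * h / real N + (9 + 2 * m) * h\<^sup>2"
proof -
  let ?L = "\<lambda>s. laplace_sol \<rho> s"
  let ?d = "\<lambda>p. laplace_emp N l (average_on p x) - laplace_emp N l x"
  have l2: "0 \<le> l/2" and sh: "0 \<le> s + h" using l s h by auto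
  have "chain_step N r (laplace_error N \<rho> l (s + h)) x
     = (laplace_emp N l x - ?L (s + h) l)\<^sup>2 + r * (\<Sum>p\<in>pairs N. 2 * (laplace_emp N l x - ?L (s + h) l) * ?d p + (?d p)\<^sup>2)"
    unfolding chain_step_def laplace_error_def
    by (intro arg_cong2[of _ _ _ _ "(+)"] arg_cong2[of _ _ _ _ "(*)"] sum.cong refl)
       (simp add: power2_eq_square algebra_simps)
  also have "(\<Sum>p\<in>pairs N. 2 * (laplace_emp N l x - ?L (s + h) l) * ?d p + (?d p)\<^sup>2)
     = 2 * (laplace_emp N l x - ?L (s + h) l) * (real N * ((laplace_emp N (l / 2) x)\<^sup>2 - laplace_emp N l x)) + (\<Sum>p\<in>pairs N. (?d p)\<^sup>2)"
    unfolding sum.distrib sum_distrib_left[symmetric] sum_pairs_laplace_emp[OF N] by simp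
  finally have e: "chain_step N r (laplace_error N \<rho> l (s + h)) x
     = (laplace_emp N l x - ?L (s + h) l)\<^sup>2
      + r * (2 * (laplace_emp N l x - ?L (s + h) l) * (real N * ((laplace_emp N (l / 2) x)\<^sup>2 - laplace_emp N l x)) + (\<Sum>p\<in>pairs N. (?d p)\<^sup>2))" .
  have Q: "r * (\<Sum>p\<in>pairs N. (?d p)\<^sup>2) \<le> 2 * h / real N"
  proof -
    have "(?d p)\<^sup>2 \<le> (2 / real N)\<^sup>2" if "p \<in> pairs N" for p
      using average_on_laplace_emp_change[OF that l x] by (metis abs_ge_zero power2_abs power_mono)
    then have "(\<Sum>p\<in>pairs N. (?d p)\<^sup>2) \<le> real (card (pairs N)) * (2 / real N)\<^sup>2"
      by (rule sum_bounded_above)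
    also have "\<dots> \<le> (real N)\<^sup>2 / 2 * (2 / real N)\<^sup>2"
      using card_pairs[of N] by (intro mult_right_mono) (auto simp: power2_eq_square algebra_simps)
    also have "\<dots> = 2" using N by (simp add: power2_eq_square)
    finally have "r * (\<Sum>p\<in>pairs N. (?d p)\<^sup>2) \<le> r * 2" using r by (intro mult_left_mono)
    also have "\<dots> \<le> 2 * h / real N" using r N by (simp add: field_simps)
    finally show ?thesis .
  qed
  show ?thesis
    unfolding e unfolding laplace_error_def
  proof (rule squared_error_step[OF _ _ _ _ _ _ _ _ _ _ h _ _ _ r m Q])
    show "\<bar>?L (s + h) l - ?L s l - h * ((?L s (l / 2))\<^sup>2 - ?L s l)\<bar> \<le> 3 * h\<^sup>2"
      using laplace_one_step[OF sol l s h] by (simp add: laplace_rate_def)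
    show "\<bar>?L (s + h) l - ?L s l\<bar> \<le> h"
      using laplace_lipschitz[OF sol l s, of "s + h"] h by simp
  qed (use laplace_emp_bounds[OF l N x] laplace_emp_bounds[OF l2 N x] solution_laplace_bounds[OF sol l s]
      solution_laplace_bounds[OF sol l2 s] solution_laplace_bounds[OF sol l sh] N in auto)
qed

text \<open>Discrete Gronwall inequality, for all \<open>l \<le> l0\<close> simultaneously because a step at \<open>l\<close> involves the
error at \<open>l/2\<close>. The bound is pointwise in the initial state, so that it can be integrated afterwards
against the initial law.\<close>
lemma funpow_chain_step_laplace_error:
  fixes r h m S :: real
  assumes sol: "averaging_solution \<rho>" and N: "0 < N" and h: "0 \<le> h"
    and r: "0 \<le> r" "r * real N \<le> h" "h - r * real N \<le> h\<^sup>2 * m" "r * card (pairs N) \<le> 1" and m: "0 \<le> m"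
    and x: "\<forall>i<N. 0 \<le> x i"
    and S: "\<And>l. 0 \<le> l \<Longrightarrow> l \<le> l0 \<Longrightarrow> laplace_error N \<rho> l 0 x \<le> S"
    and l: "0 \<le> l" "l \<le> l0"
  shows "(chain_step N r ^^ k) (laplace_error N \<rho> l (real k * h)) x
    \<le> (1 + 2 * h) ^ k * (S + real k * (2 * h / real N + (9 + 2 * m) * h\<^sup>2))"
  using l
proof (induction k arbitrary: l)
  case 0
  then show ?case using S by simp
next
  case (Suc k)
  let ?E = "2 * h / real N + (9 + 2 * m) * h\<^sup>2"
  let ?F = "\<lambda>l. laplace_error N \<rho> l (real k * h)"
  have E: "0 \<le> ?E" using h m by simp
  have l2: "0 \<le> l/2" "l/2 \<le> l0" using Suc.prems by auto
  have kh: "0 \<le> real k * h" "real (Suc k) * h = real k * h + h" using h by (simp_all add: algebra_simps)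
  have "(chain_step N r ^^ Suc k) (laplace_error N \<rho> l (real (Suc k) * h)) x
     = (chain_step N r ^^ k) (chain_step N r (laplace_error N \<rho> l (real k * h + h))) x"
    unfolding kh(2) by (simp only: funpow_Suc_right o_def)
  also have "\<dots> \<le> (chain_step N r ^^ k) (\<lambda>y. 1 * ?F l y + 2 * h * ?F (l/2) y + ?E) x"
  proof (rule funpow_chain_step_mono[OF r(1,4) _ x])
    fix y :: "nat \<Rightarrow> real" assume y: "\<forall>i<N. 0 \<le> y i"
    show "chain_step N r (laplace_error N \<rho> l (real k * h + h)) y \<le> 1 * ?F l y + 2 * h * ?F (l/2) y + ?E"
      using chain_step_laplace_error[OF sol Suc.prems(1) N kh(1) h r(1,2,3) m y] by simp
  qed
  also have "\<dots> = 1 * (chain_step N r ^^ k) (?F l) x + 2 * h * (chain_step N r ^^ k) (?F (l/2)) x + ?E"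
    by (rule funpow_chain_step_linear)
  also have "\<dots> \<le> 1 * ((1 + 2 * h) ^ k * (S + real k * ?E)) + 2 * h * ((1 + 2 * h) ^ k * (S + real k * ?E)) + ?E"
    by (intro add_mono mult_left_mono Suc.IH l2 Suc.prems order_refl) (use h in auto)
  also have "\<dots> = (1 + 2 * h) ^ Suc k * (S + real k * ?E) + ?E"
    by (simp add: algebra_simps)
  also have "\<dots> \<le> (1 + 2 * h) ^ Suc k * (S + real k * ?E) + (1 + 2 * h) ^ Suc k * ?E"
    using mult_right_mono[OF one_le_power[of "1 + 2 * h" "Suc k"] E] h by simp
  also have "\<dots> = (1 + 2 * h) ^ Suc k * (S + real (Suc k) * ?E)"
    by (simp add: algebra_simps add_divide_distrib)
  finally show ?case .
qed

section \<open>Ring times in a cell of the time grid\<close>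

definition only_ring :: "nat \<Rightarrow> (nat set \<Rightarrow> nat) \<Rightarrow> nat set \<Rightarrow> bool" where
  "only_ring N d p \<longleftrightarrow> d p = 1 \<and> (\<forall>q\<in>pairs N - {p}. d q = 0)"

text \<open>The pair whose clock rings exactly once while all others are silent; the empty set if there is no
such pair, in particular if no clock rings.\<close>
definition selected :: "nat \<Rightarrow> (nat set \<Rightarrow> nat) \<Rightarrow> nat set" where
  "selected N d = (if \<exists>p\<in>pairs N. only_ring N d p then THE p. p \<in> pairs N \<and> only_ring N d p else {})"

lemma empty_notin_pairs [simp]: "{} \<notin> pairs N"
  by (auto simp: pairs_def)

lemma only_ring_unique: "only_ring N d p \<Longrightarrow> only_ring N d q \<Longrightarrow> p \<in> pairs N \<Longrightarrow> q \<in> pairs N \<Longrightarrow> p = q"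
  by (force simp: only_ring_def)

lemma selected_eq: "p \<in> pairs N \<Longrightarrow> only_ring N d p \<Longrightarrow> selected N d = p"
  unfolding selected_def using only_ring_unique[of N d]
  by (subst if_P, blast) (rule the_equality; blast)

lemma selected_in: "selected N d \<in> insert {} (pairs N)"
proof (cases "\<exists>p\<in>pairs N. only_ring N d p")
  case True
  then obtain p where "p \<in> pairs N" "only_ring N d p" by blast
  then show ?thesis using selected_eq[of p N d] by simp
qed (simp add: selected_def)

lemma selected_eq_iff:
  "p \<in> pairs N \<Longrightarrow> selected N d = p \<longleftrightarrow> only_ring N d p"
proof
  assume p: "p \<in> pairs N" and s: "selected N d = p"
  show "only_ring N d p"
  proof (rule ccontr)
    assume n: "\<not> only_ring N d p"
    show False
    proof (cases "\<exists>q\<in>pairs N. only_ring N d q")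
      case True
      then obtain q where q: "q \<in> pairs N" "only_ring N d q" by blast
      from selected_eq[OF this] q n s show False by simp
    next
      case False
      then have "selected N d = {}" by (simp add: selected_def)
      then show False using s p by simp
    qed
  qed
qed (rule selected_eq)

lemma selected_empty_iff: "selected N d = {} \<longleftrightarrow> (\<forall>p\<in>pairs N. \<not> only_ring N d p)"
  using selected_in[of N d] selected_eq_iff[of _ N d] empty_notin_pairs by (metis insertE)

lemma selected_cong:
  assumes "\<And>p. p \<in> pairs N \<Longrightarrow> d p = d' p"
  shows "selected N d = selected N d'"
proof -
  have "(\<lambda>p. p \<in> pairs N \<and> only_ring N d p) = (\<lambda>p. p \<in> pairs N \<and> only_ring N d' p)"
    using assms by (auto simp: only_ring_def)
  then show ?thesis unfolding selected_def Bex_def by (simp only:)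
qed

lemma no_ring_if_const:
  assumes "mono_on {0..} k" "0 \<le> a" "a < w" "w \<le> b" "k b = k a"
  shows "\<not> rings_at k w"
proof
  assume "rings_at k w"
  then have "k a < k w" using assms by (simp add: rings_at_def)
  moreover have "k w \<le> k b" using assms by (intro mono_onD[OF assms(1)]) auto
  ultimately show False using assms(5) by simp
qed

text \<open>The ring time is the infimum of the times at which the clock has already advanced. Right-continuity
shows that the clock has advanced at this time, monotonicity that it had not before.\<close>
lemma single_ring:
  fixes k :: "real \<Rightarrow> nat"
  assumes mono: "mono_on {0..} k" and rc: "\<And>t. 0 \<le> t \<Longrightarrow> continuous (at_right t) k"
    and a: "0 \<le> a" "a < b" and one: "k b = Suc (k a)"
  obtains u where "a < u" "u \<le> b" "rings_at k u" "\<And>w. a \<le> w \<Longrightarrow> w < u \<Longrightarrow> k w = k a" "k u = k b"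
proof -
  define S where "S = {u. a \<le> u \<and> u \<le> b \<and> k a < k u}"
  define u where "u = Inf S"
  have bS: "b \<in> S" using a one by (simp add: S_def)
  have bdd: "bdd_below S" by (rule bdd_belowI[of _ a]) (simp add: S_def)
  have ub: "u \<le> b" unfolding u_def by (rule cInf_lower[OF bS bdd])
  have au: "a \<le> u" unfolding u_def by (rule cInf_greatest) (use bS in \<open>auto simp: S_def\<close>)
  have before: "k w = k a" if "a \<le> w" "w < u" for w
  proof -
    have "w \<notin> S" using that cInf_lower[OF _ bdd, of w] by (auto simp: u_def)
    then have "k w \<le> k a" using that ub by (auto simp: S_def)
    moreover have "k a \<le> k w" using that a by (intro mono_onD[OF mono]) auto
    ultimately show ?thesis by simp
  qed
  have ku: "k a < k u"
  proof (rule ccontr)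
    assume "\<not> k a < k u"
    moreover have "k a \<le> k u" using au a by (intro mono_onD[OF mono]) auto
    ultimately have eq: "k u = k a" by simp
    have "(k \<longlongrightarrow> k u) (at_right u)"
      using rc[of u] au a by (simp add: continuous_within)
    then have "\<forall>\<^sub>F s in at_right u. k s = k u" by (simp add: tendsto_discrete)
    then obtain c where c: "u < c" "\<And>s. u < s \<Longrightarrow> s < c \<Longrightarrow> k s = k u"
      by (auto simp: eventually_at_right_field)
    from cInf_lessD[of S c] c(1) bS obtain s where s: "s \<in> S" "s < c" by (auto simp: u_def)
    have "u \<le> s" unfolding u_def by (rule cInf_lower[OF s(1) bdd])
    then have "k s = k u" using c(2)[of s] s(2) by (cases "s = u") auto
    then show False using eq s(1) by (simp add: S_def)
  qed
  have "a < u" using ku au by (cases "a = u") auto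
  moreover have "k u \<le> k b" using ub au a by (intro mono_onD[OF mono]) auto
  then have "k u = k b" using ku one by simp
  moreover have "rings_at k u"
    unfolding rings_at_def
  proof (intro conjI allI impI)
    show "0 < u" using \<open>a < u\<close> a by simp
    fix s assume s: "0 \<le> s \<and> s < u"
    show "k s < k u"
    proof (cases "a \<le> s")
      case True
      then show ?thesis using before[of s] s ku by simp
    next
      case False
      then have "k s \<le> k a" using s a by (intro mono_onD[OF mono]) auto
      then show ?thesis using ku by simp
    qed
  qed
  ultimately show thesis using that ub before by blast
qed

text \<open>If the cell contains a single ring, the path is constant before it and after it, and the update at
the ring applies to a state equal to the one at the beginning of the cell.\<close>
lemma grid_cell_path:
  fixes k :: "nat set \<Rightarrow> real \<Rightarrow> nat" and x :: "real \<Rightarrow> nat \<Rightarrow> real"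
  assumes mono: "\<And>p. p \<in> pairs N \<Longrightarrow> mono_on {0..} (k p)"
    and rc: "\<And>p t. p \<in> pairs N \<Longrightarrow> 0 \<le> t \<Longrightarrow> continuous (at_right t) (k p)"
    and const: "\<And>s t. 0 \<le> s \<Longrightarrow> s \<le> t \<Longrightarrow> (\<And>p u. p \<in> pairs N \<Longrightarrow> s < u \<Longrightarrow> u \<le> t \<Longrightarrow> \<not> rings_at (k p) u) \<Longrightarrow> \<forall>i<N. x t i = x s i"
    and jump: "\<And>t i j. i < N \<Longrightarrow> j < N \<Longrightarrow> i \<noteq> j \<Longrightarrow> rings_at (k {i, j}) t \<Longrightarrow>
        \<forall>\<^sub>F s in at_left t. \<forall>l<N. x t l = average_pair i j (x s) l"
    and a: "0 \<le> a" "a < b"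
    and good: "(\<forall>p\<in>pairs N. k p b - k p a = 0) \<or> (\<exists>p\<in>pairs N. only_ring N (\<lambda>p. k p b - k p a) p)"
    and l: "l < N"
  shows "x b l = average_on (selected N (\<lambda>p. k p b - k p a)) (x a) l"
  using good
proof
  have le: "k p a \<le> k p b" if "p \<in> pairs N" for p
    using a by (intro mono_onD[OF mono[OF that]]) auto
  {
    assume z: "\<forall>p\<in>pairs N. k p b - k p a = 0"
    have "\<forall>i<N. x b i = x a i"
    proof (rule const)
      fix p u assume p: "p \<in> pairs N" and u: "a < u" "u \<le> b"
      have "k p b = k p a" using z le[OF p] p by force
      from no_ring_if_const[OF mono[OF p] a(1) u this] show "\<not> rings_at (k p) u" .
    qed (use a in auto)
    moreover have "selected N (\<lambda>p. k p b - k p a) = {}"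
      using z by (auto simp: selected_empty_iff only_ring_def)
    ultimately show ?thesis using l by simp
  }
  {
    assume "\<exists>p\<in>pairs N. only_ring N (\<lambda>p. k p b - k p a) p"
    then obtain p where p: "p \<in> pairs N" and o: "only_ring N (\<lambda>p. k p b - k p a) p" by blast
    have sel: "selected N (\<lambda>p. k p b - k p a) = p" by (rule selected_eq[OF p o])
    have "k p b - k p a = 1" using o by (simp only: only_ring_def)
    then have one: "k p b = Suc (k p a)" using le[OF p] by linarith
    have others: "k q b = k q a" if "q \<in> pairs N" "q \<noteq> p" for q
      using o le[OF that(1)] that by (force simp: only_ring_def)
    obtain u where u: "a < u" "u \<le> b" "rings_at (k p) u" "\<And>w. a \<le> w \<Longrightarrow> w < u \<Longrightarrow> k p w = k p a" "k p u = k p b"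
      using single_ring[OF mono[OF p] rc[OF p] a one] by blast
    from p obtain i j where ij: "p = {i, j}" "i < N" "j < N" "i \<noteq> j" by (rule pairsE)
    have "\<forall>\<^sub>F s in at_left u. \<forall>l<N. x u l = average_pair i j (x s) l"
      using jump[OF ij(2-4)] u(3) ij(1) by simp
    then obtain c where c: "c < u" "\<And>s. c < s \<Longrightarrow> s < u \<Longrightarrow> \<forall>l<N. x u l = average_pair i j (x s) l"
      by (auto simp: eventually_at_left_field)
    define s where "s = (max a c + u) / 2"
    have s: "a < s" "c < s" "s < u" using u(1) c(1) by (auto simp: s_def)
    have before: "\<forall>i<N. x s i = x a i"
    proof (rule const)
      fix q w assume q: "q \<in> pairs N" and w: "a < w" "w \<le> s"
      have "k q s = k q a"
      proof (cases "q = p")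
        case True then show ?thesis using u(4)[of s] s by simp
      next
        case False
        have "k q a \<le> k q s" "k q s \<le> k q b"
          using a s u by (auto intro!: mono_onD[OF mono[OF q]])
        then show ?thesis using others[OF q False] by simp
      qed
      from no_ring_if_const[OF mono[OF q] a(1) w this] show "\<not> rings_at (k q) w" .
    qed (use a s in auto)
    have after: "\<forall>i<N. x b i = x u i"
    proof (rule const)
      fix q w assume q: "q \<in> pairs N" and w: "u < w" "w \<le> b"
      have u0: "0 \<le> u" using a u by simp
      have "k q b = k q u"
      proof (cases "q = p")
        case True then show ?thesis using u(5) by simp
      next
        case False
        have "k q a \<le> k q u" "k q u \<le> k q b"
          using a s u by (auto intro!: mono_onD[OF mono[OF q]])
        then show ?thesis using others[OF q False] by simp
      qed
      from no_ring_if_const[OF mono[OF q] u0 w this] show "\<not> rings_at (k q) w" .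
    qed (use a u in auto)
    have "x u l = average_pair i j (x s) l" using c(2)[OF s(2,3)] l by simp
    also have "\<dots> = average_pair i j (x a) l"
      using before l ij(2,3) by (simp add: average_pair_def)
    finally show ?thesis using after l sel by (simp add: ij(1) average_pair_eq[OF ij(4)])
  }
qed

lemma grid_path:
  fixes k :: "nat set \<Rightarrow> real \<Rightarrow> nat" and x :: "real \<Rightarrow> nat \<Rightarrow> real"
  assumes cell: "\<And>m. m < n \<Longrightarrow> \<forall>l<N. x (real (Suc m) * h) l = average_on (c m) (x (real m * h)) l"
    and c: "\<And>m. m < n \<Longrightarrow> c m \<in> insert {} (pairs N)"
  shows "\<forall>l<N. x (real n * h) l = fold average_on (map c [0..<n]) (x 0) l"
  using cell c
proof (induction n)
  case (Suc n)
  have IH: "\<forall>l<N. x (real n * h) l = fold average_on (map c [0..<n]) (x 0) l"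
    by (rule Suc.IH) (use Suc.prems in auto)
  have sub: "c n \<subseteq> {..<N}" using Suc.prems(2)[of n] by (auto simp: pairs_def)
  have "average_on (c n) (x (real n * h)) l = average_on (c n) (fold average_on (map c [0..<n]) (x 0)) l"
    if "l < N" for l
  proof -
    have "(\<Sum>i\<in>c n. x (real n * h) i) = (\<Sum>i\<in>c n. fold average_on (map c [0..<n]) (x 0) i)"
      by (rule sum.cong) (use IH sub in auto)
    then show ?thesis using IH that by (simp add: average_on_def)
  qed
  then show ?case using Suc.prems(1)[of n] by (simp del: of_nat_Suc)
qed simp

section \<open>Independence and law of the selected pairs\<close>

lemma measurable_nat_diff:
  fixes f g :: "'a \<Rightarrow> nat"
  assumes "f \<in> M \<rightarrow>\<^sub>M count_space UNIV" "g \<in> M \<rightarrow>\<^sub>M count_space UNIV"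
  shows "(\<lambda>x. f x - g x) \<in> M \<rightarrow>\<^sub>M count_space UNIV"
  by (rule measurable_compose_countable[OF _ assms(1), where f = "\<lambda>m x. m - g x"],
      rule measurable_compose[OF assms(2)]) simp

lemma measurable_only_ring:
  assumes "\<And>p. p \<in> pairs N \<Longrightarrow> (\<lambda>x. d x p) \<in> M \<rightarrow>\<^sub>M count_space UNIV" "p \<in> pairs N"
  shows "Measurable.pred M (\<lambda>x. only_ring N (d x) p)"
  unfolding only_ring_def
proof (intro pred_intros_logic pred_intros_finite)
  show "Measurable.pred M (\<lambda>x. d x p = 1)"
    using assms by (intro measurable_compose[OF assms(1)]) auto
  show "Measurable.pred M (\<lambda>x. d x q = 0)" if "q \<in> pairs N - {p}" for q
    using that by (intro measurable_compose[OF assms(1)]) auto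
qed auto

text \<open>Stated for parametrized counts, since it is applied to functions on the sample space as well as to
functions on the product space of clock paths.\<close>
lemma measurable_selected_eq:
  assumes "\<And>p. p \<in> pairs N \<Longrightarrow> (\<lambda>x. d x p) \<in> M \<rightarrow>\<^sub>M count_space UNIV" "c \<in> insert {} (pairs N)"
  shows "Measurable.pred M (\<lambda>x. selected N (d x) = c)"
proof (cases "c = {}")
  case True
  have "Measurable.pred M (\<lambda>x. \<forall>p\<in>pairs N. \<not> only_ring N (d x) p)"
    by (intro pred_intros_logic pred_intros_finite measurable_only_ring assms) auto
  then show ?thesis by (simp add: True selected_empty_iff)
next
  case False
  then have "c \<in> pairs N" using assms(2) by simp
  from measurable_only_ring[OF assms(1) this] show ?thesis by (simp add: selected_eq_iff[OF \<open>c \<in> pairs N\<close>])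
qed

definition selection_weight :: "nat \<Rightarrow> real \<Rightarrow> nat set \<Rightarrow> real" where
  "selection_weight N r c = (if c = {} then 1 - real (card (pairs N)) * r else r)"

text \<open>An iterate of the operator is an average over all histories of selections. This replaces conditional
expectations: each history is a fixed map of the initial state with a product weight.\<close>
lemma funpow_chain_step_expand:
  "(chain_step N r ^^ n) F x =
    (\<Sum>js \<in> {js. set js \<subseteq> insert {} (pairs N) \<and> length js = n}.
      (\<Prod>k<n. selection_weight N r (js ! k)) * F (fold average_on js x))"
proof (induction n arbitrary: x)
  case 0
  have "{js. set js \<subseteq> insert {} (pairs N) \<and> length js = 0} = {[]}" by auto
  then show ?case by simp
next
  case (Suc n)
  let ?C = "insert {} (pairs N)"
  let ?S = "\<lambda>n. {js. set js \<subseteq> ?C \<and> length js = n}"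
  have S: "?S (Suc n) = (\<lambda>(js, c). c # js) ` (?S n \<times> ?C)"
    by (rule lists_length_Suc_eq)
  have inj: "inj_on (\<lambda>(js, c). c # js) (?S n \<times> ?C)" by (auto simp: inj_on_def)
  have "(\<Sum>js\<in>?S (Suc n). (\<Prod>k<Suc n. selection_weight N r (js ! k)) * F (fold average_on js x))
    = (\<Sum>(js, c)\<in>?S n \<times> ?C. (\<Prod>k<Suc n. selection_weight N r ((c # js) ! k)) * F (fold average_on (c # js) x))"
    unfolding S sum.reindex[OF inj] o_def by (simp add: case_prod_beta)
  also have "\<dots> = (\<Sum>(js, c)\<in>?S n \<times> ?C. selection_weight N r c *
      ((\<Prod>k<n. selection_weight N r (js ! k)) * F (fold average_on js (average_on c x))))"
    by (intro sum.cong refl) (auto simp: prod.lessThan_Suc_shift mult.assoc simp del: prod.lessThan_Suc)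
  also have "\<dots> = (\<Sum>c\<in>?C. selection_weight N r c * (chain_step N r ^^ n) F (average_on c x))"
    unfolding Suc.IH sum_distrib_left sum.cartesian_product[symmetric]
    by (rule sum.swap)
  also have "\<dots> = (1 - card (pairs N) * r) * (chain_step N r ^^ n) F x
      + (\<Sum>p\<in>pairs N. r * (chain_step N r ^^ n) F (average_on p x))"
  proof -
    have "(\<Sum>p\<in>pairs N. selection_weight N r p * (chain_step N r ^^ n) F (average_on p x))
      = (\<Sum>p\<in>pairs N. r * (chain_step N r ^^ n) F (average_on p x))"
      by (intro sum.cong refl) (auto simp: selection_weight_def)
    then show ?thesis by (simp add: selection_weight_def)
  qed
  also have "\<dots> = (chain_step N r ^^ Suc n) F x"
    by (simp add: chain_step_def sum_subtractf sum_distrib_left[symmetric] algebra_simps)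
  finally show ?case ..
qed

context repeated_averaging
begin

definition increment :: "real \<Rightarrow> nat \<Rightarrow> 'w \<Rightarrow> nat set \<Rightarrow> nat" where
  "increment h k \<omega> p = K p (real (Suc k) * h) \<omega> - K p (real k * h) \<omega>"

lemma measurable_clock: "p \<in> pairs N \<Longrightarrow> 0 \<le> t \<Longrightarrow> K p t \<in> M \<rightarrow>\<^sub>M count_space UNIV"
  by (rule poisson_process.measurable_K[OF clocks])

lemma measurable_increment:
  "p \<in> pairs N \<Longrightarrow> 0 \<le> h \<Longrightarrow> (\<lambda>\<omega>. increment h k \<omega> p) \<in> M \<rightarrow>\<^sub>M count_space UNIV"
  unfolding increment_def by (intro measurable_nat_diff measurable_clock) auto

text \<open>Independence within each clock and independence of the clocks combine to independence of the
whole array, as probabilities of boxes factorize first over clocks and then over cells.\<close>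
lemma indep_increments:
  assumes h: "0 \<le> h" and ne: "pairs N \<noteq> {}" "0 < n"
  shows "indep_vars (\<lambda>_. count_space UNIV) (\<lambda>(p, k) \<omega>. increment h k \<omega> p) (pairs N \<times> {..<n})"
proof (subst indep_vars_finite[where E = "\<lambda>_. sets (count_space UNIV)"])
  let ?Q = "Pi\<^sub>M {0..} (\<lambda>_. count_space UNIV) :: (real \<Rightarrow> nat) measure"
  let ?pre = "\<lambda>A j. (case j of (p, k) \<Rightarrow> \<lambda>\<omega>. increment h k \<omega> p) -` A j \<inter> space M"
  let ?path = "\<lambda>p \<omega>. \<lambda>t\<in>{0..}. K p t \<omega>"
  show "\<forall>A\<in>pairs N \<times> {..<n} \<rightarrow> sets (count_space UNIV).
     prob (\<Inter>j\<in>pairs N \<times> {..<n}. ?pre A j)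
      = (\<Prod>j\<in>pairs N \<times> {..<n}. prob (?pre A j))"
  proof
    fix A :: "nat set \<times> nat \<Rightarrow> nat set" assume "A \<in> pairs N \<times> {..<n} \<rightarrow> sets (count_space UNIV)"
    define B where "B p = {f \<in> space ?Q. \<forall>k\<in>{..<n}. f (real (Suc k) * h) - f (real k * h) \<in> A (p, k)}" for p
    have B: "B p \<in> sets ?Q" for p
      unfolding B_def
    proof (rule sets.sets_Collect_finite_All')
      fix k
      have "(\<lambda>f. f (real (Suc k) * h) - f (real k * h)) \<in> ?Q \<rightarrow>\<^sub>M count_space UNIV"
        using h by (intro measurable_nat_diff measurable_component_singleton) auto
      from measurable_sets[OF this, of "A (p, k)"]
      show "{f \<in> space ?Q. f (real (Suc k) * h) - f (real k * h) \<in> A (p, k)} \<in> sets ?Q"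
        by (simp add: vimage_def Int_def conj_commute)
    qed (use ne in auto)
    have pre: "?path p -` B p \<inter> space M = (\<Inter>k\<in>{..<n}. (\<lambda>\<omega>. increment h k \<omega> p) -` A (p, k) \<inter> space M)" for p
      using ne h by (auto simp: B_def space_PiM increment_def)
    have "prob (\<Inter>j\<in>pairs N \<times> {..<n}. ?pre A j)
      = prob (\<Inter>p\<in>pairs N. ?path p -` B p \<inter> space M)"
      unfolding pre using ne by (intro arg_cong[where f = prob]) auto
    also have "\<dots> = (\<Prod>p\<in>pairs N. prob (?path p -` B p \<inter> space M))"
      by (rule indep_varsD_finite[OF independent_clocks]) (use ne B in auto)
    also have "\<dots> = (\<Prod>p\<in>pairs N. \<Prod>k<n. prob ((\<lambda>\<omega>. increment h k \<omega> p) -` A (p, k) \<inter> space M))"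
    proof (rule prod.cong[OF refl])
      fix p assume "p \<in> pairs N"
      then interpret P: poisson_process M "1 / real N" "K p" by (rule clocks)
      have "indep_vars (\<lambda>_. count_space UNIV) (\<lambda>k \<omega>. increment h k \<omega> p) {..<n}"
        unfolding increment_def
        by (rule P.independent_increments[where \<tau> = "\<lambda>k. real k * h"])
           (use h in \<open>auto simp: mono_def mult_right_mono\<close>)
      then show "prob (?path p -` B p \<inter> space M) = (\<Prod>k<n. prob ((\<lambda>\<omega>. increment h k \<omega> p) -` A (p, k) \<inter> space M))"
        unfolding pre by (rule indep_varsD_finite) (use ne in auto)
    qed
    finally show "prob (\<Inter>j\<in>pairs N \<times> {..<n}. ?pre A j)
      = (\<Prod>j\<in>pairs N \<times> {..<n}. prob (?pre A j))"
      by (simp add: prod.cartesian_product case_prod_beta')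
  qed
next
  show "pairs N \<times> {..<n} \<noteq> {}" "finite (pairs N \<times> {..<n})" using ne by auto
  show "random_variable (count_space UNIV) (case z of (p, k) \<Rightarrow> \<lambda>\<omega>. increment h k \<omega> p)"
    if "z \<in> pairs N \<times> {..<n}" for z
    using that measurable_increment[OF _ h] by (cases z) simp
  show "sets (count_space UNIV) = sigma_sets (space (count_space UNIV)) (sets (count_space (UNIV :: nat set)))"
    by (rule sets.sigma_sets_eq[symmetric])
qed (auto simp: Int_stable_def)

lemma prob_increment:
  assumes p: "p \<in> pairs N" and h: "0 < h"
  shows "prob ((\<lambda>\<omega>. increment h k \<omega> p) -` {m} \<inter> space M) = (h / real N) ^ m / fact m * exp (- (h / real N))"
proof -
  interpret P: poisson_process M "1 / real N" "K p" by (rule clocks[OF p])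
  have N: "0 < N" using p by (auto simp: pairs_def)
  have "prob ((\<lambda>\<omega>. increment h k \<omega> p) -` {m} \<inter> space M) = measure (distr M (count_space UNIV) (\<lambda>\<omega>. increment h k \<omega> p)) {m}"
    using measurable_increment[OF p, of h] h by (subst measure_distr) auto
  also have "distr M (count_space UNIV) (\<lambda>\<omega>. increment h k \<omega> p) = measure_pmf (poisson_pmf (1 / real N * (real (Suc k) * h - real k * h)))"
    unfolding increment_def by (rule P.poisson_increments) (use h in \<open>auto intro: mult_nonneg_nonneg\<close>)
  also have "1 / real N * (real (Suc k) * h - real k * h) = h / real N" by (simp add: algebra_simps)
  also have "measure (measure_pmf (poisson_pmf (h / real N))) {m} = pmf (poisson_pmf (h / real N)) m"
    by (simp add: measure_pmf_single)
  finally show ?thesis using N h by simp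
qed

lemma prob_increments:
  assumes h: "0 < h" and ne: "pairs N \<noteq> {}"
  shows "prob {\<omega>\<in>space M. \<forall>p\<in>pairs N. increment h k \<omega> p = m p}
    = (\<Prod>p\<in>pairs N. (h / real N) ^ m p / fact (m p) * exp (- (h / real N)))"
proof -
  let ?pre = "\<lambda>z. (case z of (p, k) \<Rightarrow> \<lambda>\<omega>. increment h k \<omega> p) -` {m (fst z)} \<inter> space M"
  have "indep_vars (\<lambda>_. count_space UNIV) (\<lambda>(p, k) \<omega>. increment h k \<omega> p) (pairs N \<times> {..<Suc k})"
    by (rule indep_increments) (use h ne in auto)
  then have "prob (\<Inter>z\<in>pairs N \<times> {k}. ?pre z)
    = (\<Prod>z\<in>pairs N \<times> {k}. prob (?pre z))"
    by (rule indep_varsD) (use ne in auto)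
  also have "(\<Inter>z\<in>pairs N \<times> {k}. ?pre z)
     = {\<omega>\<in>space M. \<forall>p\<in>pairs N. increment h k \<omega> p = m p}"
    using ne by auto
  also have "(\<Prod>z\<in>pairs N \<times> {k}. prob (?pre z))
     = (\<Prod>p\<in>pairs N. prob ((\<lambda>\<omega>. increment h k \<omega> p) -` {m p} \<inter> space M))"
    by (rule prod.reindex_bij_witness[of _ "\<lambda>p. (p, k)" fst]) auto
  also have "\<dots> = (\<Prod>p\<in>pairs N. (h / real N) ^ m p / fact (m p) * exp (- (h / real N)))"
    by (intro prod.cong refl prob_increment h)
  finally show ?thesis .
qed

definition ring_prob :: "real \<Rightarrow> real" where
  "ring_prob h = h / real N * exp (- (real (card (pairs N)) * (h / real N)))"

lemma prob_no_ring:
  assumes h: "0 < h" and ne: "pairs N \<noteq> {}"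
  shows "prob {\<omega>\<in>space M. \<forall>p\<in>pairs N. increment h k \<omega> p = 0} = exp (- (real (card (pairs N)) * (h / real N)))"
  using prob_increments[OF h ne, of k "\<lambda>_. 0"] by (simp add: exp_of_nat_mult[symmetric])

lemma prob_selected_pair:
  assumes h: "0 < h" and p: "p \<in> pairs N"
  shows "prob {\<omega>\<in>space M. selected N (increment h k \<omega>) = p} = ring_prob h"
proof -
  let ?m = "\<lambda>q. if q = p then 1 else 0 :: nat"
  have "{\<omega>\<in>space M. selected N (increment h k \<omega>) = p} = {\<omega>\<in>space M. \<forall>q\<in>pairs N. increment h k \<omega> q = ?m q}"
    using p unfolding selected_eq_iff[OF p] only_ring_def by (intro Collect_cong) (metis Diff_iff singletonD singletonI)
  moreover have "(\<Prod>q\<in>pairs N. (h / real N) ^ ?m q / fact (?m q) * exp (- (h / real N)))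
     = (\<Prod>q\<in>pairs N. (if q = p then h / real N else 1) * exp (- (h / real N)))"
    by (intro prod.cong) auto
  moreover have "\<dots> = ring_prob h"
    using p by (simp add: prod.distrib prod.delta' ring_prob_def exp_of_nat_mult[symmetric])
  moreover have "prob {\<omega>\<in>space M. \<forall>q\<in>pairs N. increment h k \<omega> q = ?m q}
      = (\<Prod>q\<in>pairs N. (h / real N) ^ ?m q / fact (?m q) * exp (- (h / real N)))"
    by (rule prob_increments[OF h]) (use p in blast)
  ultimately show ?thesis by (simp only:)
qed

lemma events_selected:
  assumes h: "0 \<le> h" and c: "c \<in> insert {} (pairs N)"
  shows "{\<omega>\<in>space M. selected N (increment h k \<omega>) = c} \<in> events"
proof -
  have "Measurable.pred M (\<lambda>\<omega>. selected N (increment h k \<omega>) = c)"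
    by (rule measurable_selected_eq[OF measurable_increment[OF _ h] c])
  then show ?thesis by (simp add: pred_def)
qed

lemma prob_selected:
  assumes h: "0 < h" and c: "c \<in> insert {} (pairs N)"
  shows "prob {\<omega>\<in>space M. selected N (increment h k \<omega>) = c} = selection_weight N (ring_prob h) c"
proof (cases "c = {}")
  case False
  then show ?thesis using prob_selected_pair[OF h] c by (simp add: selection_weight_def)
next
  case True
  let ?A = "\<lambda>c. {\<omega>\<in>space M. selected N (increment h k \<omega>) = c}"
  have "?A {} = space M - (\<Union>p\<in>pairs N. ?A p)"
    using selected_in[of N] by (auto simp: selected_empty_iff selected_eq_iff)
  then have "prob (?A {}) = 1 - prob (\<Union>p\<in>pairs N. ?A p)"
    using events_selected[of h _ k] h by (simp add: prob_compl sets.finite_UN)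
  also have "prob (\<Union>p\<in>pairs N. ?A p) = (\<Sum>p\<in>pairs N. prob (?A p))"
    using h by (intro finite_measure_finite_Union) (auto simp: disjoint_family_on_def intro!: events_selected)
  also have "\<dots> = real (card (pairs N)) * ring_prob h"
    using prob_selected_pair[OF h] by simp
  finally show ?thesis using True by (simp add: selection_weight_def)
qed

text \<open>At least two rings in the cell.\<close>
definition bad_cell :: "real \<Rightarrow> nat \<Rightarrow> 'w \<Rightarrow> bool" where
  "bad_cell h k \<omega> \<longleftrightarrow> selected N (increment h k \<omega>) = {} \<and> \<not> (\<forall>p\<in>pairs N. increment h k \<omega> p = 0)"

lemma events_bad_cell:
  assumes h: "0 \<le> h"
  shows "{\<omega>\<in>space M. bad_cell h k \<omega>} \<in> events"
proof -
  have "Measurable.pred M (\<lambda>\<omega>. \<forall>p\<in>pairs N. increment h k \<omega> p = 0)"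
    by (intro pred_intros_finite finite_pairs measurable_compose[OF measurable_increment[OF _ h]]) auto
  moreover have "Measurable.pred M (\<lambda>\<omega>. selected N (increment h k \<omega>) = {})"
    using events_selected[OF h, of "{}" k] by (simp add: pred_def)
  ultimately have "Measurable.pred M (bad_cell h k)"
    unfolding bad_cell_def by (intro pred_intros_logic)
  then show ?thesis by (simp add: pred_def)
qed

text \<open>The number of rings in a cell is Poisson with parameter \<open>a = card (pairs N) h / N\<close>, and
\<open>1 - (1 + a) exp (- a) \<le> a\<^sup>2\<close>.\<close>
lemma prob_bad_cell:
  assumes h: "0 < h" and ne: "pairs N \<noteq> {}"
  shows "prob {\<omega>\<in>space M. bad_cell h k \<omega>} \<le> (real (card (pairs N)) * (h / real N))\<^sup>2"
proof -
  let ?a = "real (card (pairs N)) * (h / real N)"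
  let ?Z = "{\<omega>\<in>space M. \<forall>p\<in>pairs N. increment h k \<omega> p = 0}"
  let ?S = "{\<omega>\<in>space M. selected N (increment h k \<omega>) = {}}"
  have h0: "0 \<le> h" using h by simp
  have "Measurable.pred M (\<lambda>\<omega>. \<forall>p\<in>pairs N. increment h k \<omega> p = 0)"
    by (intro pred_intros_finite finite_pairs measurable_compose[OF measurable_increment[OF _ h0]]) auto
  then have Z: "?Z \<in> events" by (simp add: pred_def)
  have sub: "?Z \<subseteq> ?S" by (auto simp: selected_empty_iff only_ring_def)
  have "{\<omega>\<in>space M. bad_cell h k \<omega>} = ?S - ?Z" by (auto simp: bad_cell_def)
  then have "prob {\<omega>\<in>space M. bad_cell h k \<omega>} = prob ?S - prob ?Z"
    using finite_measure_Diff[OF events_selected[OF h0, of "{}" k] Z sub] by simp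
  also have "\<dots> = 1 - (1 + ?a) * exp (- ?a)"
    using prob_selected[OF h, of "{}" k] prob_no_ring[OF h ne, of k]
    by (simp add: selection_weight_def ring_prob_def algebra_simps)
  also have "\<dots> \<le> 1 - (1 + ?a) * (1 - ?a)"
  proof -
    have "1 - ?a \<le> exp (- ?a)" using exp_ge_add_one_self[of "- ?a"] by simp
    from mult_left_mono[OF this, of "1 + ?a"] show ?thesis using h by simp
  qed
  also have "\<dots> = ?a\<^sup>2" by (simp add: power2_eq_square algebra_simps)
  finally show ?thesis .
qed

lemma grid_representation:
  assumes h: "0 < h"
  shows "AE \<omega> in M. (\<forall>k<n. \<not> bad_cell h k \<omega>) \<longrightarrow>
    (\<forall>l<N. X (real n * h) \<omega> l = fold average_on (map (\<lambda>k. selected N (increment h k \<omega>)) [0..<n]) (X 0 \<omega>) l)"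
proof -
  have "AE \<omega> in M. \<forall>p\<in>pairs N. K p 0 \<omega> = 0 \<and> mono_on {0..} (\<lambda>t. K p t \<omega>) \<and>
      (\<forall>t\<ge>0. continuous (at_right t) (\<lambda>s. K p s \<omega>))"
    by (intro AE_finite_allI finite_pairs poisson_process.paths[OF clocks])
  then show ?thesis using constant_between_rings jumps
  proof eventually_elim
    case (elim \<omega>)
    show ?case
    proof
      assume good: "\<forall>k<n. \<not> bad_cell h k \<omega>"
      show "\<forall>l<N. X (real n * h) \<omega> l = fold average_on (map (\<lambda>k. selected N (increment h k \<omega>)) [0..<n]) (X 0 \<omega>) l"
      proof (rule grid_path[where x = "\<lambda>t. X t \<omega>"])
        fix m assume m: "m < n"
        show "\<forall>l<N. X (real (Suc m) * h) \<omega> l = average_on (selected N (increment h m \<omega>)) (X (real m * h) \<omega>) l"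
        proof (intro allI impI)
          fix l assume l: "l < N"
          show "X (real (Suc m) * h) \<omega> l = average_on (selected N (increment h m \<omega>)) (X (real m * h) \<omega>) l"
            unfolding increment_def[abs_def]
          proof (rule grid_cell_path[where x = "\<lambda>t. X t \<omega>" and k = "\<lambda>p t. K p t \<omega>"])
            show "\<And>p. p \<in> pairs N \<Longrightarrow> mono_on {0..} (\<lambda>t. K p t \<omega>)" using elim(1) by blast
            show "\<And>p t. p \<in> pairs N \<Longrightarrow> 0 \<le> t \<Longrightarrow> continuous (at_right t) (\<lambda>t. K p t \<omega>)" using elim(1) by blast
            show "\<forall>i<N. X t \<omega> i = X s \<omega> i" if "0 \<le> s" "s \<le> t"
                "\<And>p u. p \<in> pairs N \<Longrightarrow> s < u \<Longrightarrow> u \<le> t \<Longrightarrow> \<not> rings_at (\<lambda>t. K p t \<omega>) u" for s t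
              using elim(2) that by (metis greaterThanAtMost_iff)
            show "\<forall>\<^sub>F s in at_left t. \<forall>l<N. X t \<omega> l = average_pair i j (X s \<omega>) l"
              if "i < N" "j < N" "i \<noteq> j" "rings_at (\<lambda>t. K {i, j} t \<omega>) t" for i j t
              using elim(3) that by blast
            show "(\<forall>p\<in>pairs N. K p (real (Suc m) * h) \<omega> - K p (real m * h) \<omega> = 0) \<or>
              (\<exists>p\<in>pairs N. only_ring N (\<lambda>p. K p (real (Suc m) * h) \<omega> - K p (real m * h) \<omega>) p)"
              using good m unfolding bad_cell_def selected_empty_iff increment_def[abs_def] by blast
          qed (use h l in auto)
        qed
        show "selected N (increment h m \<omega>) \<in> insert {} (pairs N)" by (rule selected_in)
      qed
    qed
  qed
qed

end

abbreviation states :: "nat \<Rightarrow> (nat \<Rightarrow> real) measure" where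
  "states N \<equiv> Pi\<^sub>M {..<N} (\<lambda>_. borel)"

lemma measurable_average_on:
  assumes p: "p \<in> insert {} (pairs N)"
  shows "average_on p \<in> states N \<rightarrow>\<^sub>M states N"
proof (rule measurable_PiM_single')
  have sub: "p \<subseteq> {..<N}" using p by (auto simp: pairs_def)
  show "(\<lambda>x. average_on p x i) \<in> borel_measurable (states N)" if "i \<in> {..<N}" for i
  proof (cases "i \<in> p")
    case True
    have "(\<lambda>x. (\<Sum>i\<in>p. x i) / 2 :: real) \<in> borel_measurable (states N)"
      using sub by (intro borel_measurable_divide borel_measurable_sum measurable_component_singleton) auto
    then show ?thesis using True by (simp add: average_on_def)
  next
    case False
    then show ?thesis using that by (simp add: average_on_def measurable_component_singleton)
  qed
  show "average_on p \<in> space (states N) \<rightarrow> (\<Pi>\<^sub>E i\<in>{..<N}. space borel)"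
    using sub by (auto simp: space_PiM average_on_def PiE_def extensional_def)
qed

lemma measurable_fold_average_on:
  "set js \<subseteq> insert {} (pairs N) \<Longrightarrow>
    fold average_on js \<in> states N \<rightarrow>\<^sub>M states N"
proof (induction js)
  case (Cons p js)
  then show ?case
    using measurable_comp[OF measurable_average_on[of p N] Cons.IH] by (simp add: o_def)
qed simp

lemma fold_average_on_cong:
  assumes "set js \<subseteq> insert {} (pairs N)" "\<forall>i<N. x i = y i"
  shows "\<forall>i<N. fold average_on js x i = fold average_on js y i"
  using assms
proof (induction js arbitrary: x y)
  case (Cons p js)
  have "p \<subseteq> {..<N}" using Cons.prems(1) by (auto simp: pairs_def)
  then have "(\<Sum>i\<in>p. x i) = (\<Sum>i\<in>p. y i)" using Cons.prems(2) by (intro sum.cong) auto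
  then have "\<forall>i<N. average_on p x i = average_on p y i"
    using Cons.prems(2) by (simp add: average_on_def)
  then show ?case using Cons.IH Cons.prems(1) by simp
qed simp

lemma fold_average_on_nonneg:
  assumes "set js \<subseteq> insert {} (pairs N)" "\<forall>i<N. 0 \<le> x i"
  shows "\<forall>i<N. 0 \<le> fold average_on js x i"
  using assms
proof (induction js arbitrary: x)
  case (Cons p js)
  have "\<forall>i<N. 0 \<le> average_on p x i"
    using Cons.prems by (cases "p = {}") (auto intro: average_on_nonneg)
  then show ?case using Cons.IH Cons.prems(1) by simp
qed simp

lemma fold_average_on_mean:
  assumes "set js \<subseteq> insert {} (pairs N)"
  shows "sample_mean N (\<lambda>y. y) (fold average_on js x) = sample_mean N (\<lambda>y. y) x"
  using assms
proof (induction js arbitrary: x)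
  case (Cons p js)
  have "sample_mean N (\<lambda>y. y) (average_on p x) = sample_mean N (\<lambda>y. y) x"
  proof (cases "p = {}")
    case False
    then have "p \<in> pairs N" using Cons.prems by simp
    then obtain i j where ij: "p = {i, j}" "i < N" "j < N" "i \<noteq> j" by (rule pairsE)
    show ?thesis using sample_mean_average_on[OF ij(2-4), of "\<lambda>y. y" x] by (simp add: ij(1) add_divide_distrib)
  qed simp
  then show ?case using Cons by simp
qed simp

text \<open>The initial state and the clock paths take values in different types, so that their independence is
expressed by the generated algebras; numerical functions of them are independent variables.\<close>
lemma (in prob_space) indep_var_of_vimage_algebras:
  assumes ind: "indep_set (sets (vimage_algebra (space M) V S)) (sets (vimage_algebra (space M) W T))"
    and V: "V \<in> M \<rightarrow>\<^sub>M S" and W: "W \<in> M \<rightarrow>\<^sub>M T" and g: "g \<in> S \<rightarrow>\<^sub>M S'" and f: "f \<in> T \<rightarrow>\<^sub>M T'"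
  shows "indep_var S' (\<lambda>\<omega>. g (V \<omega>)) T' (\<lambda>\<omega>. f (W \<omega>))"
proof -
  have sub: "sigma_sets (space M) {(\<lambda>\<omega>. g (V \<omega>)) -` A \<inter> space M |A. A \<in> sets S'} \<subseteq> sets (vimage_algebra (space M) V S)"
    if V: "V \<in> M \<rightarrow>\<^sub>M S" and g: "g \<in> S \<rightarrow>\<^sub>M S'" for V :: "'a \<Rightarrow> 'x" and S g and S' :: "'y measure"
  proof -
    have "(\<lambda>\<omega>. g (V \<omega>)) -` A \<inter> space M \<in> sets (vimage_algebra (space M) V S)" if "A \<in> sets S'" for A
    proof -
      have "(\<lambda>\<omega>. g (V \<omega>)) -` A \<inter> space M = V -` (g -` A \<inter> space S) \<inter> space M"
        using measurable_space[OF V] by auto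
      then show ?thesis
        using in_vimage_algebra[OF measurable_sets[OF g that], of V "space M"] by simp
    qed
    then have "sigma_sets (space (vimage_algebra (space M) V S)) {(\<lambda>\<omega>. g (V \<omega>)) -` A \<inter> space M |A. A \<in> sets S'}
        \<subseteq> sets (vimage_algebra (space M) V S)"
      by (intro sets.sigma_sets_subset) auto
    then show ?thesis by simp
  qed
  have "indep_set (sigma_sets (space M) {(\<lambda>\<omega>. g (V \<omega>)) -` A \<inter> space M |A. A \<in> sets S'})
      (sigma_sets (space M) {(\<lambda>\<omega>. f (W \<omega>)) -` A \<inter> space M |A. A \<in> sets T'})"
    using ind sub[OF V g] sub[OF W f] unfolding indep_sets2_eq by blast
  then show ?thesis
    using measurable_compose[OF V g] measurable_compose[OF W f] by (simp add: indep_var_eq)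
qed

context repeated_averaging
begin

abbreviation state0 :: "'w \<Rightarrow> nat \<Rightarrow> real" where
  "state0 \<omega> \<equiv> \<lambda>i\<in>{..<N}. X 0 \<omega> i"

lemma random_variable_state0: "random_variable (states N) state0"
  by (intro measurable_restrict measurable_X) auto

lemma random_variable_paths:
  "random_variable (Pi\<^sub>M (pairs N) (\<lambda>_. Pi\<^sub>M {0..} (\<lambda>_. count_space UNIV))) (\<lambda>\<omega>. \<lambda>p\<in>pairs N. \<lambda>t\<in>{0..}. K p t \<omega>)"
  by (intro measurable_restrict measurable_clock) auto

definition selections :: "real \<Rightarrow> nat \<Rightarrow> 'w \<Rightarrow> nat set list" where
  "selections h n \<omega> = map (\<lambda>k. selected N (increment h k \<omega>)) [0..<n]"

lemma selections_in: "set (selections h n \<omega>) \<subseteq> insert {} (pairs N)" "length (selections h n \<omega>) = n"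
  using selected_in by (auto simp: selections_def simp del: insert_iff)

lemma selections_eq_iff:
  "length js = n \<Longrightarrow> selections h n \<omega> = js \<longleftrightarrow> (\<forall>k<n. selected N (increment h k \<omega>) = js ! k)"
  by (auto simp: selections_def list_eq_iff_nth_eq)

lemma prob_selections:
  assumes h: "0 < h" and ne: "pairs N \<noteq> {}" and js: "set js \<subseteq> insert {} (pairs N)" "length js = n"
  shows "prob {\<omega>\<in>space M. selections h n \<omega> = js} = (\<Prod>k<n. selection_weight N (ring_prob h) (js ! k))"
proof (cases "n = 0")
  case True
  then show ?thesis using js by (simp add: selections_def prob_space)
next
  case False
  let ?row = "\<lambda>k \<omega>. restrict (\<lambda>z. (case z of (p, k) \<Rightarrow> \<lambda>\<omega>. increment h k \<omega> p) \<omega>) (pairs N \<times> {k})"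
    and ?J = "{\<omega>\<in>space M. selections h n \<omega> = js}"
  have jsk: "js ! k \<in> insert {} (pairs N)" if "k < n" for k
  proof -
    have "js ! k \<in> set js" using that js(2) by simp
    with js(1) show ?thesis by blast
  qed
  have ind: "indep_vars (\<lambda>_. count_space UNIV) (\<lambda>(p, k) \<omega>. increment h k \<omega> p) (pairs N \<times> {..<n})"
    by (rule indep_increments) (use h ne False in auto)
  have "indep_vars (\<lambda>k. Pi\<^sub>M (pairs N \<times> {k}) (\<lambda>_. count_space UNIV))
     (\<lambda>k \<omega>. ?row k \<omega>) {..<n}"
    by (rule indep_vars_restrict[OF ind]) (auto simp: disjoint_family_on_def)
  then have "indep_vars (\<lambda>_. count_space UNIV)
     (\<lambda>k \<omega>. (\<lambda>f. selected N (\<lambda>p. f (p, k)) = js ! k) (?row k \<omega>)) {..<n}"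
    by (rule indep_vars_compose2)
       (intro measurable_selected_eq measurable_component_singleton; use jsk in auto)
  also have "?this \<longleftrightarrow> indep_vars (\<lambda>_. count_space UNIV) (\<lambda>k \<omega>. selected N (increment h k \<omega>) = js ! k) {..<n}"
  proof (rule indep_vars_cong)
    fix k assume "k \<in> {..<n}"
    have "selected N (\<lambda>p. ?row k \<omega> (p, k)) = selected N (increment h k \<omega>)" for \<omega>
      by (rule selected_cong) simp
    then show "(\<lambda>\<omega>. (\<lambda>f. selected N (\<lambda>p. f (p, k)) = js ! k) (?row k \<omega>))
      = (\<lambda>\<omega>. selected N (increment h k \<omega>) = js ! k)" by (simp only:)
  qed simp_all
  finally have ind2: "indep_vars (\<lambda>_. count_space UNIV) (\<lambda>k \<omega>. selected N (increment h k \<omega>) = js ! k) {..<n}" .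
  have "?J = (\<Inter>k\<in>{..<n}. (\<lambda>\<omega>. selected N (increment h k \<omega>) = js ! k) -` {True} \<inter> space M)"
    using False by (auto simp: selections_eq_iff[OF js(2)])
  then have "prob ?J
     = (\<Prod>k<n. prob ((\<lambda>\<omega>. selected N (increment h k \<omega>) = js ! k) -` {True} \<inter> space M))"
    using indep_varsD_finite[OF ind2, of "\<lambda>_. {True}"] False by auto
  also have "\<dots> = (\<Prod>k<n. selection_weight N (ring_prob h) (js ! k))"
  proof (intro prod.cong refl)
    fix k assume "k \<in> {..<n}"
    then have "prob {\<omega>\<in>space M. selected N (increment h k \<omega>) = js ! k} = selection_weight N (ring_prob h) (js ! k)"
      by (intro prob_selected h jsk) simp
    then show "prob ((\<lambda>\<omega>. selected N (increment h k \<omega>) = js ! k) -` {True} \<inter> space M) = selection_weight N (ring_prob h) (js ! k)"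
      by (simp add: vimage_def Int_def conj_commute)
  qed
  finally show ?thesis .
qed

lemma selections_indep_initial:
  assumes h: "0 < h" and js: "set js \<subseteq> insert {} (pairs N)" "length js = n"
    and g: "g \<in> borel_measurable (states N)" and int: "integrable M (\<lambda>\<omega>. g (state0 \<omega>))"
  shows "expectation (\<lambda>\<omega>. indicator {\<omega>\<in>space M. selections h n \<omega> = js} \<omega> * g (state0 \<omega>))
    = prob {\<omega>\<in>space M. selections h n \<omega> = js} * expectation (\<lambda>\<omega>. g (state0 \<omega>))"
    and "integrable M (\<lambda>\<omega>. indicator {\<omega>\<in>space M. selections h n \<omega> = js} \<omega> * g (state0 \<omega>))"
    and "{\<omega>\<in>space M. selections h n \<omega> = js} \<in> events"
proof -
  let ?Q = "Pi\<^sub>M (pairs N) (\<lambda>_. Pi\<^sub>M {0..} (\<lambda>_. count_space UNIV)) :: (nat set \<Rightarrow> real \<Rightarrow> nat) measure"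
  let ?path = "\<lambda>\<omega>. \<lambda>p\<in>pairs N. \<lambda>t\<in>{0..}. K p t \<omega>"
  have jsk: "js ! k \<in> insert {} (pairs N)" if "k < n" for k
  proof -
    have "js ! k \<in> set js" using that js(2) by simp
    with js(1) show ?thesis by blast
  qed
  let ?B = "\<lambda>f. \<forall>k\<in>{..<n}. selected N (\<lambda>p. f p (real (Suc k) * h) - f p (real k * h) :: nat) = js ! k"
  let ?J = "{\<omega>\<in>space M. selections h n \<omega> = js}" and ?S = "{f \<in> space ?Q. ?B f}"
  have B: "Measurable.pred ?Q ?B"
  proof (intro pred_intros_finite measurable_selected_eq measurable_nat_diff)
    fix p and k :: nat assume p: "p \<in> pairs N"
    have "(\<lambda>f. f p t) \<in> ?Q \<rightarrow>\<^sub>M count_space UNIV" if "0 \<le> t" for t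
      using measurable_compose[OF measurable_component_singleton[OF p] measurable_component_singleton[of t "{0..}"]] that by simp
    then show "(\<lambda>f. f p (real (Suc k) * h)) \<in> ?Q \<rightarrow>\<^sub>M count_space UNIV"
      "(\<lambda>f. f p (real k * h)) \<in> ?Q \<rightarrow>\<^sub>M count_space UNIV" using h by auto
  qed (use jsk in auto)
  then have Bs: "?S \<in> sets ?Q" by (simp add: pred_def)
  have sel: "selected N (\<lambda>p. ?path \<omega> p (real (Suc k) * h) - ?path \<omega> p (real k * h)) = selected N (increment h k \<omega>)" for \<omega> k
    by (rule selected_cong) (use h in \<open>simp add: increment_def\<close>)
  have ind: "(indicator ?J \<omega> :: real) = indicator ?S (?path \<omega>)" 
    if "\<omega> \<in> space M" for \<omega>
    using that sel[of \<omega>] by (auto simp: indicator_def selections_eq_iff[OF js(2)] space_PiM)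
  note rv = random_variable_paths
  have vim: "?J = ?path -` ?S \<inter> space M"
  proof -
    have "?B (?path \<omega>) \<longleftrightarrow> selections h n \<omega> = js" for \<omega>
      unfolding sel selections_eq_iff[OF js(2)] by auto
    then show ?thesis using measurable_space[OF rv] by blast
  qed
  show ev: "?J \<in> events"
    unfolding vim by (rule measurable_sets[OF rv Bs])
  have "indep_var borel (\<lambda>\<omega>. g (state0 \<omega>)) borel (\<lambda>\<omega>. (indicator ?S :: _ \<Rightarrow> real) (?path \<omega>))"
    by (rule indep_var_of_vimage_algebras[OF independent_initial random_variable_state0 rv g]) (use Bs in simp)
  then have iv: "indep_var borel (g \<circ> state0) borel ((indicator ?S :: _ \<Rightarrow> real) \<circ> ?path)"
    by (simp only: o_def)
  have i1: "integrable M (g \<circ> state0)" using int by (simp add: o_def)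
  have eqf: "(indicator ?S \<circ> ?path) \<omega> = (indicator ?J \<omega> :: real)" if "\<omega> \<in> space M" for \<omega>
    using ind[OF that] by (simp only: o_apply)
  have "integrable M (indicator ?J :: _ \<Rightarrow> real)"
    by (rule integrable_real_indicator[OF ev]) (simp add: emeasure_eq_measure)
  then have i2: "integrable M ((indicator ?S :: _ \<Rightarrow> real) \<circ> ?path)"
    by (subst Bochner_Integration.integrable_cong[OF refl eqf]) auto
  note E = indep_var_lebesgue_integral[OF iv i1 i2] indep_var_integrable[OF iv i1 i2]
  have eqp: "indicator ?J \<omega> * g (state0 \<omega>)
     = (g \<circ> state0) \<omega> * (indicator ?S \<circ> ?path) \<omega>" if "\<omega> \<in> space M" for \<omega>
    using eqf[OF that] by simp
  have "expectation (indicator ?S \<circ> ?path) = expectation (indicator ?J :: _ \<Rightarrow> real)"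
    by (rule Bochner_Integration.integral_cong[OF refl eqf])
  also have "\<dots> = prob ?J"
    using ev by simp
  finally have P: "expectation (indicator ?S \<circ> ?path) = prob ?J" .
  show "expectation (\<lambda>\<omega>. indicator ?J \<omega> * g (state0 \<omega>))
    = prob ?J * expectation (\<lambda>\<omega>. g (state0 \<omega>))"
  proof -
    have "expectation (\<lambda>\<omega>. indicator ?J \<omega> * g (state0 \<omega>))
      = expectation (\<lambda>\<omega>. (g \<circ> state0) \<omega> * (indicator ?S \<circ> ?path) \<omega>)"
      by (rule Bochner_Integration.integral_cong[OF refl eqp])
    also have "\<dots> = expectation (g \<circ> state0) * prob ?J"
      by (simp only: E(1) P)
    finally show ?thesis by (simp add: o_def)
  qed
  show "integrable M (\<lambda>\<omega>. indicator ?J \<omega> * g (state0 \<omega>))"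
    by (rule Bochner_Integration.integrable_cong[OF refl eqp, THEN iffD2, OF _ E(2)])
qed

end

section \<open>Comparison of the particle system with the discrete chain\<close>

context repeated_averaging
begin

lemma random_variable_state:
  "0 \<le> t \<Longrightarrow> (\<lambda>\<omega>. \<lambda>i\<in>{..<N}. X t \<omega> i) \<in> M \<rightarrow>\<^sub>M states N"
  by (intro measurable_restrict measurable_X) auto

lemma random_variable_functional:
  assumes Fm: "F \<in> borel_measurable (states N)"
    and Fc: "\<And>x y. \<forall>i<N. x i = y i \<Longrightarrow> F x = F y" and t: "0 \<le> t"
  shows "(\<lambda>\<omega>. F (X t \<omega>)) \<in> borel_measurable M"
proof -
  have "F (X t \<omega>) = F (\<lambda>i\<in>{..<N}. X t \<omega> i)" for \<omega> by (rule Fc) simp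
  then show ?thesis using measurable_compose[OF random_variable_state[OF t] Fm] by simp
qed

text \<open>On the event that no cell is bad, exactly one history of selections occurs, and it determines the
state at time \<open>n h\<close>; the complement is estimated by the union bound. Independence turns the sum over
histories into the iterated one-step operator.\<close>
lemma chain_expectation:
  assumes h: "0 < h" and ne: "pairs N \<noteq> {}"
    and Fm: "F \<in> borel_measurable (states N)"
    and Fc: "\<And>x y. \<forall>i<N. x i = y i \<Longrightarrow> F x = F y"
    and Fb: "\<And>x. \<forall>i<N. 0 \<le> x i \<Longrightarrow> 0 \<le> F x \<and> F x \<le> (1::real)"
  shows "expectation (\<lambda>\<omega>. F (X (real n * h) \<omega>))
     \<le> expectation (\<lambda>\<omega>. (chain_step N (ring_prob h) ^^ n) F (X 0 \<omega>))
       + real n * (real (card (pairs N)) * (h / real N))\<^sup>2" (is "?lhs \<le> ?rhs")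
    and "integrable M (\<lambda>\<omega>. (chain_step N (ring_prob h) ^^ n) F (X 0 \<omega>))"
proof -
  let ?S = "{js. set js \<subseteq> insert {} (pairs N) \<and> length js = n}"
  let ?I = "\<lambda>js. indicator {\<omega>\<in>space M. selections h n \<omega> = js} :: 'w \<Rightarrow> real"
  let ?G = "\<lambda>js x. F (fold average_on js x)"
  let ?w = "\<lambda>js. \<Prod>k<n. selection_weight N (ring_prob h) (js ! k)"
  let ?bad = "\<lambda>k. {\<omega>\<in>space M. bad_cell h k \<omega>}"
  have finS: "finite ?S" by (rule finite_lists_length_eq) simp
  have nh: "0 \<le> real n * h" using h by simp
  have nn0: "\<forall>i<N. 0 \<le> state0 \<omega> i" if "\<omega> \<in> space M" for \<omega>
    using nonneg_X[of 0 _ \<omega>] that by simp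
  have Gm: "?G js \<in> borel_measurable (states N)" if "js \<in> ?S" for js
    using measurable_compose[OF measurable_fold_average_on Fm] that by blast
  have Gint: "integrable M (\<lambda>\<omega>. ?G js (state0 \<omega>))" if "js \<in> ?S" for js
  proof (rule integrable_const_bound[where B = 1])
    show "AE \<omega> in M. norm (?G js (state0 \<omega>)) \<le> 1"
    proof (rule AE_I2)
      fix \<omega> assume "\<omega> \<in> space M"
      then have "0 \<le> ?G js (state0 \<omega>) \<and> ?G js (state0 \<omega>) \<le> 1"
        using that by (intro Fb fold_average_on_nonneg nn0) auto
      then show "norm (?G js (state0 \<omega>)) \<le> 1" by simp
    qed
    show "(\<lambda>\<omega>. ?G js (state0 \<omega>)) \<in> borel_measurable M"
      by (rule measurable_compose[OF random_variable_state0 Gm[OF that]])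
  qed
  have G0: "?G js (X 0 \<omega>) = ?G js (state0 \<omega>)" if "js \<in> ?S" for js \<omega>
    by (rule Fc, rule fold_average_on_cong) (use that in auto)
  have expand: "(chain_step N (ring_prob h) ^^ n) F (X 0 \<omega>) = (\<Sum>js\<in>?S. ?w js * ?G js (state0 \<omega>))" for \<omega>
    unfolding funpow_chain_step_expand using G0 by (intro sum.cong) auto
  show "integrable M (\<lambda>\<omega>. (chain_step N (ring_prob h) ^^ n) F (X 0 \<omega>))"
    unfolding expand by (intro Bochner_Integration.integrable_sum integrable_mult_right Gint)
  have IGint: "integrable M (\<lambda>\<omega>. ?I js \<omega> * ?G js (state0 \<omega>))" if "js \<in> ?S" for js
    using that by (intro selections_indep_initial(2)[OF h _ _ Gm Gint]) auto
  have badE: "?bad k \<in> events" for k using events_bad_cell[of h k] h by simp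
  have badint: "integrable M (indicator (?bad k) :: 'w \<Rightarrow> real)" for k
    by (rule integrable_real_indicator[OF badE]) (simp add: emeasure_eq_measure)
  have "expectation (\<lambda>\<omega>. F (X (real n * h) \<omega>))
     \<le> expectation (\<lambda>\<omega>. (\<Sum>js\<in>?S. ?I js \<omega> * ?G js (state0 \<omega>)) + (\<Sum>k<n. indicator (?bad k) \<omega>))"
  proof (rule integral_mono_AE)
    show "integrable M (\<lambda>\<omega>. F (X (real n * h) \<omega>))"
    proof (rule integrable_const_bound[where B = 1])
      show "AE \<omega> in M. norm (F (X (real n * h) \<omega>)) \<le> 1"
        using Fb nonneg_X[OF nh] by (intro AE_I2) auto
    qed (rule random_variable_functional[OF Fm Fc nh])
    show "integrable M (\<lambda>\<omega>. (\<Sum>js\<in>?S. ?I js \<omega> * ?G js (state0 \<omega>)) + (\<Sum>k<n. indicator (?bad k) \<omega>))"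
      by (intro Bochner_Integration.integrable_add Bochner_Integration.integrable_sum IGint badint)
    show "AE \<omega> in M. F (X (real n * h) \<omega>) \<le> (\<Sum>js\<in>?S. ?I js \<omega> * ?G js (state0 \<omega>)) + (\<Sum>k<n. indicator (?bad k) \<omega>)"
      using grid_representation[OF h, of n] AE_space
    proof eventually_elim
      case (elim \<omega>)
      have Gb: "0 \<le> ?I js \<omega> * ?G js (state0 \<omega>)" if "js \<in> ?S" for js
      proof (rule mult_nonneg_nonneg)
        show "0 \<le> ?G js (state0 \<omega>)"
          by (rule conjunct1[OF Fb]) (use that elim(2) in \<open>intro fold_average_on_nonneg nn0; auto\<close>)
      qed simp
      show ?case
      proof (cases "\<forall>k<n. \<not> bad_cell h k \<omega>")
        case True
        let ?j = "selections h n \<omega>"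
        have j: "?j \<in> ?S" using selections_in by simp
        have "F (X (real n * h) \<omega>) = ?G ?j (X 0 \<omega>)"
          by (rule Fc) (use elim(1) True in \<open>simp add: selections_def\<close>)
        also have "\<dots> = ?I ?j \<omega> * ?G ?j (state0 \<omega>)"
          using G0[OF j] elim(2) by (simp add: indicator_def)
        also have "\<dots> \<le> (\<Sum>js\<in>?S. ?I js \<omega> * ?G js (state0 \<omega>))"
          using member_le_sum[OF j _ finS, of "\<lambda>js. ?I js \<omega> * ?G js (state0 \<omega>)"] Gb by blast
        finally show ?thesis by (simp add: add_increasing2 sum_nonneg)
      next
        case False
        then obtain k where k: "k < n" "bad_cell h k \<omega>" by blast
        have "F (X (real n * h) \<omega>) \<le> 1" using Fb nonneg_X[OF nh] elim(2) by simp
        also have "1 = (indicator (?bad k) \<omega> :: real)" using k elim(2) by simp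
        also have "\<dots> \<le> (\<Sum>k<n. indicator (?bad k) \<omega>)"
          using k(1) by (intro member_le_sum) auto
        finally show ?thesis using sum_nonneg[OF Gb, of ?S "\<lambda>x. x"] by (simp add: add_increasing)
      qed
    qed
  qed
  also have "\<dots> = (\<Sum>js\<in>?S. expectation (\<lambda>\<omega>. ?I js \<omega> * ?G js (state0 \<omega>))) + (\<Sum>k<n. prob (?bad k))"
    using IGint badint badE
    by (subst Bochner_Integration.integral_add) (auto simp: Bochner_Integration.integral_sum)
  also have "(\<Sum>js\<in>?S. expectation (\<lambda>\<omega>. ?I js \<omega> * ?G js (state0 \<omega>))) = (\<Sum>js\<in>?S. ?w js * expectation (\<lambda>\<omega>. ?G js (state0 \<omega>)))"
  proof (intro sum.cong refl)
    fix js assume js: "js \<in> ?S"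
    then show "expectation (\<lambda>\<omega>. ?I js \<omega> * ?G js (state0 \<omega>)) = ?w js * expectation (\<lambda>\<omega>. ?G js (state0 \<omega>))"
      by (subst selections_indep_initial(1)[OF h _ _ Gm[OF js] Gint[OF js]])
         (use prob_selections[OF h ne, of js n] in auto)
  qed
  also have "\<dots> = expectation (\<lambda>\<omega>. (chain_step N (ring_prob h) ^^ n) F (X 0 \<omega>))"
    unfolding expand using Gint by (subst Bochner_Integration.integral_sum) auto
  also have "(\<Sum>k<n. prob (?bad k)) \<le> real n * (real (card (pairs N)) * (h / real N))\<^sup>2"
    using sum_bounded_above[of "{..<n}" "\<lambda>k. prob (?bad k)"] prob_bad_cell[OF h ne] by simp
  finally show "?lhs \<le> ?rhs" by simp
qed

text \<open>On the event that no cell is bad the state arises by averagings, which preserve the mean. The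
probability of the complement is \<open>O(1/n)\<close> for every \<open>n\<close>.\<close>
lemma mean_conserved:
  assumes t: "0 < t" and ne: "pairs N \<noteq> {}"
  shows "AE \<omega> in M. sample_mean N (\<lambda>y. y) (X t \<omega>) = sample_mean N (\<lambda>y. y) (X 0 \<omega>)"
proof -
  let ?m = "sample_mean N (\<lambda>y. y)"
  let ?D = "{\<omega>\<in>space M. ?m (X t \<omega>) \<noteq> ?m (X 0 \<omega>)}"
  have mm: "(\<lambda>\<omega>. ?m (X s \<omega>)) \<in> borel_measurable M" if "0 \<le> s" for s
    unfolding sample_mean_def using measurable_X[OF that] by measurable
  have D: "?D \<in> events"
    using measurable_sets[OF borel_measurable_diff[OF mm[of t] mm[of 0]], of "- {0}"] t
    by (simp add: vimage_def Int_def conj_commute)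
  let ?c = "(real (card (pairs N)) * (t / real N))\<^sup>2"
  have le: "prob ?D \<le> ?c / real n" if n: "0 < n" for n
  proof -
    let ?h = "t / real n"
    have h: "0 < ?h" and nh: "real n * ?h = t" using t n by simp_all
    let ?bad = "\<lambda>k. {\<omega>\<in>space M. bad_cell ?h k \<omega>}"
    have badE: "?bad k \<in> events" for k using events_bad_cell[of ?h k] h by simp
    have "prob ?D \<le> prob (\<Union>k<n. ?bad k)"
    proof (rule finite_measure_mono_AE)
      show "AE \<omega> in M. \<omega> \<in> ?D \<longrightarrow> \<omega> \<in> (\<Union>k<n. ?bad k)"
        using grid_representation[OF h, of n]
      proof eventually_elim
        case (elim \<omega>)
        show ?case
        proof
          assume w: "\<omega> \<in> ?D"
          show "\<omega> \<in> (\<Union>k<n. ?bad k)"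
          proof (rule ccontr)
            assume "\<omega> \<notin> (\<Union>k<n. ?bad k)"
            then have "\<forall>l<N. X t \<omega> l = fold average_on (selections ?h n \<omega>) (X 0 \<omega>) l"
              using elim w unfolding nh selections_def by auto
            then have "?m (X t \<omega>) = ?m (fold average_on (selections ?h n \<omega>) (X 0 \<omega>))"
              by (simp add: sample_mean_def)
            also have "\<dots> = ?m (X 0 \<omega>)" by (rule fold_average_on_mean) (rule selections_in)
            finally show False using w by simp
          qed
        qed
      qed
    qed (use badE in auto)
    also have "\<dots> \<le> (\<Sum>k<n. prob (?bad k))"
      using badE by (intro finite_measure_subadditive_finite) auto
    also have "\<dots> \<le> real n * (real (card (pairs N)) * (?h / real N))\<^sup>2"
      using sum_bounded_above[of "{..<n}" "\<lambda>k. prob (?bad k)"] prob_bad_cell[OF h ne] by simp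
    also have "\<dots> = ?c / real n" using n by (simp add: power2_eq_square field_simps)
    finally show ?thesis .
  qed
  have "(\<lambda>n. ?c / real n) \<longlonglongrightarrow> 0" by (rule lim_const_over_n)
  then have "prob ?D \<le> 0"
    by (rule LIMSEQ_le_const) (use le in \<open>auto intro!: exI[of _ 1]\<close>)
  then have "prob ?D = 0" using measure_nonneg[of M ?D] by linarith
  then show ?thesis using D by (subst (asm) prob_eq_0) (auto elim!: AE_mp intro!: AE_I2)
qed

end

section \<open>Wasserstein distance and Laplace transforms\<close>

lemma wasserstein1_ge:
  assumes "1-lipschitz_on {0..} \<phi>" "integrable \<mu> \<phi>" "integrable \<nu> \<phi>"
  shows "ennreal \<bar>(\<integral>x. \<phi> x \<partial>\<mu>) - (\<integral>x. \<phi> x \<partial>\<nu>)\<bar> \<le> wasserstein1 \<mu> \<nu>"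
proof -
  have ge: "ennreal ((\<integral>x. \<phi> x \<partial>\<mu>) - (\<integral>x. \<phi> x \<partial>\<nu>)) \<le> wasserstein1 \<mu> \<nu>"
    if "1-lipschitz_on {0..} \<phi>" "integrable \<mu> \<phi>" "integrable \<nu> \<phi>" for \<phi>
    unfolding wasserstein1_def by (rule SUP_upper2[where i = \<phi>]) (use that in auto)
  have "1-lipschitz_on {0..} (\<lambda>x. - \<phi> x)" using assms(1) by (simp add: lipschitz_on_minus)
  from ge[OF assms] ge[OF this] assms(2,3) show ?thesis by (auto simp: abs_if)
qed

lemma measurable_lipschitz_half_line:
  assumes "L-lipschitz_on {0..} (f :: real \<Rightarrow> real)"
  shows "f \<in> borel_measurable half_line"
proof -
  have "f \<in> borel_measurable (restrict_space borel {0..})"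
    by (rule borel_measurable_continuous_on_restrict) (rule lipschitz_on_continuous_on[OF assms])
  moreover have "sets half_line = sets (restrict_space borel {0..})"
    unfolding half_line_def by (rule sets_restrict_space_cong) simp
  ultimately show ?thesis by (subst measurable_cong_sets[OF _ refl])
qed

lemma empirical_measure_facts:
  assumes N: "0 < N" and x: "\<forall>i<N. 0 \<le> x i"
  shows "prob_space (empirical_measure N x)"
    and "f \<in> borel_measurable half_line \<Longrightarrow> integrable (empirical_measure N x) (f :: real \<Rightarrow> real)"
    and "f \<in> borel_measurable half_line \<Longrightarrow> (\<integral>y. f y \<partial>empirical_measure N x) = sample_mean N f x"
proof -
  have x': "x \<in> uniform_count_measure {..<N} \<rightarrow>\<^sub>M half_line" by (rule measurable_indices) (use x in auto)
  interpret U: prob_space "uniform_count_measure {..<N}"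
    by (rule prob_space_uniform_count_measure) (use N in auto)
  show "prob_space (empirical_measure N x)"
    unfolding empirical_measure_def by (rule U.prob_space_distr[OF x'])
  show "integrable (empirical_measure N x) f" if "f \<in> borel_measurable half_line" for f :: "real \<Rightarrow> real"
  proof -
    have "integrable (uniform_count_measure {..<N}) (\<lambda>i. f (x i))"
      unfolding uniform_count_measure_def by (rule integrable_point_measure_finite) simp
    then show ?thesis unfolding empirical_measure_def by (subst integrable_distr_eq[OF x' that])
  qed
  show "(\<integral>y. f y \<partial>empirical_measure N x) = sample_mean N f x" if "f \<in> borel_measurable half_line" for f :: "real \<Rightarrow> real"
    unfolding empirical_measure_def sample_mean_def
    by (subst integral_distr[OF x' that], subst integral_uniform_count_measure) auto
qed

lemma laplace_empirical_measure:
  assumes N: "0 < N" and x: "\<forall>i<N. 0 \<le> x i"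
  shows "laplace (empirical_measure N x) l = laplace_emp N l x"
  unfolding laplace_def laplace_emp_def by (rule empirical_measure_facts(3)[OF assms]) measurable

lemma lipschitz_exp_half_line:
  assumes l: "0 \<le> l"
  shows "l-lipschitz_on {0..} (\<lambda>x::real. exp (- l * x))"
proof -
  have le: "exp (- l * a) - exp (- l * b) \<le> l * (b - a)" if "0 \<le> a" "a \<le> b" for a b :: real
  proof -
    have "exp (- l * a) - exp (- l * b) = exp (- l * a) * (1 - exp (- l * (b - a)))"
      by (simp add: right_diff_distrib exp_add[symmetric] algebra_simps)
    also have "\<dots> \<le> 1 * (l * (b - a))"
      using exp_ge_add_one_self[of "- l * (b - a)"] l that
      by (intro mult_mono) auto
    finally show ?thesis by simp
  qed
  have mono: "exp (- l * b) \<le> exp (- l * a)" if "a \<le> b" for a b :: real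
    using that l by (simp add: mult_left_mono)
  show ?thesis
  proof (rule lipschitz_onI)
    fix a b :: real assume ab: "a \<in> {0..}" "b \<in> {0..}"
    then show "dist (exp (- l * a)) (exp (- l * b)) \<le> l * dist a b"
      using le[of a b] le[of b a] mono[of a b] mono[of b a] unfolding dist_real_def
      by (cases "a \<le> b") (auto simp: abs_if)
  qed (rule l)
qed

lemma laplace_diff_le_wasserstein1:
  assumes \<mu>: "prob_space \<mu>" "sets \<mu> = sets half_line" and \<nu>: "prob_space \<nu>" "sets \<nu> = sets half_line" and l: "0 < l"
  shows "ennreal (\<bar>laplace \<mu> l - laplace \<nu> l\<bar> / l) \<le> wasserstein1 \<mu> \<nu>"
proof -
  let ?f = "\<lambda>x::real. 1 / l * exp (- l * x)"
  have "1-lipschitz_on {0..} ?f"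
  proof (rule lipschitz_onI)
    fix a b :: real assume ab: "a \<in> {0..}" "b \<in> {0..}"
    have "dist (?f a) (?f b) = 1 / l * dist (exp (- l * a)) (exp (- l * b))"
      using l by (simp add: dist_real_def right_diff_distrib[symmetric] abs_mult diff_divide_distrib[symmetric])
    also have "\<dots> \<le> 1 / l * (l * dist a b)"
      by (intro mult_left_mono lipschitz_onD[OF lipschitz_exp_half_line]) (use l ab in auto)
    finally show "dist (?f a) (?f b) \<le> 1 * dist a b" using l by simp
  qed simp
  from wasserstein1_ge[OF this, of \<mu> \<nu>]
  have "ennreal \<bar>(\<integral>x. ?f x \<partial>\<mu>) - (\<integral>x. ?f x \<partial>\<nu>)\<bar> \<le> wasserstein1 \<mu> \<nu>"
    using l integrable_exp_on_half_line[OF \<mu>] integrable_exp_on_half_line[OF \<nu>] by (auto intro: integrable_mult_right)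
  moreover have "\<bar>(\<integral>x. ?f x \<partial>\<mu>) - (\<integral>x. ?f x \<partial>\<nu>)\<bar> = \<bar>laplace \<mu> l - laplace \<nu> l\<bar> / l"
    unfolding laplace_def integral_mult_right_zero right_diff_distrib[symmetric] abs_mult using l by simp
  ultimately show ?thesis by simp
qed

text \<open>The variance of the binomial distribution is \<open>u (1 - u) / n\<close> after rescaling; the elementary bound
\<open>2 \<bar>d\<bar> \<le> s d\<^sup>2 + 1/s\<close> with \<open>s = sqrt n\<close> passes to the first absolute moment.\<close>
lemma Bernstein_mean_deviation:
  assumes n: "0 < n" and u: "0 \<le> u" "u \<le> 1"
  shows "(\<Sum>k\<le>n. \<bar>real k / real n - u\<bar> * Bernstein n k u) \<le> 1 / sqrt (real n)"
proof -
  have var: "(\<Sum>k\<le>n. (real k / real n - u)\<^sup>2 * Bernstein n k u) = u * (1 - u) / real n"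
  proof -
    have "(\<Sum>k\<le>n. (real k / real n - u)\<^sup>2 * Bernstein n k u)
      = (\<Sum>k\<le>n. (real k * (real k - 1) * Bernstein n k u) / (real n)\<^sup>2
          + (1 / (real n)\<^sup>2 - 2 * u / real n) * (real k * Bernstein n k u) + u\<^sup>2 * Bernstein n k u)"
      using n by (intro sum.cong refl) (simp add: field_simps power2_eq_square)
    also have "\<dots> = (real n * (real n - 1) * u\<^sup>2) / (real n)\<^sup>2 + (1 / (real n)\<^sup>2 - 2 * u / real n) * (real n * u) + u\<^sup>2"
      by (simp add: sum.distrib sum_divide_distrib[symmetric] sum_distrib_left[symmetric])
    also have "\<dots> = u * (1 - u) / real n"
      using n by (simp add: field_simps power2_eq_square)
    finally show ?thesis .
  qed
  have B: "0 \<le> Bernstein n k u" for k using Bernstein_nonneg[OF u] .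
  let ?s = "sqrt (real n)"
  have s: "0 < ?s" "?s * ?s = real n" using n by simp_all
  have am: "\<bar>d\<bar> \<le> (?s * d\<^sup>2 + 1 / ?s) / 2" for d
  proof -
    \<comment> \<open>Arithmetic and geometric mean of \<open>s d\<^sup>2\<close> and \<open>1/s\<close>.\<close>
    have "0 \<le> (?s * \<bar>d\<bar> - 1)\<^sup>2 / ?s" using s by simp
    also have "\<dots> = ?s * d\<^sup>2 - 2 * \<bar>d\<bar> + 1 / ?s"
      using s(1) by (simp add: power2_eq_square field_simps abs_mult_self_eq)
    finally show ?thesis by simp
  qed
  have "(\<Sum>k\<le>n. \<bar>real k / real n - u\<bar> * Bernstein n k u)
     \<le> (\<Sum>k\<le>n. (?s * (real k / real n - u)\<^sup>2 + 1 / ?s) / 2 * Bernstein n k u)"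
    by (intro sum_mono mult_right_mono am B)
  also have "\<dots> = (\<Sum>k\<le>n. ?s / 2 * ((real k / real n - u)\<^sup>2 * Bernstein n k u) + 1 / ?s / 2 * Bernstein n k u)"
    by (intro sum.cong refl) (simp add: algebra_simps add_divide_distrib)
  also have "\<dots> = ?s / 2 * (u * (1 - u) / real n) + 1 / ?s / 2"
    by (simp only: sum.distrib sum_distrib_left[symmetric] var sum_Bernstein mult_1_right)
  also have "\<dots> \<le> ?s / 2 * (1 / real n) + 1 / ?s / 2"
    using u by (intro add_right_mono mult_left_mono divide_right_mono mult_le_one) auto
  also have "\<dots> = 1 / ?s" using s n by (simp add: field_simps)
  finally show ?thesis .
qed

lemma Bernstein_lipschitz_approx:
  fixes f :: "real \<Rightarrow> real"
  assumes n: "0 < n" and u: "0 \<le> u" "u \<le> 1" and f: "L-lipschitz_on {0..1} f"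
  shows "\<bar>f u - (\<Sum>k\<le>n. f (real k / real n) * Bernstein n k u)\<bar> \<le> L / sqrt (real n)"
proof -
  have B: "0 \<le> Bernstein n k u" for k using Bernstein_nonneg[OF u] .
  have "f u - (\<Sum>k\<le>n. f (real k / real n) * Bernstein n k u) = (\<Sum>k\<le>n. (f u - f (real k / real n)) * Bernstein n k u)"
    by (simp add: left_diff_distrib sum_subtractf sum_distrib_left[symmetric])
  also have "\<bar>\<dots>\<bar> \<le> (\<Sum>k\<le>n. \<bar>(f u - f (real k / real n)) * Bernstein n k u\<bar>)"
    by (rule sum_abs)
  also have "\<dots> \<le> (\<Sum>k\<le>n. L * (\<bar>real k / real n - u\<bar> * Bernstein n k u))"
  proof (rule sum_mono)
    fix k assume "k \<in> {..n}"
    then have "\<bar>f u - f (real k / real n)\<bar> \<le> L * \<bar>real k / real n - u\<bar>"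
      using lipschitz_onD[OF f, of u "real k / real n"] u n by (simp add: dist_real_def abs_minus_commute)
    then show "\<bar>(f u - f (real k / real n)) * Bernstein n k u\<bar> \<le> L * (\<bar>real k / real n - u\<bar> * Bernstein n k u)"
      using B[of k] by (simp add: abs_mult mult.assoc[symmetric] mult_right_mono)
  qed
  also have "\<dots> \<le> L * (1 / sqrt (real n))"
    unfolding sum_distrib_left[symmetric]
    by (intro mult_left_mono Bernstein_mean_deviation n u lipschitz_on_nonneg[OF f])
  finally show ?thesis by simp
qed

text \<open>In the variable \<open>u = exp (- x)\<close> the cut-off \<open>x \<le> R\<close> becomes \<open>u \<ge> exp (- R)\<close>, where the logarithm has
Lipschitz constant \<open>exp R\<close>.\<close>
lemma lipschitz_log_transform:
  fixes \<phi> :: "real \<Rightarrow> real"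
  assumes \<phi>: "1-lipschitz_on {0..} \<phi>" and R: "0 \<le> R"
  shows "(exp R)-lipschitz_on {0..1} (\<lambda>u. \<phi> (- ln (max u (exp (- R)))))"
proof (rule lipschitz_onI)
  fix u v :: real assume uv: "u \<in> {0..1}" "v \<in> {0..1}"
  define a b where "a = max u (exp (- R))" and "b = max v (exp (- R))"
  have e: "exp (- R) \<le> 1" using R by simp
  have a: "exp (- R) \<le> a" "a \<le> 1" and b: "exp (- R) \<le> b" "b \<le> 1" using uv e by (auto simp: a_def b_def)
  have pos: "0 < a" "0 < b" using a b by (auto intro: less_le_trans[OF exp_gt_zero])
  have ab: "\<bar>a - b\<bar> \<le> \<bar>u - v\<bar>" by (auto simp: a_def b_def max_def)
  have ln: "ln a - ln b \<le> exp R * \<bar>a - b\<bar>" if "exp (- R) \<le> b" "0 < a" "0 < b" for a b :: real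
  proof -
    have "ln a - ln b = ln (a / b)" using that by (simp add: ln_div)
    also have "\<dots> \<le> a / b - 1" using that by (intro ln_le_minus_one) simp
    also have "\<dots> = (a - b) * (1 / b)" using that by (simp add: field_simps)
    also have "\<dots> \<le> \<bar>a - b\<bar> * exp R"
    proof (rule mult_mono)
      have "1 / b \<le> 1 / exp (- R)" using that by (intro divide_left_mono) auto
      then show "1 / b \<le> exp R" by (simp add: exp_minus inverse_eq_divide)
    qed (use that in auto)
    finally show ?thesis by (simp add: mult.commute)
  qed
  have "dist (\<phi> (- ln a)) (\<phi> (- ln b)) \<le> 1 * dist (- ln a) (- ln b)"
    by (rule lipschitz_onD[OF \<phi>]) (use a b pos in auto)
  also have "\<dots> \<le> exp R * \<bar>a - b\<bar>"
    using ln[OF b(1) pos] ln[OF a(1) pos(2,1)] unfolding dist_real_def abs_minus_commute[of b a]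
    by (simp add: abs_le_iff)
  also have "\<dots> \<le> exp R * dist u v" using ab by (simp add: dist_real_def)
  finally show "dist (\<phi> (- ln (max u (exp (- R))))) (\<phi> (- ln (max v (exp (- R))))) \<le> exp R * dist u v"
    by (simp add: a_def b_def)
qed simp

text \<open>A Bernstein polynomial in \<open>exp (- y)\<close> is a combination of \<open>exp (- i y)\<close> with \<open>i \<le> n\<close>, whose
integrals are values of the Laplace transform.\<close>
lemma Bernstein_exp_expand:
  "Bernstein n k (exp (- y)) = (\<Sum>j\<le>n - k. real (n choose k) * real ((n - k) choose j) * (- 1) ^ j * exp (- real (k + j) * y))"
proof -
  have "(1 - exp (- y)) ^ (n - k) = (\<Sum>j\<le>n - k. real ((n - k) choose j) * (- exp (- y)) ^ j)"
    using binomial_ring[of "- exp (- y)" 1 "n - k"] by simp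
  also have "\<dots> = (\<Sum>j\<le>n - k. real ((n - k) choose j) * ((- 1) ^ j * exp (- real j * y)))"
    by (intro sum.cong refl) (simp add: power_minus[of "exp (- y)"] exp_of_nat_mult[symmetric])
  finally show ?thesis
    unfolding Bernstein_def
    by (simp add: exp_of_nat_mult[symmetric] sum_distrib_left mult.assoc exp_add[symmetric] algebra_simps)
qed

text \<open>Two laws on the half-line with finite means, compared through their integrals. In the application
one is empirical and the other is the law of the solution.\<close>
locale half_line_pair = M: prob_space \<mu> + N: prob_space \<nu>
  for \<mu> \<nu> :: "real measure" +
  assumes sets_\<mu> [simp, measurable_cong]: "sets \<mu> = sets half_line" and sets_\<nu> [simp, measurable_cong]: "sets \<nu> = sets half_line"
    and mean_\<mu>: "integrable \<mu> (\<lambda>y. y)" and mean_\<nu>: "integrable \<nu> (\<lambda>y. y)"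
begin

definition gap :: "(real \<Rightarrow> real) \<Rightarrow> real" where
  "gap f = (\<integral>y. f y \<partial>\<mu>) - (\<integral>y. f y \<partial>\<nu>)"

lemma spaces [simp]: "space \<mu> = {0..}" "space \<nu> = {0..}"
  using sets_eq_imp_space_eq[OF sets_\<mu>] sets_eq_imp_space_eq[OF sets_\<nu>] by simp_all

lemma int_exp: "0 \<le> l \<Longrightarrow> integrable \<mu> (\<lambda>y. exp (- l * y))" "0 \<le> l \<Longrightarrow> integrable \<nu> (\<lambda>y. exp (- l * y))"
  by (rule integrable_exp_on_half_line[OF M.prob_space_axioms sets_\<mu>], assumption)
     (rule integrable_exp_on_half_line[OF N.prob_space_axioms sets_\<nu>])

lemma gap_Bernstein:
  "\<bar>gap (\<lambda>y. Bernstein n k (exp (- y)))\<bar> \<le> 4 ^ n * (\<Sum>i\<le>n. \<bar>laplace \<mu> (real i) - laplace \<nu> (real i)\<bar>)"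
  if "k \<le> n"
  and "integrable \<mu> (\<lambda>y. Bernstein n k (exp (- y)))" "integrable \<nu> (\<lambda>y. Bernstein n k (exp (- y)))"
proof -
  let ?c = "\<lambda>j. real (n choose k) * real ((n - k) choose j) * (- 1) ^ j"
  let ?d = "\<lambda>i. \<bar>laplace \<mu> (real i) - laplace \<nu> (real i)\<bar>"
  have eq: "gap (\<lambda>y. Bernstein n k (exp (- y))) = (\<Sum>j\<le>n - k. ?c j * (laplace \<mu> (real (k + j)) - laplace \<nu> (real (k + j))))"
  proof -
    have "integrable \<mu> (\<lambda>y. ?c j * exp (- real (k + j) * y))" "integrable \<nu> (\<lambda>y. ?c j * exp (- real (k + j) * y))" for j
      by (intro integrable_mult_right int_exp of_nat_0_le_iff)+
    note i = this
    have "(\<integral>y. Bernstein n k (exp (- y)) \<partial>\<mu>) = (\<Sum>j\<le>n - k. ?c j * laplace \<mu> (real (k + j)))"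
      unfolding Bernstein_exp_expand laplace_def
      by (subst Bochner_Integration.integral_sum[OF i(1)]) (intro sum.cong refl integral_mult_right_zero)
    moreover have "(\<integral>y. Bernstein n k (exp (- y)) \<partial>\<nu>) = (\<Sum>j\<le>n - k. ?c j * laplace \<nu> (real (k + j)))"
      unfolding Bernstein_exp_expand laplace_def
      by (subst Bochner_Integration.integral_sum[OF i(2)]) (intro sum.cong refl integral_mult_right_zero)
    ultimately show ?thesis
      unfolding gap_def by (simp only: sum_subtractf[symmetric] right_diff_distrib)
  qed
  have "\<bar>gap (\<lambda>y. Bernstein n k (exp (- y)))\<bar> \<le> (\<Sum>j\<le>n - k. \<bar>?c j * (laplace \<mu> (real (k + j)) - laplace \<nu> (real (k + j)))\<bar>)"
    unfolding eq by (rule sum_abs)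
  also have "\<dots> \<le> (\<Sum>j\<le>n - k. 4 ^ n * ?d (k + j))"
  proof (rule sum_mono)
    fix j
    have "(n choose k) * ((n - k) choose j) \<le> 2 ^ n * 2 ^ (n - k)"
      by (intro mult_mono binomial_le_pow2) auto
    also have "\<dots> \<le> 2 ^ n * 2 ^ n" by (intro mult_mono power_increasing) auto
    also have "\<dots> = (4::nat) ^ n" by (simp add: power_mult_distrib[symmetric])
    finally have "real ((n choose k) * ((n - k) choose j)) \<le> real (4 ^ n)" by (rule of_nat_mono)
    then have "\<bar>?c j\<bar> \<le> 4 ^ n" by (simp add: abs_mult)
    then show "\<bar>?c j * (laplace \<mu> (real (k + j)) - laplace \<nu> (real (k + j)))\<bar> \<le> 4 ^ n * ?d (k + j)"
      unfolding abs_mult[of "?c j"] by (rule mult_right_mono) simp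
  qed
  also have "\<dots> = 4 ^ n * (\<Sum>i\<in>(\<lambda>j. k + j) ` {..n - k}. ?d i)"
    by (subst sum.reindex) (auto simp: sum_distrib_left)
  also have "\<dots> \<le> 4 ^ n * (\<Sum>i\<le>n. ?d i)"
    using that(1) by (intro mult_left_mono sum_mono2) auto
  finally show ?thesis .
qed

end

lemma integrable_lipschitz_half_line:
  fixes f :: "real \<Rightarrow> real"
  assumes \<nu>: "prob_space \<nu>" "sets \<nu> = sets half_line" and mean: "integrable \<nu> (\<lambda>y. y)"
    and f: "L-lipschitz_on {0..} f"
  shows "integrable \<nu> f"
proof (rule Bochner_Integration.integrable_bound)
  interpret prob_space \<nu> by fact
  have sp: "space \<nu> = {0..}" using sets_eq_imp_space_eq[OF \<nu>(2)] by simp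
  show "integrable \<nu> (\<lambda>y. \<bar>f 0\<bar> + L * y)" using mean by simp
  show "f \<in> borel_measurable \<nu>"
    unfolding measurable_cong_sets[OF \<nu>(2) refl] by (rule measurable_lipschitz_half_line[OF f])
  show "AE y in \<nu>. norm (f y) \<le> norm (\<bar>f 0\<bar> + L * y)"
  proof (rule AE_I2)
    fix y assume "y \<in> space \<nu>"
    then show "norm (f y) \<le> norm (\<bar>f 0\<bar> + L * y)"
      using lipschitz_onD[OF f, of y 0] by (auto simp: sp dist_real_def)
  qed
qed

context half_line_pair
begin

lemmas integrable_lipschitz =
  integrable_lipschitz_half_line[OF M.prob_space_axioms sets_\<mu> mean_\<mu>]
  integrable_lipschitz_half_line[OF N.prob_space_axioms sets_\<nu> mean_\<nu>]

lemma gap_diff: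
  "integrable \<mu> f \<Longrightarrow> integrable \<nu> f \<Longrightarrow> integrable \<mu> g \<Longrightarrow> integrable \<nu> g \<Longrightarrow>
    gap (\<lambda>y. f y - g y) = gap f - gap g"
  by (simp add: gap_def)

lemma gap_bound:
  assumes f: "integrable \<mu> f" "integrable \<nu> f" and b: "\<And>y. 0 \<le> y \<Longrightarrow> \<bar>f y\<bar> \<le> c"
  shows "\<bar>gap f\<bar> \<le> 2 * c"
proof -
  have "\<bar>\<integral>y. f y \<partial>\<kappa>\<bar> \<le> c" if \<kappa>: "prob_space \<kappa>" "space \<kappa> = {0..}" "integrable \<kappa> f" for \<kappa>
  proof -
    interpret \<kappa>: prob_space \<kappa> by (rule \<kappa>(1))
    have "\<bar>\<integral>y. f y \<partial>\<kappa>\<bar> \<le> (\<integral>y. \<bar>f y\<bar> \<partial>\<kappa>)" by (rule integral_abs_bound)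
    also have "\<dots> \<le> (\<integral>y. c \<partial>\<kappa>)" using \<kappa>(2,3) b by (intro integral_mono integrable_abs) auto
    finally show ?thesis by (simp add: \<kappa>.prob_space)
  qed
  from this[OF M.prob_space_axioms spaces(1) f(1)] this[OF N.prob_space_axioms spaces(2) f(2)]
  show ?thesis unfolding gap_def by linarith
qed

lemma integrable_Bernstein:
  "integrable \<mu> (\<lambda>y. Bernstein n k (exp (- y)))" "integrable \<nu> (\<lambda>y. Bernstein n k (exp (- y)))"
  unfolding Bernstein_exp_expand
  by (intro Bochner_Integration.integrable_sum integrable_mult_right int_exp of_nat_0_le_iff)+

abbreviation laplace_gaps :: "nat \<Rightarrow> real" where
  "laplace_gaps n \<equiv> \<Sum>i\<le>n. \<bar>laplace \<mu> (real i) - laplace \<nu> (real i)\<bar>"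

lemma lipschitz_cutoff:
  fixes \<phi> :: "real \<Rightarrow> real"
  assumes \<phi>: "1-lipschitz_on {0..} \<phi>" and R: "0 \<le> R"
  shows "1-lipschitz_on {0..} (\<lambda>y. \<phi> (min y R))"
proof (rule lipschitz_onI)
  fix a b :: real assume "a \<in> {0..}" "b \<in> {0..}"
  then have "dist (\<phi> (min a R)) (\<phi> (min b R)) \<le> 1 * dist (min a R) (min b R)"
    using R by (intro lipschitz_onD[OF \<phi>]) auto
  also have "dist (min a R) (min b R) \<le> dist a b"
    by (auto simp: dist_real_def min_def)
  finally show "dist (\<phi> (min a R)) (\<phi> (min b R)) \<le> 1 * dist a b" by simp
qed simp

text \<open>The first term is the error of the Bernstein approximation in the variable \<open>exp (- y)\<close>, paid under
both measures; in the second, \<open>R\<close> bounds the nodal values of a test function that vanishes at \<open>0\<close>.\<close>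
lemma gap_cutoff:
  assumes \<phi>: "1-lipschitz_on {0..} \<phi>" "\<phi> 0 = 0" and R: "0 \<le> R" and n: "0 < n"
  shows "\<bar>gap (\<lambda>y. \<phi> (min y R))\<bar> \<le> 2 * exp R / sqrt (real n) + R * (real (Suc n) * (4 ^ n * laplace_gaps n))"
proof -
  define \<psi> where "\<psi> u = \<phi> (- ln (max u (exp (- R))))" for u
  have lip: "(exp R)-lipschitz_on {0..1} \<psi>"
    unfolding \<psi>_def by (rule lipschitz_log_transform[OF \<phi>(1) R])
  have \<psi>e: "\<psi> (exp (- y)) = \<phi> (min y R)" for y
  proof -
    have "max (exp (- y)) (exp (- R)) = exp (- min y R)" by (auto simp: max_def min_def)
    then show ?thesis by (simp add: \<psi>_def)
  qed
  have \<psi>R: "\<bar>\<psi> u\<bar> \<le> R" if "u \<in> {0..1}" for u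
  proof -
    let ?m = "max u (exp (- R))"
    have m: "exp (- R) \<le> ?m" "?m \<le> 1" using that R by auto
    have pos: "0 < ?m" by (rule less_le_trans[OF exp_gt_zero m(1)])
    have "- ln ?m \<le> R" using m(1) pos by (metis ln_exp ln_le_cancel_iff exp_gt_zero minus_le_iff)
    moreover have "0 \<le> - ln ?m" using m(2) pos by simp
    ultimately show ?thesis
      using lipschitz_onD[OF \<phi>(1), of "- ln ?m" 0] \<phi>(2) by (simp add: \<psi>_def dist_real_def)
  qed
  let ?P = "\<lambda>y. \<Sum>k\<le>n. \<psi> (real k / real n) * Bernstein n k (exp (- y))"
  have P: "integrable \<mu> ?P" "integrable \<nu> ?P"
    by (intro Bochner_Integration.integrable_sum integrable_mult_right integrable_Bernstein)+
  have c: "integrable \<mu> (\<lambda>y. \<phi> (min y R))" "integrable \<nu> (\<lambda>y. \<phi> (min y R))"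
    by (rule integrable_lipschitz[OF lipschitz_cutoff[OF \<phi>(1) R]])+
  have 1: "\<bar>gap (\<lambda>y. \<phi> (min y R) - ?P y)\<bar> \<le> 2 * (exp R / sqrt (real n))"
  proof (rule gap_bound)
    fix y :: real assume "0 \<le> y"
    then show "\<bar>\<phi> (min y R) - ?P y\<bar> \<le> exp R / sqrt (real n)"
      using Bernstein_lipschitz_approx[OF n _ _ lip, of "exp (- y)"] by (simp add: \<psi>e)
  qed (use P c in auto)
  have 2: "\<bar>gap ?P\<bar> \<le> R * (real (Suc n) * (4 ^ n * laplace_gaps n))"
  proof -
    have eq: "gap ?P = (\<Sum>k\<le>n. \<psi> (real k / real n) * gap (\<lambda>y. Bernstein n k (exp (- y))))"
    proof -
      have "(\<integral>y. ?P y \<partial>\<mu>) = (\<Sum>k\<le>n. \<psi> (real k / real n) * (\<integral>y. Bernstein n k (exp (- y)) \<partial>\<mu>))"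
        by (subst Bochner_Integration.integral_sum[OF integrable_mult_right[OF integrable_Bernstein(1)]])
           (intro sum.cong refl integral_mult_right_zero)
      moreover have "(\<integral>y. ?P y \<partial>\<nu>) = (\<Sum>k\<le>n. \<psi> (real k / real n) * (\<integral>y. Bernstein n k (exp (- y)) \<partial>\<nu>))"
        by (subst Bochner_Integration.integral_sum[OF integrable_mult_right[OF integrable_Bernstein(2)]])
           (intro sum.cong refl integral_mult_right_zero)
      ultimately show ?thesis
        unfolding gap_def by (simp only: sum_subtractf[symmetric] right_diff_distrib)
    qed
    have "\<bar>gap ?P\<bar> \<le> (\<Sum>k\<le>n. \<bar>\<psi> (real k / real n) * gap (\<lambda>y. Bernstein n k (exp (- y)))\<bar>)"
      unfolding eq by (rule sum_abs)
    also have "\<dots> \<le> (\<Sum>k\<le>n. R * (4 ^ n * laplace_gaps n))"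
      unfolding abs_mult
      by (intro sum_mono mult_mono \<psi>R gap_Bernstein integrable_Bernstein) (use n R in auto)
    finally show ?thesis by (simp add: mult.left_commute)
  qed
  have "gap (\<lambda>y. \<phi> (min y R)) = gap (\<lambda>y. \<phi> (min y R) - ?P y) + gap ?P"
    using gap_diff[OF c P] by simp
  then show ?thesis using 1 2 by linarith
qed

text \<open>A test function differs from its cut-off at \<open>R\<close> by at most \<open>y - min y R\<close>. The integral of this tail
under \<open>\<mu>\<close> is that under \<open>\<nu>\<close> up to the difference of the means and the difference for the cut-off
test function \<open>min y R\<close>, so only the tail of \<open>\<nu>\<close> remains.\<close>
lemma wasserstein1_le:
  assumes R: "0 \<le> R" and n: "0 < n"
  shows "wasserstein1 \<mu> \<nu> \<le> ennreal (4 * exp R / sqrt (real n) + 2 * R * real (Suc n) * 4 ^ n * laplace_gaps n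
      + \<bar>gap (\<lambda>y. y)\<bar> + 2 * (\<integral>y. y - min y R \<partial>\<nu>))"
  unfolding wasserstein1_def
proof (rule SUP_least)
  fix \<phi> :: "real \<Rightarrow> real" assume "\<phi> \<in> {\<phi>. 1-lipschitz_on {0..} \<phi> \<and> integrable \<mu> \<phi> \<and> integrable \<nu> \<phi>}"
  then have \<phi>: "1-lipschitz_on {0..} \<phi>" "integrable \<mu> \<phi>" "integrable \<nu> \<phi>" by auto
  define A where "A = 2 * exp R / sqrt (real n) + R * (real (Suc n) * (4 ^ n * laplace_gaps n))"
  define f where "f y = \<phi> y - \<phi> 0" for y
  have f: "1-lipschitz_on {0..} f" "f 0 = 0"
    using \<phi>(1) by (auto simp: f_def lipschitz_on_def dist_real_def)
  have fi: "integrable \<mu> f" "integrable \<nu> f" by (rule integrable_lipschitz[OF f(1)])+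
  have idl: "1-lipschitz_on {0..} (\<lambda>y::real. y)" by (auto simp: lipschitz_on_def)
  have c: "integrable \<mu> (\<lambda>y. f (min y R))" "integrable \<nu> (\<lambda>y. f (min y R))"
    by (rule integrable_lipschitz[OF lipschitz_cutoff[OF f(1) R]])+
  have m: "integrable \<mu> (\<lambda>y. min y R)" "integrable \<nu> (\<lambda>y. min y R)"
    by (rule integrable_lipschitz[OF lipschitz_cutoff[OF idl R]])+
  have tail: "\<bar>f y - f (min y R)\<bar> \<le> y - min y R" if "0 \<le> y" for y
    using lipschitz_onD[OF f(1), of y "min y R"] that R by (auto simp: dist_real_def min_def)
  have t: "\<bar>\<integral>y. f y - f (min y R) \<partial>\<kappa>\<bar> \<le> (\<integral>y. y - min y R \<partial>\<kappa>)"
    if \<kappa>: "space \<kappa> = {0..}" "integrable \<kappa> f" "integrable \<kappa> (\<lambda>y. f (min y R))"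
      "integrable \<kappa> (\<lambda>y. y)" "integrable \<kappa> (\<lambda>y. min y R)" for \<kappa>
  proof -
    have "\<bar>\<integral>y. f y - f (min y R) \<partial>\<kappa>\<bar> \<le> (\<integral>y. \<bar>f y - f (min y R)\<bar> \<partial>\<kappa>)" by (rule integral_abs_bound)
    also have "\<dots> \<le> (\<integral>y. y - min y R \<partial>\<kappa>)"
      using \<kappa> tail by (intro integral_mono integrable_abs Bochner_Integration.integrable_diff) auto
    finally show ?thesis .
  qed
  note t1 = t[OF spaces(1) fi(1) c(1) mean_\<mu> m(1)] and t2 = t[OF spaces(2) fi(2) c(2) mean_\<nu> m(2)]
  have d: "(\<integral>y. y - min y R \<partial>\<mu>) = (\<integral>y. y - min y R \<partial>\<nu>) + gap (\<lambda>y. y) - gap (\<lambda>y. min y R)"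
    using mean_\<mu> mean_\<nu> m by (simp add: gap_def)
  have g1: "\<bar>gap (\<lambda>y. f (min y R))\<bar> \<le> A" unfolding A_def by (rule gap_cutoff[OF f R n])
  have g2: "\<bar>gap (\<lambda>y. min y R)\<bar> \<le> A" unfolding A_def using gap_cutoff[OF idl _ R n] by simp
  have "gap f = gap (\<lambda>y. f (min y R)) + ((\<integral>y. f y - f (min y R) \<partial>\<mu>) - (\<integral>y. f y - f (min y R) \<partial>\<nu>))"
    using fi c by (simp add: gap_def)
  then have "gap f \<le> 2 * A + \<bar>gap (\<lambda>y. y)\<bar> + 2 * (\<integral>y. y - min y R \<partial>\<nu>)"
    using t1 t2 d g1 g2 by linarith
  moreover have "gap f = (\<integral>x. \<phi> x \<partial>\<mu>) - (\<integral>x. \<phi> x \<partial>\<nu>)"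
    using \<phi> M.prob_space N.prob_space by (simp add: gap_def f_def)
  ultimately show "ennreal ((\<integral>x. \<phi> x \<partial>\<mu>) - (\<integral>x. \<phi> x \<partial>\<nu>))
    \<le> ennreal (4 * exp R / sqrt (real n) + 2 * R * real (Suc n) * 4 ^ n * laplace_gaps n
      + \<bar>gap (\<lambda>y. y)\<bar> + 2 * (\<integral>y. y - min y R \<partial>\<nu>))"
    by (intro ennreal_leI) (simp add: A_def algebra_simps)
qed

end

text \<open>The quotients \<open>(1 - exp (- l y)) / l\<close> tend to \<open>y\<close> as \<open>l \<rightarrow> 0\<close>, so Fatou's lemma applies.\<close>
lemma integrable_id_if_laplace_slope_bounded:
  assumes \<nu>: "prob_space \<nu>" "sets \<nu> = sets half_line"
    and b: "\<And>l. 0 < l \<Longrightarrow> 1 - laplace \<nu> l \<le> c * l"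
  shows "integrable \<nu> (\<lambda>y. y)" "(\<integral>y. y \<partial>\<nu>) \<le> c"
proof -
  interpret prob_space \<nu> by fact
  note [measurable_cong] = \<nu>(2)
  have sp: "space \<nu> = {0..}" using sets_eq_imp_space_eq[OF \<nu>(2)] by simp
  have c: "0 \<le> c" using b[of 1] laplace_bounds(2)[OF \<nu>, of 1] by simp
  let ?f = "\<lambda>k y::real. real (Suc k) * (1 - exp (- (1 / real (Suc k)) * y))"
  have lim: "(\<lambda>k. ?f k y) \<longlonglongrightarrow> y" for y
  proof -
    have z: "(\<lambda>k. - y / real (Suc k)) \<longlonglongrightarrow> 0"
      using tendsto_mult[OF tendsto_const[of "- y"] LIMSEQ_inverse_real_of_nat] by (simp add: divide_inverse)
    have "(\<lambda>k. (exp (- y / real (Suc k)) - 1) / (- y / real (Suc k))) \<longlonglongrightarrow> 1" if "y \<noteq> 0"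
      by (rule filterlim_compose[OF lim_exp_minus_1]) (use z that in \<open>simp add: filterlim_at\<close>)
    from tendsto_mult[OF tendsto_const[of y] this]
    have "(\<lambda>k. y * ((exp (- y / real (Suc k)) - 1) / (- y / real (Suc k)))) \<longlonglongrightarrow> y" if "y \<noteq> 0"
      using that by simp
    moreover have "y * ((exp (- y / real (Suc k)) - 1) / (- y / real (Suc k))) = ?f k y" if "y \<noteq> 0" for k
      using that by (simp add: divide_simps) (simp add: algebra_simps)
    ultimately show ?thesis by (cases "y = 0") simp_all
  qed
  have "(\<integral>\<^sup>+y. ennreal y \<partial>\<nu>) = (\<integral>\<^sup>+y. liminf (\<lambda>k. ennreal (?f k y)) \<partial>\<nu>)"
    using lim_imp_Liminf[OF _ tendsto_ennrealI[OF lim]] by (intro nn_integral_cong) simp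
  also have "\<dots> \<le> liminf (\<lambda>k. \<integral>\<^sup>+y. ennreal (?f k y) \<partial>\<nu>)"
    by (rule nn_integral_liminf) measurable
  also have "\<dots> \<le> ennreal c"
  proof (rule Liminf_le)
    show "\<forall>\<^sub>F k in sequentially. (\<integral>\<^sup>+y. ennreal (?f k y) \<partial>\<nu>) \<le> ennreal c"
    proof (rule always_eventually, rule allI)
      fix k
      let ?l = "1 / real (Suc k)"
      have i: "integrable \<nu> (\<lambda>y. exp (- ?l * y))" by (rule integrable_exp_on_half_line[OF \<nu>]) simp
      have "(\<integral>\<^sup>+y. ennreal (?f k y) \<partial>\<nu>) = ennreal (\<integral>y. ?f k y \<partial>\<nu>)"
        using i by (intro nn_integral_eq_integral) (auto simp: sp)
      also have "(\<integral>y. ?f k y \<partial>\<nu>) = real (Suc k) * (1 - laplace \<nu> ?l)"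
        using i by (simp add: laplace_def prob_space del: of_nat_Suc)
      also have "\<dots> \<le> real (Suc k) * (c * ?l)" by (intro mult_left_mono b) auto
      also have "\<dots> = c" by simp
      finally show "(\<integral>\<^sup>+y. ennreal (?f k y) \<partial>\<nu>) \<le> ennreal c" by (simp add: ennreal_leI)
    qed
  qed simp
  finally have le: "(\<integral>\<^sup>+y. ennreal y \<partial>\<nu>) \<le> ennreal c" .
  show int: "integrable \<nu> (\<lambda>y. y)"
  proof (rule integrableI_bounded)
    have "(\<integral>\<^sup>+y. ennreal (norm y) \<partial>\<nu>) = (\<integral>\<^sup>+y. ennreal y \<partial>\<nu>)" by (intro nn_integral_cong) (simp add: sp)
    then show "(\<integral>\<^sup>+y. ennreal (norm y) \<partial>\<nu>) < \<infinity>" using le by (simp add: order_le_less_trans)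
  qed measurable
  have "AE y in \<nu>. 0 \<le> y" by (rule AE_I2) (simp add: sp)
  from nn_integral_eq_integral[OF int this] le
  have "ennreal (\<integral>y. y \<partial>\<nu>) \<le> ennreal c" by simp
  then show "(\<integral>y. y \<partial>\<nu>) \<le> c" using c by (simp add: ennreal_le_iff)
qed

lemma laplace_slope_le_mean:
  assumes \<nu>: "prob_space \<nu>" "sets \<nu> = sets half_line" and int: "integrable \<nu> (\<lambda>y. y)" and l: "0 \<le> l"
  shows "1 - laplace \<nu> l \<le> (\<integral>y. y \<partial>\<nu>) * l"
proof -
  interpret prob_space \<nu> by fact
  have i: "integrable \<nu> (\<lambda>y. exp (- l * y))" by (rule integrable_exp_on_half_line[OF \<nu> l])
  have "1 - laplace \<nu> l = (\<integral>y. 1 - exp (- l * y) \<partial>\<nu>)"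
    using i by (simp add: laplace_def prob_space)
  also have "\<dots> \<le> (\<integral>y. l * y \<partial>\<nu>)"
  proof (intro integral_mono)
    show "1 - exp (- l * y) \<le> l * y" for y using exp_ge_add_one_self[of "- l * y"] by simp
  qed (use i int in auto)
  finally show ?thesis by (simp add: mult.commute)
qed

section \<open>Convergence of the particle system\<close>

context repeated_averaging
begin

abbreviation expected_distance :: "(real \<Rightarrow> real \<Rightarrow> real) \<Rightarrow> real \<Rightarrow> ennreal" where
  "expected_distance \<rho> s \<equiv>
    \<integral>\<^sup>+\<omega>. wasserstein1 (empirical_measure N (X s \<omega>)) (density_measure (\<rho> s)) \<partial>M"

text \<open>At each realization of the initial state the transforms at \<open>l\<close> differ by at most \<open>l W\<^sub>1\<close>, which
starts the Gronwall bound. The discretization error vanishes as the number of cells grows with \<open>N\<close>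
fixed.\<close>
lemma expectation_laplace_error_le:
  assumes sol: "averaging_solution \<rho>" and N: "2 \<le> N" and t: "0 < t" and l: "0 < l"
    and w: "0 \<le> w" "expected_distance \<rho> 0 \<le> ennreal w"
  shows "expectation (\<lambda>\<omega>. laplace_error N \<rho> l t (X t \<omega>)) \<le> exp (2 * t) * (l * w + 2 * t / real N)"
proof -
  let ?W = "\<lambda>\<omega>. wasserstein1 (empirical_measure N (X 0 \<omega>)) (density_measure (\<rho> 0))"
  let ?F = "laplace_error N \<rho> l t"
  let ?M = "real (card (pairs N))"
  let ?m = "?M / real N"
  let ?B = "exp (2 * t) * (9 + 2 * ?m) * t\<^sup>2 + (?m * t)\<^sup>2"
  have N0: "0 < N" using N by simp
  have ne: "pairs N \<noteq> {}" by (rule pairs_nonempty[OF N])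
  have l0: "0 \<le> l" and t0: "0 \<le> t" using l t by simp_all
  have Fm: "?F \<in> borel_measurable (states N)"
    unfolding laplace_error_def[abs_def] laplace_emp_def sample_mean_def by measurable
  have Fc: "?F x = ?F y" if "\<forall>i<N. x i = y i" for x y
    using that by (simp add: laplace_error_def laplace_emp_def sample_mean_def)
  have Fb: "0 \<le> ?F x \<and> ?F x \<le> 1" if "\<forall>i<N. 0 \<le> x i" for x
    using laplace_error_bounds[OF sol l0 N0 t0 that] by simp
  have main: "expectation (\<lambda>\<omega>. ?F (X t \<omega>)) \<le> exp (2 * t) * (l * w + 2 * t / real N) + ?B / real n" if n: "0 < n" for n
  proof -
    define h where "h = t / real n"
    have h: "0 < h" "real n * h = t" using t n by (simp_all add: h_def)
    let ?r = "ring_prob h"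
    let ?a = "?M * (h / real N)"
    let ?E = "2 * h / real N + (9 + 2 * ?m) * h\<^sup>2"
    have a0: "0 \<le> ?a" using h by simp
    have r: "0 \<le> ?r" "?r * real N \<le> h" "h - ?r * real N \<le> h\<^sup>2 * ?m" "?r * ?M \<le> 1"
    proof -
      show "0 \<le> ?r" using h by (simp add: ring_prob_def)
      have rN: "?r * real N = h * exp (- ?a)" using N0 by (simp add: ring_prob_def)
      show "?r * real N \<le> h" unfolding rN using h a0 by (simp add: mult_left_le)
      have "h - h * exp (- ?a) = h * (1 - exp (- ?a))" by (simp add: algebra_simps)
      also have "\<dots> \<le> h * ?a" using exp_ge_add_one_self[of "- ?a"] h by (intro mult_left_mono) auto
      finally show "h - ?r * real N \<le> h\<^sup>2 * ?m" unfolding rN by (simp add: power2_eq_square algebra_simps)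
      have "?r * ?M = ?a * exp (- ?a)" by (simp add: ring_prob_def)
      also have "\<dots> \<le> exp ?a * exp (- ?a)"
        using exp_ge_add_one_self[of ?a] by (intro mult_right_mono) (linarith, simp)
      also have "\<dots> = 1" by (simp add: exp_minus)
      finally show "?r * ?M \<le> 1" .
    qed
    let ?g = "\<lambda>\<omega>. (chain_step N ?r ^^ n) ?F (X 0 \<omega>)"
    note ce = chain_expectation[OF h(1) ne Fm Fc Fb, of n]
    have gint: "integrable M ?g" by (rule ce(2))
    have pow: "(1 + 2 * h) ^ n \<le> exp (2 * t)"
    proof -
      have "(1 + 2 * h) ^ n \<le> exp (2 * h) ^ n"
        using h exp_ge_add_one_self[of "2 * h"] by (intro power_mono) auto
      also have "\<dots> = exp (2 * t)" using h(2) by (simp add: exp_of_nat_mult[symmetric] algebra_simps)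
      finally show ?thesis .
    qed
    have bound: "?g \<omega> \<le> exp (2 * t) * (S + real n * ?E)"
      if \<omega>: "\<omega> \<in> space M" and S: "0 \<le> S" "\<And>k. 0 \<le> k \<Longrightarrow> k \<le> l \<Longrightarrow> laplace_error N \<rho> k 0 (X 0 \<omega>) \<le> S" for \<omega> S
    proof -
      have x: "\<forall>i<N. 0 \<le> X 0 \<omega> i" using nonneg_X[of 0 _ \<omega>] \<omega> by simp
      have "?g \<omega> \<le> (1 + 2 * h) ^ n * (S + real n * ?E)"
        using funpow_chain_step_laplace_error[OF sol N0 _ r _ x S(2) l0 order_refl, of n] h by simp
      also have "\<dots> \<le> exp (2 * t) * (S + real n * ?E)"
        using pow S h by (intro mult_right_mono) auto
      finally show ?thesis .
    qed
    let ?c = "exp (2 * t) * (real n * ?E)"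
    \<comment> \<open>The distance itself is only bounded from below, by this measurable function of the initial state;
      integrating the lower bound gives the estimate of the expectation.\<close>
    let ?k = "\<lambda>\<omega>. (?g \<omega> - ?c) / (exp (2 * t) * l)"
    have kW: "ennreal (?k \<omega>) \<le> ?W \<omega>" if \<omega>: "\<omega> \<in> space M" for \<omega>
    proof (cases "?W \<omega>")
      case (real v)
      have x: "\<forall>i<N. 0 \<le> X 0 \<omega> i" using nonneg_X[of 0 _ \<omega>] \<omega> by simp
      have "laplace_error N \<rho> k 0 (X 0 \<omega>) \<le> l * v" if k: "0 \<le> k" "k \<le> l" for k
      proof (cases "k = 0")
        case True
        have "laplace_emp N 0 (X 0 \<omega>) = 1" using N0 by (simp add: laplace_emp_def sample_mean_def)
        moreover have "laplace_sol \<rho> 0 0 = 1"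
          using prob_space.prob_space[OF prob_space_density_measure[OF solution_density[OF sol order_refl]]]
          by (simp add: laplace_def)
        ultimately show ?thesis using True l real(1) by (simp add: laplace_error_def)
      next
        case False
        let ?d = "laplace_emp N k (X 0 \<omega>) - laplace_sol \<rho> 0 k"
        have k0: "0 < k" using k False by simp
        have "ennreal (\<bar>?d\<bar> / k) \<le> ?W \<omega>"
          using laplace_diff_le_wasserstein1[OF empirical_measure_facts(1)[OF N0 x] _
              prob_space_density_measure[OF solution_density[OF sol order_refl]] _ k0]
            laplace_empirical_measure[OF N0 x] by simp
        then have d: "\<bar>?d\<bar> \<le> k * v" using real k0 by (simp add: divide_le_eq mult.commute)
        have "\<bar>?d\<bar> \<le> 1"
          using laplace_emp_bounds[OF k(1) N0 x] solution_laplace_bounds[OF sol k(1) order_refl] by linarith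
        then have "\<bar>?d\<bar> * \<bar>?d\<bar> \<le> \<bar>?d\<bar> * 1" by (intro mult_left_mono) auto
        then have "laplace_error N \<rho> k 0 (X 0 \<omega>) \<le> \<bar>?d\<bar>" by (simp add: laplace_error_def power2_eq_square abs_mult_self_eq)
        also note d
        also have "k * v \<le> l * v" using k real(1) by (intro mult_right_mono) auto
        finally show ?thesis .
      qed
      then have "?g \<omega> \<le> exp (2 * t) * (l * v + real n * ?E)"
        using bound[OF \<omega>, of "l * v"] l real(1) by simp
      then have "?g \<omega> - ?c \<le> exp (2 * t) * l * v" by (simp add: algebra_simps)
      then have "?k \<omega> \<le> v" using l by (simp add: divide_le_eq mult.commute)
      then show ?thesis using real by (simp add: ennreal_leI)
    qed simp
    have kint: "integrable M ?k" using gint by simp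
    have "expectation ?k \<le> w"
    proof -
      have kp: "integrable M (\<lambda>\<omega>. max 0 (?k \<omega>))" using kint by simp
      have "ennreal (expectation (\<lambda>\<omega>. max 0 (?k \<omega>))) = (\<integral>\<^sup>+\<omega>. ennreal (max 0 (?k \<omega>)) \<partial>M)"
        by (rule nn_integral_eq_integral[OF kp, symmetric]) simp
      also have "\<dots> \<le> (\<integral>\<^sup>+\<omega>. ?W \<omega> \<partial>M)"
        by (intro nn_integral_mono) (use kW in \<open>simp add: max_def ennreal_neg\<close>)
      also have "\<dots> \<le> ennreal w" by (rule w(2))
      finally have "expectation (\<lambda>\<omega>. max 0 (?k \<omega>)) \<le> w" using w(1) by (simp add: ennreal_le_iff)
      moreover have "expectation ?k \<le> expectation (\<lambda>\<omega>. max 0 (?k \<omega>))"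
        by (rule integral_mono[OF kint kp]) simp
      ultimately show ?thesis by simp
    qed
    moreover have "expectation ?k = (expectation ?g - ?c) / (exp (2 * t) * l)"
      using gint by (simp add: prob_space)
    ultimately have g: "expectation ?g \<le> exp (2 * t) * (l * w) + ?c"
      using l by (simp add: divide_le_eq algebra_simps)
    have "expectation (\<lambda>\<omega>. ?F (X t \<omega>)) \<le> expectation ?g + real n * ?a\<^sup>2"
      using ce(1) unfolding h(2) .
    also have "\<dots> \<le> exp (2 * t) * (l * w) + ?c + real n * ?a\<^sup>2" using g by simp
    also have "?c = exp (2 * t) * (2 * t / real N) + exp (2 * t) * (9 + 2 * ?m) * t\<^sup>2 / real n"
    proof -
      have "real n * ?E = 2 * (real n * h) / real N + (9 + 2 * ?m) * ((real n * h) * h)"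
        by (simp add: power2_eq_square algebra_simps)
      also have "(real n * h) * h = t\<^sup>2 / real n" unfolding h(2) by (simp add: h_def power2_eq_square)
      finally have e: "real n * ?E = 2 * t / real N + (9 + 2 * ?m) * (t\<^sup>2 / real n)" unfolding h(2) .
      have "exp (2 * t) * (p + q * (t\<^sup>2 / real n)) = exp (2 * t) * p + exp (2 * t) * q * t\<^sup>2 / real n" for p q
        by (simp add: distrib_left)
      then show ?thesis unfolding e .
    qed
    also have "real n * ?a\<^sup>2 = (?m * t)\<^sup>2 / real n"
      using n by (simp add: h_def power2_eq_square mult_ac)
    finally show ?thesis by (simp add: algebra_simps add_divide_distrib)
  qed
  have "(\<lambda>n. exp (2 * t) * (l * w + 2 * t / real N) + ?B / real n) \<longlonglongrightarrow> exp (2 * t) * (l * w + 2 * t / real N) + 0"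
    by (intro tendsto_add tendsto_const lim_const_over_n)
  then have "expectation (\<lambda>\<omega>. ?F (X t \<omega>)) \<le> exp (2 * t) * (l * w + 2 * t / real N) + 0"
    by (rule LIMSEQ_le_const) (intro exI[of _ 1] allI impI main, simp)
  then show ?thesis by simp
qed

abbreviation laplace_gap :: "(real \<Rightarrow> real \<Rightarrow> real) \<Rightarrow> real \<Rightarrow> real \<Rightarrow> 'w \<Rightarrow> real" where
  "laplace_gap \<rho> t l \<omega> \<equiv> \<bar>laplace_emp N l (X t \<omega>) - laplace_sol \<rho> t l\<bar>"

lemma expectation_laplace_gap_le:
  assumes sol: "averaging_solution \<rho>" and N: "2 \<le> N" and t: "0 < t" and l: "0 < l"
    and w: "0 \<le> w" "expected_distance \<rho> 0 \<le> ennreal w"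
  shows "expectation (laplace_gap \<rho> t l)
      \<le> sqrt (exp (2 * t) * (l * w + 2 * t / real N))"
    and "integrable M (laplace_gap \<rho> t l)"
proof -
  let ?d = "\<lambda>\<omega>. \<bar>laplace_emp N l (X t \<omega>) - laplace_sol \<rho> t l\<bar>"
  have l0: "0 \<le> l" and t0: "0 \<le> t" and N0: "0 < N" using l t N by simp_all
  have dm: "?d \<in> borel_measurable M"
    unfolding laplace_emp_def sample_mean_def using measurable_X[OF t0] by measurable
  have d1: "?d \<omega> \<le> 1" if "\<omega> \<in> space M" for \<omega>
    using laplace_emp_bounds[OF l0 N0, of "X t \<omega>"] solution_laplace_bounds[OF sol l0 t0] nonneg_X[OF t0 _ that] by fastforce
  show i1: "integrable M ?d"
    by (rule integrable_const_bound[where B = 1]) (use d1 dm in auto)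
  have i2: "integrable M (\<lambda>\<omega>. (?d \<omega>)\<^sup>2)"
    by (rule integrable_const_bound[where B = 1]) (use d1 borel_measurable_power[OF dm, of 2] in \<open>auto simp: abs_square_le_1\<close>)
  have "(expectation ?d)\<^sup>2 \<le> expectation (\<lambda>\<omega>. (?d \<omega>)\<^sup>2)"
    using variance_positive[of ?d] unfolding variance_eq[OF i1 i2] by simp
  also have "\<dots> = expectation (\<lambda>\<omega>. laplace_error N \<rho> l t (X t \<omega>))"
    by (simp add: laplace_error_def)
  also have "\<dots> \<le> exp (2 * t) * (l * w + 2 * t / real N)"
    by (rule expectation_laplace_error_le[OF assms])
  finally show "expectation ?d \<le> sqrt (exp (2 * t) * (l * w + 2 * t / real N))"
    by (rule real_le_rsqrt)
qed

end

lemma half_line_pair_empirical: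
  assumes N: "0 < N" and x: "\<forall>i<N. 0 \<le> x i" and f: "probability_density f"
    and int: "integrable (density_measure f) (\<lambda>y. y)"
  shows "half_line_pair (empirical_measure N x) (density_measure f)"
proof -
  interpret E: prob_space "empirical_measure N x" by (rule empirical_measure_facts(1)[OF N x])
  interpret D: prob_space "density_measure f" by (rule prob_space_density_measure[OF f])
  show ?thesis
    by unfold_locales
       (rule sets_empirical_measure sets_density_measure int empirical_measure_facts(2)[OF N x measurable_id_half_line])+
qed

context repeated_averaging
begin

text \<open>Some realization of the initial empirical measure is at finite distance from \<open>\<rho>(0)\<close>; its mean
is finite, and the two Laplace transforms differ by at most \<open>l\<close> times the distance.\<close>
lemma mean_finite_if_wasserstein1_finite:
  assumes sol: "averaging_solution \<rho>" and N: "2 \<le> N"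
    and fin: "expected_distance \<rho> 0 < \<infinity>"
  shows "integrable (density_measure (\<rho> 0)) (\<lambda>y. y)"
proof -
  let ?W = "\<lambda>\<omega>. wasserstein1 (empirical_measure N (X 0 \<omega>)) (density_measure (\<rho> 0))"
  have "\<exists>\<omega>\<in>space M. ?W \<omega> < \<infinity>"
  proof (rule ccontr)
    assume "\<not> ?thesis"
    then have "(\<integral>\<^sup>+\<omega>. ?W \<omega> \<partial>M) = (\<integral>\<^sup>+\<omega>. \<infinity> \<partial>M)" by (intro nn_integral_cong) (auto simp: less_top[symmetric])
    then show False using fin by (simp add: emeasure_space_1)
  qed
  then obtain \<omega> where \<omega>: "\<omega> \<in> space M" "?W \<omega> < \<infinity>" by blast
  then obtain v where v: "?W \<omega> = ennreal v" "0 \<le> v" by (cases "?W \<omega>") auto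
  have N0: "0 < N" using N by simp
  have x: "\<forall>i<N. 0 \<le> X 0 \<omega> i" using nonneg_X[of 0 _ \<omega>] \<omega>(1) by simp
  note E = empirical_measure_facts(1)[OF N0 x] and D = prob_space_density_measure[OF solution_density[OF sol order_refl]]
  let ?m = "\<integral>y. y \<partial>empirical_measure N (X 0 \<omega>)"
  show ?thesis
  proof (rule integrable_id_if_laplace_slope_bounded(1)[OF D])
    fix l :: real assume l: "0 < l"
    let ?d = "\<bar>laplace (empirical_measure N (X 0 \<omega>)) l - laplace_sol \<rho> 0 l\<bar>"
    have "ennreal (?d / l) \<le> ennreal v"
      using laplace_diff_le_wasserstein1[OF E _ D _ l] v(1) by simp
    then have "?d \<le> v * l" using v(2) l by (simp add: ennreal_le_iff divide_le_eq)
    moreover have "1 - laplace (empirical_measure N (X 0 \<omega>)) l \<le> ?m * l"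
      by (rule laplace_slope_le_mean[OF E]) (use l empirical_measure_facts(2)[OF N0 x measurable_id_half_line] in simp_all)
    ultimately show "1 - laplace_sol \<rho> 0 l \<le> (?m + v) * l"
      by (simp add: algebra_simps)
  qed simp
qed

abbreviation mean_gap :: "(real \<Rightarrow> real \<Rightarrow> real) \<Rightarrow> 'w \<Rightarrow> real" where
  "mean_gap \<rho> \<omega> \<equiv> \<bar>sample_mean N (\<lambda>y. y) (X 0 \<omega>) - (\<integral>y. y \<partial>density_measure (\<rho> 0))\<bar>"

lemma expectation_mean_gap_le:
  assumes sol: "averaging_solution \<rho>" and N: "2 \<le> N"
    and int: "integrable (density_measure (\<rho> 0)) (\<lambda>y. y)"
    and w: "0 \<le> w" "expected_distance \<rho> 0 \<le> ennreal w"
  shows "expectation (mean_gap \<rho>) \<le> w"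
    and "integrable M (mean_gap \<rho>)"
proof -
  let ?W = "\<lambda>\<omega>. wasserstein1 (empirical_measure N (X 0 \<omega>)) (density_measure (\<rho> 0))"
  let ?d = "\<lambda>\<omega>. \<bar>sample_mean N (\<lambda>y. y) (X 0 \<omega>) - (\<integral>y. y \<partial>density_measure (\<rho> 0))\<bar>"
  have N0: "0 < N" using N by simp
  have m: "?d \<in> borel_measurable M"
    unfolding sample_mean_def using measurable_X[of 0] by measurable
  have idl: "1-lipschitz_on {0..} (\<lambda>y::real. y)" by (auto simp: lipschitz_on_def)
  have dW: "ennreal (?d \<omega>) \<le> ?W \<omega>" if "\<omega> \<in> space M" for \<omega>
  proof -
    have x: "\<forall>i<N. 0 \<le> X 0 \<omega> i" using nonneg_X[of 0 _ \<omega>] that by simp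
    from wasserstein1_ge[OF idl empirical_measure_facts(2)[OF N0 x measurable_id_half_line] int]
    show ?thesis unfolding empirical_measure_facts(3)[OF N0 x measurable_id_half_line] .
  qed
  have le: "(\<integral>\<^sup>+\<omega>. ennreal (?d \<omega>) \<partial>M) \<le> ennreal w"
    by (rule order_trans[OF nn_integral_mono w(2)]) (rule dW)
  show i: "integrable M ?d"
  proof (rule integrableI_bounded[OF m])
    show "(\<integral>\<^sup>+\<omega>. ennreal (norm (?d \<omega>)) \<partial>M) < \<infinity>" using le by (simp add: order_le_less_trans)
  qed
  have "ennreal (expectation ?d) \<le> ennreal w"
    using le nn_integral_eq_integral[OF i] by simp
  then show "expectation ?d \<le> w" using w(1) by (simp add: ennreal_le_iff)
qed

text \<open>The inequality \<open>1 - u(l) \<le> l (mean)\<close> holds for every empirical measure, and the empirical mean is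
conserved; what remains is the distance of the transforms at time \<open>t\<close> and of the means at time \<open>0\<close>.
Letting \<open>N \<rightarrow> \<infinity>\<close> bounds the mean of \<open>\<rho>(t)\<close> by that of \<open>\<rho>(0)\<close>.\<close>
lemma laplace_slope_later_le:
  assumes sol: "averaging_solution \<rho>" and N: "2 \<le> N" and t: "0 < t" and l: "0 < l"
    and int: "integrable (density_measure (\<rho> 0)) (\<lambda>y. y)"
    and w: "0 \<le> w" "expected_distance \<rho> 0 \<le> ennreal w"
  shows "1 - laplace_sol \<rho> t l
    \<le> ((\<integral>y. y \<partial>density_measure (\<rho> 0)) + w) * l + sqrt (exp (2 * t) * (l * w + 2 * t / real N))"
proof -
  let ?m = "\<integral>y. y \<partial>density_measure (\<rho> 0)"
  let ?d = "\<lambda>\<omega>. \<bar>sample_mean N (\<lambda>y. y) (X 0 \<omega>) - ?m\<bar>"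
  let ?e = "\<lambda>\<omega>. \<bar>laplace_emp N l (X t \<omega>) - laplace_sol \<rho> t l\<bar>"
  have N0: "0 < N" and t0: "0 \<le> t" using N t by simp_all
  have ne: "pairs N \<noteq> {}" by (rule pairs_nonempty[OF N])
  note d = expectation_mean_gap_le[OF sol N int w] and e = expectation_laplace_gap_le[OF sol N t l w]
  have "expectation (\<lambda>_. 1 - laplace_sol \<rho> t l) \<le> expectation (\<lambda>\<omega>. ?m * l + ?d \<omega> * l + ?e \<omega>)"
  proof (rule integral_mono_AE)
    show "AE \<omega> in M. 1 - laplace_sol \<rho> t l \<le> ?m * l + ?d \<omega> * l + ?e \<omega>"
      using mean_conserved[OF t ne] AE_space
    proof eventually_elim
      case (elim \<omega>)
      have x: "\<forall>i<N. 0 \<le> X t \<omega> i" using nonneg_X[OF t0 _ elim(2)] by simp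
      note E = empirical_measure_facts[OF N0 x]
      have "1 - laplace (empirical_measure N (X t \<omega>)) l \<le> (\<integral>y. y \<partial>empirical_measure N (X t \<omega>)) * l"
        by (rule laplace_slope_le_mean[OF E(1)]) (use l E(2)[OF measurable_id_half_line] in simp_all)
      then have "1 - laplace_emp N l (X t \<omega>) \<le> sample_mean N (\<lambda>y. y) (X 0 \<omega>) * l"
        using laplace_empirical_measure[OF N0 x] E(3)[OF measurable_id_half_line] elim(1) by simp
      also have "\<dots> \<le> (?m + ?d \<omega>) * l" using l by (intro mult_right_mono) auto
      finally show ?case by (simp add: algebra_simps)
    qed
  qed (use d e in auto)
  also have "\<dots> = ?m * l + expectation ?d * l + expectation ?e"
    using d(2) e(2) by (simp add: prob_space)
  also have "\<dots> \<le> ?m * l + w * l + sqrt (exp (2 * t) * (l * w + 2 * t / real N))"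
    using d(1) e(1) l by (intro add_mono mult_right_mono) auto
  finally show ?thesis by (simp add: prob_space algebra_simps)
qed

lemma expectation_wasserstein1_le:
  assumes sol: "averaging_solution \<rho>" and N: "2 \<le> N" and t: "0 < t"
    and int0: "integrable (density_measure (\<rho> 0)) (\<lambda>y. y)" and intt: "integrable (density_measure (\<rho> t)) (\<lambda>y. y)"
    and mean: "(\<integral>y. y \<partial>density_measure (\<rho> t)) = (\<integral>y. y \<partial>density_measure (\<rho> 0))"
    and w: "0 \<le> w" "expected_distance \<rho> 0 \<le> ennreal w"
    and R: "0 \<le> R" and n: "0 < n"
  shows "expected_distance \<rho> t
    \<le> ennreal (4 * exp R / sqrt (real n)
        + 2 * R * real (Suc n) * 4 ^ n * (\<Sum>i\<le>n. sqrt (exp (2 * t) * (real i * w + 2 * t / real N)))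
        + w + 2 * (\<integral>y. y - min y R \<partial>density_measure (\<rho> t)))"
proof -
  let ?s = "\<lambda>i. sqrt (exp (2 * t) * (real i * w + 2 * t / real N))"
  let ?m = "\<integral>y. y \<partial>density_measure (\<rho> 0)"
  let ?d = "\<lambda>\<omega>. \<bar>sample_mean N (\<lambda>y. y) (X 0 \<omega>) - ?m\<bar>"
  let ?e = "\<lambda>i \<omega>. \<bar>laplace_emp N (real i) (X t \<omega>) - laplace_sol \<rho> t (real i)\<bar>"
  let ?c = "4 * exp R / sqrt (real n)" and ?Q = "2 * R * real (Suc n) * 4 ^ n"
    and ?\<tau> = "\<integral>y. y - min y R \<partial>density_measure (\<rho> t)"
  have N0: "0 < N" and t0: "0 \<le> t" using N t by simp_all
  have ne: "pairs N \<noteq> {}" by (rule pairs_nonempty[OF N])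
  note dens = solution_density[OF sol t0]
  note d = expectation_mean_gap_le[OF sol N int0 w]
  have e: "expectation (?e i) \<le> ?s i" "integrable M (?e i)" for i
  proof -
    have "expectation (?e i) \<le> ?s i \<and> integrable M (?e i)"
    proof (cases "i = 0")
      case True
      have "laplace_emp N 0 x = 1" for x using N0 by (simp add: laplace_emp_def sample_mean_def)
      moreover have "laplace_sol \<rho> t 0 = 1"
        using prob_space.prob_space[OF prob_space_density_measure[OF dens]] by (simp add: laplace_def)
      ultimately show ?thesis using True t by simp
    next
      case False
      then show ?thesis using expectation_laplace_gap_le[OF sol N t _ w, of "real i"] by simp
    qed
    then show "expectation (?e i) \<le> ?s i" "integrable M (?e i)" by auto
  qed
  let ?b = "\<lambda>\<omega>. ?c + ?Q * (\<Sum>i\<le>n. ?e i \<omega>) + ?d \<omega> + 2 * ?\<tau>"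
  have tau: "0 \<le> ?\<tau>" by (rule integral_nonneg_AE) (simp add: min_def)
  have bint: "integrable M ?b"
    using d(2) e(2) by (intro Bochner_Integration.integrable_add integrable_mult_right Bochner_Integration.integrable_sum) auto
  have b0: "0 \<le> ?b \<omega>" for \<omega>
    using R tau by (intro add_nonneg_nonneg mult_nonneg_nonneg sum_nonneg) auto
  have "expected_distance \<rho> t \<le> (\<integral>\<^sup>+\<omega>. ennreal (?b \<omega>) \<partial>M)"
  proof (rule nn_integral_mono_AE)
    show "AE \<omega> in M. wasserstein1 (empirical_measure N (X t \<omega>)) (density_measure (\<rho> t)) \<le> ennreal (?b \<omega>)"
      using mean_conserved[OF t ne] AE_space
    proof eventually_elim
      case (elim \<omega>)
      have x: "\<forall>i<N. 0 \<le> X t \<omega> i" using nonneg_X[OF t0 _ elim(2)] by simp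
      interpret half_line_pair "empirical_measure N (X t \<omega>)" "density_measure (\<rho> t)"
        by (rule half_line_pair_empirical[OF N0 x dens intt])
      have "gap (\<lambda>y. y) = sample_mean N (\<lambda>y. y) (X 0 \<omega>) - ?m"
        using empirical_measure_facts(3)[OF N0 x measurable_id_half_line] mean elim(1) by (simp add: gap_def)
      then show ?case
        using wasserstein1_le[OF R n] by (simp only: laplace_empirical_measure[OF N0 x])
    qed
  qed
  also have "\<dots> = ennreal (expectation ?b)"
    using b0 by (intro nn_integral_eq_integral bint) auto
  also have "expectation ?b = ?c + ?Q * (\<Sum>i\<le>n. expectation (?e i)) + expectation ?d + 2 * ?\<tau>"
    using d(2) e(2) by (simp add: prob_space)
  also have "ennreal \<dots> \<le> ennreal (?c + ?Q * (\<Sum>i\<le>n. ?s i) + w + 2 * ?\<tau>)"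
    using d(1) e(1) R by (intro ennreal_leI add_mono order_refl mult_left_mono sum_mono) auto
  finally show ?thesis .
qed

end

lemma tail_mean_tendsto_0:
  assumes f: "probability_density f" and int: "integrable (density_measure f) (\<lambda>y. y)"
  shows "(\<lambda>k. \<integral>y. y - min y (real k) \<partial>density_measure f) \<longlonglongrightarrow> 0"
proof -
  have "(\<lambda>k. \<integral>y. y - min y (real k) \<partial>density_measure f) \<longlonglongrightarrow> (\<integral>y. 0 \<partial>density_measure f)"
  proof (rule integral_dominated_convergence[where w = "\<lambda>y. \<bar>y\<bar>"])
    show "(\<lambda>y. y - min y (real k)) \<in> borel_measurable (density_measure f)" for k
      unfolding measurable_cong_sets[OF sets_density_measure refl] by measurable
    show "AE y in density_measure f. (\<lambda>k. y - min y (real k)) \<longlonglongrightarrow> 0"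
    proof (rule AE_I2)
      fix y :: real
      obtain k0 where "y \<le> real k0" using real_arch_simple by blast
      then have "\<forall>\<^sub>F k in sequentially. y - min y (real k) = 0"
        by (intro eventually_sequentiallyI[of k0]) (auto simp: min_def)
      then show "(\<lambda>k. y - min y (real k)) \<longlonglongrightarrow> 0" by (rule tendsto_eventually)
    qed
    have sp: "space (density_measure f) = {0..}"
      using sets_eq_imp_space_eq[OF sets_density_measure[of f]] by simp
    show "AE y in density_measure f. norm (y - min y (real k)) \<le> \<bar>y\<bar>" for k
      by (rule AE_I2) (auto simp: sp min_def)
    show "integrable (density_measure f) (\<lambda>y. \<bar>y\<bar>)" using int by (rule integrable_abs)
  qed (rule measurable_const, simp)
  then show ?thesis by simp
qed

theorem theorem3:
  fixes M :: "nat \<Rightarrow> 'w measure"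
    and X :: "nat \<Rightarrow> real \<Rightarrow> 'w \<Rightarrow> nat \<Rightarrow> real"
    and K :: "nat \<Rightarrow> nat set \<Rightarrow> real \<Rightarrow> 'w \<Rightarrow> nat"
    and \<rho> :: "real \<Rightarrow> real \<Rightarrow> real"
    and T t :: real
  assumes system: "\<And>N. 2 \<le> N \<Longrightarrow> repeated_averaging (M N) N (X N) (K N)"
    and solution: "averaging_solution \<rho>"
    and initial: "(\<lambda>N. \<integral>\<^sup>+ \<omega>. wasserstein1 (empirical_measure N (X N 0 \<omega>)) (density_measure (\<rho> 0))
        \<partial>M N) \<longlonglongrightarrow> 0"
    and "0 < T" and "0 \<le> t" and "t \<le> T"
  shows "(\<lambda>N. \<integral>\<^sup>+ \<omega>. wasserstein1 (empirical_measure N (X N t \<omega>)) (density_measure (\<rho> t))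
        \<partial>M N) \<longlonglongrightarrow> 0"
proof (cases "t = 0")
  case True
  then show ?thesis using initial by simp
next
  case False
  then have t: "0 < t" and t0: "0 \<le> t" using \<open>0 \<le> t\<close> by simp_all
  let ?\<nu> = "\<lambda>s. density_measure (\<rho> s)"
  define W where "W s N = (\<integral>\<^sup>+ \<omega>. wasserstein1 (empirical_measure N (X N s \<omega>)) (?\<nu> s) \<partial>M N)" for s N
  define w where "w N = enn2real (W 0 N)" for N
  have W0: "W 0 \<longlonglongrightarrow> 0" using initial by (simp add: W_def[abs_def])
  have w0: "w \<longlonglongrightarrow> 0"
    using tendsto_enn2real[OF W0[folded ennreal_0]] by (simp add: w_def[abs_def])
  have "\<forall>\<^sub>F N in sequentially. W 0 N < 1" using W0 by (rule order_tendstoD(2)) simp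
  then have ev: "\<forall>\<^sub>F N in sequentially. 2 \<le> N \<and> W 0 N < 1"
    using eventually_ge_at_top[of 2] by eventually_elim simp
  have wN: "0 \<le> w N" "W 0 N \<le> ennreal (w N)" if "W 0 N < 1" for N
    using that by (auto simp: w_def ennreal_enn2real_if intro!: order_less_imp_le)
  have dens: "prob_space (?\<nu> s)" if "0 \<le> s" for s
    by (rule prob_space_density_measure[OF solution_density[OF solution that]])
  \<comment> \<open>A single system at finite expected distance suffices for the mean of \<open>\<rho>(0)\<close> to be finite.\<close>
  obtain N1 where N1: "2 \<le> N1" "W 0 N1 < 1" using eventually_happens[OF ev] by auto
  interpret N1: repeated_averaging "M N1" N1 "X N1" "K N1" by (rule system[OF N1(1)])
  have int0: "integrable (?\<nu> 0) (\<lambda>y. y)"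
    by (rule N1.mean_finite_if_wasserstein1_finite[OF solution N1(1)])
       (use N1(2) in \<open>simp add: W_def less_trans[OF _ ennreal_one_less_top]\<close>)
  let ?m = "\<lambda>s. \<integral>y. y \<partial>?\<nu> s"
  let ?s = "\<lambda>l N. sqrt (exp (2 * t) * (l * w N + 2 * t / real N))"
  have root: "(\<lambda>N. ?s l N) \<longlonglongrightarrow> 0" for l
  proof -
    have "(\<lambda>N. ?s l N) \<longlonglongrightarrow> sqrt (exp (2 * t) * (l * 0 + 0))"
      by (intro tendsto_real_sqrt tendsto_mult tendsto_add tendsto_const w0 lim_const_over_n)
    then show ?thesis by simp
  qed
  have slope: "1 - laplace (?\<nu> t) l \<le> ?m 0 * l" if l: "0 < l" for l
  proof -
    have "(\<lambda>N. (?m 0 + w N) * l + ?s l N) \<longlonglongrightarrow> (?m 0 + 0) * l + 0"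
      by (intro tendsto_add tendsto_mult tendsto_const w0 root)
    moreover have "\<forall>\<^sub>F N in sequentially. 1 - laplace (?\<nu> t) l \<le> (?m 0 + w N) * l + ?s l N"
      using ev
    proof eventually_elim
      case (elim N)
      then interpret P: repeated_averaging "M N" N "X N" "K N" using system by blast
      show ?case
        by (rule P.laplace_slope_later_le[OF solution _ t l int0]) (use elim wN[of N] in \<open>auto simp: W_def\<close>)
    qed
    ultimately show ?thesis using tendsto_lowerbound by fastforce
  qed
  have intt: "integrable (?\<nu> t) (\<lambda>y. y)" and mle: "?m t \<le> ?m 0"
    using integrable_id_if_laplace_slope_bounded[OF dens[OF t0] _ slope] by simp_all
  have "?m 0 \<le> ?m t"
  proof (rule integrable_id_if_laplace_slope_bounded(2)[OF dens[OF order_refl]])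
    fix l :: real assume l: "0 < l"
    have "laplace (?\<nu> t) l \<le> laplace (?\<nu> 0) l"
      by (rule laplace_decreasing_in_time[OF solution _ t0]) (use l in simp)
    moreover have "1 - laplace (?\<nu> t) l \<le> ?m t * l"
      by (rule laplace_slope_le_mean[OF dens[OF t0] _ intt]) (use l in auto)
    ultimately show "1 - laplace (?\<nu> 0) l \<le> ?m t * l" by linarith
  qed simp
  with mle have mean: "?m t = ?m 0" by simp
  show ?thesis
    unfolding W_def[symmetric]
  proof (rule order_tendstoI)
    fix a :: ennreal assume "0 < a"
    then obtain \<epsilon> where \<epsilon>: "0 < \<epsilon>" and a: "ennreal \<epsilon> \<le> a"
    proof (cases a)
      case (real r)
      with \<open>0 < a\<close> that[of r] show thesis by simp
    next
      case top
      with that[of 1] show thesis by simp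
    qed
    \<comment> \<open>The cut-off \<open>R\<close> makes the tail small, then the degree \<open>n\<close> makes the Bernstein error small, and
      only then \<open>N\<close> is taken large.\<close>
    have "\<forall>\<^sub>F k in sequentially. (\<integral>y. y - min y (real k) \<partial>?\<nu> t) < \<epsilon> / 8"
      by (rule order_tendstoD(2)[OF tail_mean_tendsto_0[OF solution_density[OF solution t0] intt]]) (use \<epsilon> in simp)
    then obtain k where k: "(\<integral>y. y - min y (real k) \<partial>?\<nu> t) < \<epsilon> / 8" using eventually_happens'[OF sequentially_bot] by blast
    define R where "R = real k"
    have "(\<lambda>n. 4 * exp R / sqrt (real n)) \<longlonglongrightarrow> 0"
      by (rule real_tendsto_divide_at_top[OF tendsto_const filterlim_compose[OF sqrt_at_top filterlim_real_sequentially]])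
    from order_tendstoD(2)[OF this, of "\<epsilon> / 4"] \<epsilon>
    have "\<forall>\<^sub>F n in sequentially. 0 < n \<and> 4 * exp R / sqrt (real n) < \<epsilon> / 4"
      using eventually_gt_at_top[of 0] by (simp add: eventually_conj)
    then obtain n where n: "0 < n" "4 * exp R / sqrt (real n) < \<epsilon> / 4" using eventually_happens'[OF sequentially_bot] by blast
    let ?Q = "2 * R * real (Suc n) * 4 ^ n"
    let ?b = "\<lambda>N. ?Q * (\<Sum>i\<le>n. ?s (real i) N) + w N"
    have "?b \<longlonglongrightarrow> ?Q * (\<Sum>i\<le>n. 0) + 0"
      by (intro tendsto_add tendsto_mult tendsto_const tendsto_sum root w0)
    then have "\<forall>\<^sub>F N in sequentially. ?b N < \<epsilon> / 2"
      by (rule order_tendstoD(2)) (use \<epsilon> in simp)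
    with ev show "\<forall>\<^sub>F N in sequentially. W t N < a"
    proof eventually_elim
      case (elim N)
      then interpret P: repeated_averaging "M N" N "X N" "K N" using system by blast
      have "W t N \<le> ennreal (4 * exp R / sqrt (real n) + ?Q * (\<Sum>i\<le>n. ?s (real i) N)
          + w N + 2 * (\<integral>y. y - min y R \<partial>?\<nu> t))"
        unfolding W_def
        by (rule P.expectation_wasserstein1_le[OF solution _ t int0 intt mean])
           (use elim wN[of N] n in \<open>auto simp: W_def R_def\<close>)
      also have "\<dots> < ennreal \<epsilon>"
        using elim n(2) k \<epsilon> by (intro ennreal_lessI) (auto simp: R_def)
      finally show ?case using a by (rule less_le_trans)
    qed
  qed simp
qed

end
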